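(* Let $d\ge2$, $0<p<\infty$, $0<q\le\infty$, and $s=d/p$. (i) Let $1<q\le\infty$. Then there exists a constant $c$ such that $$(-\log|x|)^{-1/q'}|f(x)|\le c\,\|f|B^{d/p}_{p,q}(\mathbb{R}^d)\|$$ holds for all $0<|x|\le1/2$ and all $f\in RB^{d/p}_{p,q}(\mathbb{R}^d)$. (ii) Let $1<p<\infty$. Then there exists a constant $c$ such that $$(-\log|x|)^{-1/p'}|f(x)|\le c\,\|f|F^{d/p}_{p,q}(\mathbb{R}^d)\|$$ holds for all $0<|x|\le1/2$ and all $f\in RF^{d/p}_{p,q}(\mathbb{R}^d)$.
   Context: $q'=q/(q-1)$ (so $1/q'=1-1/q$, with $1/q'=1$ for $q=\infty$), similarly $p'$. Besov and Lizorkin-Triebel spaces on $\mathbb{R}^n$: let $\varphi_0\in C_0^\infty(\mathbb{R}^n)$ with $\varphi_0(\xi)=1$ for $|\xi|\le1$ and $\varphi_0(\xi)=0$ for $|\xi|\ge 3/2$, and $\varphi_j(\xi)=\varphi_0(2^{-j}\xi)-\varphi_0(2^{-j+1}\xi)$, $j\ge1$. Then $B^s_{p,q}(\mathbb{R}^n)$ consists of all $f\in\mathcal{S}'(\mathbb{R}^n)$ with $\big(\sum_{j\ge0}2^{jsq}\|\mathcal{F}^{-1}[\varphi_j\mathcal{F}f]\|_{L_p}^q\big)^{1/q}<\infty$, and, for $p<\infty$, $F^s_{p,q}(\mathbb{R}^n)$ of all $f\in\mathcal{S}'(\mathbb{R}^n)$ with $\big\|\big(\sum_{j\ge0}2^{jsq}|\mathcal{F}^{-1}[\varphi_j\mathcal{F}f](\cdot)|^q\big)^{1/q}\big\|_{L_p}<\infty$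 (usual modification for $q=\infty$); these expressions are the quasi-norms. $RE$ denotes the subset of radial elements of $E$ (invariant under all orthogonal transformations), with the quasi-norm of $E$. Radial elements of these spaces (with $s=d/p>1/p$) agree on $\mathbb{R}^d\setminus\{0\}$ with a continuous function, and $f(x)$, $x\neq0$, denotes the value of this continuous representative. *)

theory Defs
  imports "HOL-Analysis.Analysis"
begin

section \<open>Test functions, Schwartz functions and tempered distributions\<close>

definition dir_deriv :: "'a::real_normed_vector \<Rightarrow> ('a \<Rightarrow> complex) \<Rightarrow> 'a \<Rightarrow> complex" where
  "dir_deriv v f x = frechet_derivative f (at x) v"

fun dir_derivs :: "'a::real_normed_vector list \<Rightarrow> ('a \<Rightarrow> complex) \<Rightarrow> 'a \<Rightarrow> complex" where
  "dir_derivs [] f = f"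
| "dir_derivs (v # vs) f = dir_deriv v (dir_derivs vs f)"

text \<open>Partial derivatives are indexed by lists of basis vectors instead of multi-indices.
  Differentiability of every iterated partial derivative amounts to infinite differentiability.\<close>

definition smooth_fun :: "('a::euclidean_space \<Rightarrow> complex) \<Rightarrow> bool" where
  "smooth_fun f \<longleftrightarrow> (\<forall>vs. set vs \<subseteq> Basis \<longrightarrow> dir_derivs vs f differentiable_on UNIV)"

definition test_fun_on :: "'a::euclidean_space set \<Rightarrow> ('a \<Rightarrow> complex) \<Rightarrow> bool" where
  "test_fun_on U f \<longleftrightarrow>
     smooth_fun f \<and> compact (closure {x. f x \<noteq> 0}) \<and> closure {x. f x \<noteq> 0} \<subseteq> U"

definition schwartz_fun :: "('a::euclidean_space \<Rightarrow> complex) \<Rightarrow> bool" where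
  "schwartz_fun f \<longleftrightarrow> smooth_fun f \<and>
     (\<forall>vs N. set vs \<subseteq> Basis \<longrightarrow>
        bounded (range (\<lambda>x. of_real ((1 + norm x) ^ N) * dir_derivs vs f x)))"

definition schwartz_seminorm :: "nat \<Rightarrow> ('a::euclidean_space \<Rightarrow> complex) \<Rightarrow> real" where
  "schwartz_seminorm N f =
     (SUP (vs, x) \<in> {vs. set vs \<subseteq> Basis \<and> length vs \<le> N} \<times> UNIV.
        (1 + norm x) ^ N * norm (dir_derivs vs f x))"

text \<open>A distribution is a functional on all functions of which only the values at Schwartz
  functions matter.\<close>

type_synonym 'a distribution = "('a \<Rightarrow> complex) \<Rightarrow> complex"

definition tempered_distribution :: "'a::euclidean_space distribution \<Rightarrow> bool" where
  "tempered_distribution T \<longleftrightarrow>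
     (\<forall>f g. schwartz_fun f \<longrightarrow> schwartz_fun g \<longrightarrow> T (\<lambda>x. f x + g x) = T f + T g) \<and>
     (\<forall>a f. schwartz_fun f \<longrightarrow> T (\<lambda>x. a * f x) = a * T f) \<and>
     (\<exists>C N. \<forall>f. schwartz_fun f \<longrightarrow> norm (T f) \<le> C * schwartz_seminorm N f)"

definition agrees_with_on ::
    "'a::euclidean_space set \<Rightarrow> 'a distribution \<Rightarrow> ('a \<Rightarrow> complex) \<Rightarrow> bool" where
  "agrees_with_on U T g \<longleftrightarrow> continuous_on U g \<and>
     (\<forall>f. test_fun_on U f \<longrightarrow> T f = (LINT x|lborel. g x * f x))"

definition radial_distribution :: "'a::euclidean_space distribution \<Rightarrow> bool" where
  "radial_distribution T \<longleftrightarrow>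
     (\<forall>A f. orthogonal_transformation A \<longrightarrow> schwartz_fun f \<longrightarrow> T (f \<circ> A) = T f)"

definition radial_part :: "'a::euclidean_space distribution set \<Rightarrow> 'a distribution set" where
  "radial_part E = {f \<in> E. radial_distribution f}"


section \<open>Fourier transform\<close>

definition fourier :: "('a::euclidean_space \<Rightarrow> complex) \<Rightarrow> 'a \<Rightarrow> complex" where
  "fourier f \<xi> = of_real ((2 * pi) powr (- real DIM('a) / 2)) *
     (LINT x|lborel. cis (- (x \<bullet> \<xi>)) * f x)"

definition fourier_inv :: "('a::euclidean_space \<Rightarrow> complex) \<Rightarrow> 'a \<Rightarrow> complex" where
  "fourier_inv f x = of_real ((2 * pi) powr (- real DIM('a) / 2)) *
     (LINT \<xi>|lborel. cis (x \<bullet> \<xi>) * f \<xi>)"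

definition fourier_dist :: "'a::euclidean_space distribution \<Rightarrow> 'a distribution" where
  "fourier_dist T f = T (fourier f)"

definition fourier_inv_dist :: "'a::euclidean_space distribution \<Rightarrow> 'a distribution" where
  "fourier_inv_dist T f = T (fourier_inv f)"

definition mult_dist :: "('a \<Rightarrow> complex) \<Rightarrow> 'a distribution \<Rightarrow> 'a distribution" where
  "mult_dist m T f = T (\<lambda>x. m x * f x)"


section \<open>Littlewood-Paley decomposition\<close>

definition lp_generator :: "('a::euclidean_space \<Rightarrow> complex) \<Rightarrow> bool" where
  "lp_generator \<phi> \<longleftrightarrow> test_fun_on UNIV \<phi> \<and>
     (\<forall>\<xi>. norm \<xi> \<le> 1 \<longrightarrow> \<phi> \<xi> = 1) \<and> (\<forall>\<xi>. norm \<xi> \<ge> 3/2 \<longrightarrow> \<phi> \<xi> = 0)"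

definition lp_cutoff :: "('a::euclidean_space \<Rightarrow> complex) \<Rightarrow> nat \<Rightarrow> 'a \<Rightarrow> complex" where
  "lp_cutoff \<phi> j \<xi> =
     (if j = 0 then \<phi> \<xi>
      else \<phi> ((2 powr (- real j)) *\<^sub>R \<xi>) - \<phi> ((2 powr (- real j + 1)) *\<^sub>R \<xi>))"

text \<open>The inverse Fourier transform of a compactly supported distribution is a continuous
  (indeed analytic) function by the Paley-Wiener-Schwartz theorem; the definition
  selects this function.\<close>

definition lp_block ::
    "('a::euclidean_space \<Rightarrow> complex) \<Rightarrow> nat \<Rightarrow> 'a distribution \<Rightarrow> 'a \<Rightarrow> complex" where
  "lp_block \<phi> j T =
     (THE g. agrees_with_on UNIV
               (fourier_inv_dist (mult_dist (lp_cutoff \<phi> j) (fourier_dist T))) g)"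


section \<open>Besov and Lizorkin-Triebel spaces\<close>

text \<open>Real powers of extended non-negative numbers, for positive exponents only.\<close>

definition enn_powr :: "ennreal \<Rightarrow> real \<Rightarrow> ennreal" where
  "enn_powr x a = (if x = \<infinity> then \<infinity> else ennreal (enn2real x powr a))"

definition Lp_norm :: "real \<Rightarrow> ('a::euclidean_space \<Rightarrow> ennreal) \<Rightarrow> ennreal" where
  "Lp_norm p u = enn_powr (\<integral>\<^sup>+ x. enn_powr (u x) p \<partial>lborel) (1 / p)"

definition lq_norm :: "ennreal \<Rightarrow> (nat \<Rightarrow> ennreal) \<Rightarrow> ennreal" where
  "lq_norm q a =
     (if q = \<infinity> then (SUP j. a j)
      else enn_powr (\<Sum>j. enn_powr (a j) (enn2real q)) (1 / enn2real q))"

definition besov_norm ::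
    "('a::euclidean_space \<Rightarrow> complex) \<Rightarrow> real \<Rightarrow> real \<Rightarrow> ennreal \<Rightarrow> 'a distribution \<Rightarrow> ennreal" where
  "besov_norm \<phi> s p q f =
     lq_norm q (\<lambda>j. ennreal (2 powr (real j * s)) *
                    Lp_norm p (\<lambda>x. ennreal (norm (lp_block \<phi> j f x))))"

definition triebel_norm ::
    "('a::euclidean_space \<Rightarrow> complex) \<Rightarrow> real \<Rightarrow> real \<Rightarrow> ennreal \<Rightarrow> 'a distribution \<Rightarrow> ennreal" where
  "triebel_norm \<phi> s p q f =
     Lp_norm p (\<lambda>x. lq_norm q (\<lambda>j. ennreal (2 powr (real j * s)) *
                                   ennreal (norm (lp_block \<phi> j f x))))"

definition besov_space ::
    "('a::euclidean_space \<Rightarrow> complex) \<Rightarrow> real \<Rightarrow> real \<Rightarrow> ennreal \<Rightarrow> 'a distribution set" where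
  "besov_space \<phi> s p q = {f. tempered_distribution f \<and> besov_norm \<phi> s p q f < \<infinity>}"

definition triebel_space ::
    "('a::euclidean_space \<Rightarrow> complex) \<Rightarrow> real \<Rightarrow> real \<Rightarrow> ennreal \<Rightarrow> 'a distribution set" where
  "triebel_space \<phi> s p q = {f. tempered_distribution f \<and> triebel_norm \<phi> s p q f < \<infinity>}"

text \<open>The reciprocal of the conjugate exponent of \<open>q\<close>.\<close>

definition inv_conj_exponent :: "ennreal \<Rightarrow> real" where
  "inv_conj_exponent q = (if q = \<infinity> then 1 else 1 - 1 / enn2real q)"

end

theory Submission
  imports Defs "HOL-Probability.Probability"
begin


text \<open>Write \<open>f\<^sub>i\<close> for the Littlewood-Paley blocks and let \<open>\<psi>\<close> be a radial cutoff function of integral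
  zero. The radial blocks \<open>g\<^sub>j\<close> built from \<open>\<psi>\<close> sum up to \<open>f\<close> and are convolutions of finitely many
  neighbouring \<open>f\<^sub>i\<close> with kernels concentrated at scale \<open>1 / 2 ^ j\<close>. Hence \<open>g\<^sub>j x\<close> is at most a constant
  times \<open>2 powr (j * d / p)\<close> times the \<open>L\<^sub>p\<close> norms of those \<open>f\<^sub>i\<close>; by averaging over the sphere through \<open>x\<close>
  one gains the factor \<open>(2 ^ j * norm x) powr (- 1 / p)\<close>, so that the \<open>j\<close> with
  \<open>2 ^ j * norm x \<ge> 1\<close> contribute a geometric series. There remain about \<open>- ln (norm x)\<close> indices, to
  which Hoelder's inequality for sums applies. In the Lizorkin-Triebel case the \<open>p\<close>-th powers of all
  \<open>g\<^sub>j x\<close> can be summed without loss: since \<open>\<psi>\<close> has integral zero, the kernels vanish at the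
  origin, and their dilates have a bounded sum. Exponents \<open>p < 1\<close> are reduced to \<open>p = 1\<close> by
  Nikolskii's inequality.\<close>

section \<open>Differentiable functions\<close>

text \<open>The generator that defines the spaces is not assumed to be radial, so the blocks
  \<open>lp_block\<close> of a radial distribution need not be radial and cannot be averaged over
  spheres. This obstacle forces the second generator. The identity linking both families lives on
  the frequency side: near the support of one radial cutoff, finitely many of the given cutoffs sum
  to 1. The smoothness s = d/p is critical: with a_i denoting 2^(i d/p) times the L_p norm of block
  i, the scales with 2^j |x| < 1 are bounded by the a_i without any decay in j. They can only be
  counted, and this count is the logarithm. In the Lizorkin-Triebel case only the supremum over the
  scales enters, so the summability exponent is p and not q. A distribution is here a functional
  that is constrained on Schwartz functions only, and a block is given by a definite description.
  Hence every function handed to T must first be shown to be Schwartz, T must be exchanged with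
  integrals over translated kernels, and blocks must be identified with convolutions before any
  estimate can start.\<close>

lemma dir_deriv_eqI: "(f has_derivative f') (at x) \<Longrightarrow> dir_deriv v f x = f' v"
  unfolding dir_deriv_def by (metis frechet_derivative_at)

lemma dir_deriv_ext:
  assumes "\<And>x. (f has_derivative f' x) (at x)"
  shows "dir_deriv v f = (\<lambda>x. f' x v)"
  using dir_deriv_eqI[OF assms] by auto

lemma dir_derivs_append: "dir_derivs (vs @ ws) f = dir_derivs vs (dir_derivs ws f)"
  by (induction vs) auto

text \<open>Smoothness graded by order. Differentiating a product or a composite yields sums of
  products of other functions, so the closure properties need an induction on the order in which the
  functions are generalised.\<close>

definition diff_upto :: "nat \<Rightarrow> ('a::euclidean_space \<Rightarrow> complex) \<Rightarrow> bool" where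
  "diff_upto n f \<longleftrightarrow>
     (\<forall>vs. set vs \<subseteq> Basis \<and> length vs \<le> n \<longrightarrow> dir_derivs vs f differentiable_on UNIV)"

lemma smooth_fun_iff: "smooth_fun f \<longleftrightarrow> (\<forall>n. diff_upto n f)"
  unfolding smooth_fun_def diff_upto_def by auto

lemma diff_upto_0: "diff_upto 0 f \<longleftrightarrow> f differentiable_on UNIV"
  unfolding diff_upto_def by auto

text \<open>The last entry of a list is the derivative taken first. Peeling the list from that end
  leaves lists of length at most n applied to a first derivative.\<close>

lemma diff_upto_Suc:
  "diff_upto (Suc n) f \<longleftrightarrow> f differentiable_on UNIV \<and> (\<forall>b\<in>Basis. diff_upto n (dir_deriv b f))"
proof (intro iffI conjI ballI)
  assume f: "diff_upto (Suc n) f"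
  show "f differentiable_on UNIV"
    using f[unfolded diff_upto_def, rule_format, of "[]"] by simp
  show "diff_upto n (dir_deriv b f)" if "b \<in> Basis" for b
    unfolding diff_upto_def
  proof (intro allI impI)
    fix vs :: "'a list" assume "set vs \<subseteq> Basis \<and> length vs \<le> n"
    then show "dir_derivs vs (dir_deriv b f) differentiable_on UNIV"
      using f[unfolded diff_upto_def, rule_format, of "vs @ [b]"] that
      by (simp add: dir_derivs_append)
  qed
next
  assume *: "f differentiable_on UNIV \<and> (\<forall>b\<in>Basis. diff_upto n (dir_deriv b f))"
  show "diff_upto (Suc n) f"
    unfolding diff_upto_def
  proof (intro allI impI)
    fix vs :: "'a list" assume vs: "set vs \<subseteq> Basis \<and> length vs \<le> Suc n"
    show "dir_derivs vs f differentiable_on UNIV"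
    proof (cases vs rule: rev_cases)
      case Nil
      then show ?thesis using * by simp
    next
      case (snoc ws b)
      then show ?thesis using * vs unfolding diff_upto_def
        by (simp add: dir_derivs_append)
    qed
  qed
qed

lemma diff_upto_mono: "diff_upto n f \<Longrightarrow> m \<le> n \<Longrightarrow> diff_upto m f"
  unfolding diff_upto_def by auto

lemma diff_upto_Suc_imp: "diff_upto (Suc n) f \<Longrightarrow> diff_upto n f"
  by (rule diff_upto_mono) auto

lemma diff_upto_differentiable: "diff_upto n f \<Longrightarrow> f differentiable (at x)"
  using diff_upto_mono[of n f 0] by (auto simp: diff_upto_0 differentiable_on_def)

lemma diff_upto_has_derivative:
  assumes "diff_upto n f"
  shows "(f has_derivative (\<lambda>v. dir_deriv v f x)) (at x)"
  using diff_upto_differentiable[OF assms, of x]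
  by (simp add: dir_deriv_def[abs_def] frechet_derivative_works)

lemma smooth_fun_has_derivative:
  assumes "smooth_fun f"
  shows "(f has_derivative (\<lambda>v. dir_deriv v f x)) (at x)"
  using assms diff_upto_has_derivative unfolding smooth_fun_iff by blast

lemma smooth_fun_dir_derivs:
  assumes "smooth_fun f" "set vs \<subseteq> Basis"
  shows "smooth_fun (dir_derivs vs f)"
  using assms unfolding smooth_fun_def dir_derivs_append[symmetric] by auto

lemma smooth_fun_dir_deriv:
  assumes "smooth_fun f" "b \<in> Basis"
  shows "smooth_fun (dir_deriv b f)"
  using smooth_fun_dir_derivs[of f "[b]"] assms by simp

lemma smooth_fun_continuous: "smooth_fun f \<Longrightarrow> continuous_on S f"
  by (meson continuous_at_imp_continuous_on has_derivative_continuous smooth_fun_has_derivative)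

lemma dir_deriv_const: "dir_deriv v (\<lambda>x. c) = (\<lambda>x. 0)"
  by (rule ext, rule dir_deriv_eqI) simp

lemma diff_upto_const: "diff_upto n (\<lambda>x. c)"
  by (induction n arbitrary: c) (auto simp: diff_upto_0 diff_upto_Suc dir_deriv_const)

lemma dir_deriv_add:
  assumes "diff_upto n f" "diff_upto n g"
  shows "dir_deriv v (\<lambda>x. f x + g x) = (\<lambda>x. dir_deriv v f x + dir_deriv v g x)"
  by (rule ext, rule dir_deriv_eqI)
    (intro has_derivative_add diff_upto_has_derivative[OF assms(1)] diff_upto_has_derivative[OF assms(2)])

lemma dir_deriv_mult:
  assumes "diff_upto n f" "diff_upto n g"
  shows "dir_deriv v (\<lambda>x. f x * g x) = (\<lambda>x. f x * dir_deriv v g x + dir_deriv v f x * g x)"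
  by (rule ext, rule dir_deriv_eqI)
    (intro has_derivative_mult diff_upto_has_derivative[OF assms(1)] diff_upto_has_derivative[OF assms(2)])

lemma diff_upto_add:
  "diff_upto n f \<Longrightarrow> diff_upto n g \<Longrightarrow> diff_upto n (\<lambda>x. f x + g x)"
proof (induction n arbitrary: f g)
  case 0
  then show ?case by (auto simp: diff_upto_0 intro: differentiable_on_add)
next
  case (Suc n)
  then show ?case
    by (auto simp: diff_upto_Suc dir_deriv_add[OF Suc.prems] intro: differentiable_on_add)
qed

lemma diff_upto_mult:
  "diff_upto n f \<Longrightarrow> diff_upto n g \<Longrightarrow> diff_upto n (\<lambda>x. f x * g x)"
proof (induction n arbitrary: f g)
  case 0
  then show ?case by (auto simp: diff_upto_0 intro: differentiable_on_mult)
next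
  case (Suc n)
  have "diff_upto n f" "diff_upto n g" using Suc.prems by (auto intro: diff_upto_Suc_imp)
  then show ?case
    using Suc.prems
    by (auto simp: diff_upto_Suc dir_deriv_mult[OF Suc.prems]
        intro!: differentiable_on_mult diff_upto_add Suc.IH)
qed

lemma diff_upto_sum:
  "(\<And>i. i \<in> I \<Longrightarrow> diff_upto n (f i)) \<Longrightarrow> diff_upto n (\<lambda>x. \<Sum>i\<in>I. f i x)"
  by (induction I rule: infinite_finite_induct) (auto intro: diff_upto_const diff_upto_add)

lemma smooth_fun_const: "smooth_fun (\<lambda>x. c)"
  by (simp add: smooth_fun_iff diff_upto_const)

lemma smooth_fun_add: "smooth_fun f \<Longrightarrow> smooth_fun g \<Longrightarrow> smooth_fun (\<lambda>x. f x + g x)"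
  by (simp add: smooth_fun_iff diff_upto_add)

lemma smooth_fun_mult: "smooth_fun f \<Longrightarrow> smooth_fun g \<Longrightarrow> smooth_fun (\<lambda>x. f x * g x)"
  by (simp add: smooth_fun_iff diff_upto_mult)

lemma smooth_fun_sum:
  "(\<And>i. i \<in> I \<Longrightarrow> smooth_fun (f i)) \<Longrightarrow> smooth_fun (\<lambda>x. \<Sum>i\<in>I. f i x)"
  by (simp add: smooth_fun_iff diff_upto_sum)

lemma smooth_fun_inner: "smooth_fun (\<lambda>x. complex_of_real (x \<bullet> b))"
proof -
  have deriv: "((\<lambda>x. complex_of_real (x \<bullet> b)) has_derivative (\<lambda>v. complex_of_real (v \<bullet> b))) (at x)" for x :: 'a
    by (auto intro!: derivative_eq_intros)
  have "diff_upto n (\<lambda>x. complex_of_real (x \<bullet> b))" for n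
  proof (cases n)
    case 0
    then show ?thesis using deriv by (auto simp: diff_upto_0 differentiable_on_def differentiable_def)
  next
    case (Suc m)
    then show ?thesis using deriv
      by (auto simp: diff_upto_Suc differentiable_on_def differentiable_def dir_deriv_ext[OF deriv]
          intro: diff_upto_const)
  qed
  then show ?thesis by (simp add: smooth_fun_iff)
qed

lemma smooth_fun_cnj:
  assumes "smooth_fun f"
  shows "smooth_fun (\<lambda>x. cnj (f x))"
proof -
  have "diff_upto n (\<lambda>x. cnj (f x))" if "diff_upto n f" for n and f :: "'a \<Rightarrow> complex"
    using that
  proof (induction n arbitrary: f)
    case 0
    then show ?case
      by (auto simp: diff_upto_0 differentiable_on_def differentiable_def intro: has_derivative_cnj)
  next
    case (Suc n)
    have "((\<lambda>x. cnj (f x)) has_derivative (\<lambda>v. cnj (dir_deriv v f x))) (at x)" for x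
      by (intro has_derivative_cnj diff_upto_has_derivative[OF Suc.prems])
    from this dir_deriv_ext[OF this] show ?case using Suc
      by (auto simp: diff_upto_Suc differentiable_on_def differentiable_def)
  qed
  then show ?thesis using assms by (simp add: smooth_fun_iff)
qed

text \<open>Chain rule in coordinates: the derivative in direction v is the sum over b of the b-th
  partial derivative of f at g x times the derivative of the b-th component of g. The components are
  embedded into the complex numbers because \<open>diff_upto\<close> speaks of complex functions
  only.\<close>

lemma diff_upto_compose:
  fixes f :: "'b::euclidean_space \<Rightarrow> complex" and g :: "'a::euclidean_space \<Rightarrow> 'b"
  assumes "diff_upto n f" "\<forall>b\<in>Basis. diff_upto n (\<lambda>x. complex_of_real (g x \<bullet> b))"
  shows "diff_upto n (\<lambda>x. f (g x))"
  using assms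
proof (induction n arbitrary: f)
  have deriv: "((\<lambda>x. f (g x)) has_derivative
      (\<lambda>v. \<Sum>b\<in>Basis. dir_deriv b f (g x) * dir_deriv v (\<lambda>x. complex_of_real (g x \<bullet> b)) x)) (at x)"
    if f: "diff_upto n f" and g: "\<forall>b\<in>Basis. diff_upto n (\<lambda>x. complex_of_real (g x \<bullet> b))"
    for n f x
  proof -
    define D where "D b v = dir_deriv v (\<lambda>x. complex_of_real (g x \<bullet> b)) x" for b v
    have D: "((\<lambda>x. complex_of_real (g x \<bullet> b)) has_derivative D b) (at x)" if "b \<in> Basis" for b
      unfolding D_def using bspec[OF g that] by (rule diff_upto_has_derivative)
    have D': "((\<lambda>x. g x \<bullet> b) has_derivative (\<lambda>v. Re (D b v))) (at x)" if "b \<in> Basis" for b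
      using has_derivative_Re[OF D[OF that]] by simp
    \<comment> \<open>The derivative of an embedded real component takes real values, by uniqueness
      of derivatives; so nothing is lost in passing to the real part.\<close>
    have ofD: "complex_of_real (Re (D b v)) = D b v" if "b \<in> Basis" for b v
      using has_derivative_unique[OF bounded_linear.has_derivative[OF bounded_linear_of_real D'[OF that]] D[OF that]]
      by (rule fun_cong)
    have gd: "(g has_derivative (\<lambda>v. \<Sum>b\<in>Basis. Re (D b v) *\<^sub>R b)) (at x)"
      by (subst has_derivative_componentwise_within) (auto simp: inner_sum_left inner_Basis if_distrib D' cong: if_cong)
    have "((\<lambda>x. f (g x)) has_derivative (\<lambda>v. dir_deriv (\<Sum>b\<in>Basis. Re (D b v) *\<^sub>R b) f (g x))) (at x)"
      using has_derivative_compose[OF gd diff_upto_has_derivative[OF f, of "g x"]] .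
    moreover have "dir_deriv (\<Sum>b\<in>Basis. Re (D b v) *\<^sub>R b) f (g x) = (\<Sum>b\<in>Basis. dir_deriv b f (g x) * D b v)" for v
    proof -
      interpret bounded_linear "\<lambda>v. dir_deriv v f (g x)"
        using diff_upto_has_derivative[OF f, of "g x"] by (rule has_derivative_bounded_linear)
      show ?thesis
        by (simp add: sum scale scaleR_conv_of_real ofD mult.commute)
    qed
    ultimately show ?thesis by (simp add: D_def)
  qed
  {
    case 0
    show ?case
      unfolding diff_upto_0 differentiable_on_def using deriv[OF 0] by (intro ballI differentiableI)
  next
    case (Suc n)
    have IH: "diff_upto n (\<lambda>x. h (g x))" if "diff_upto n h" for h
      using that Suc.prems(2) by (intro Suc.IH) (auto intro: diff_upto_Suc_imp)
    show ?case
      unfolding diff_upto_Suc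
    proof (intro conjI ballI)
      show "(\<lambda>x. f (g x)) differentiable_on UNIV"
        using deriv[OF Suc.prems] by (auto simp: differentiable_on_def differentiable_def)
      fix v :: 'a assume v: "v \<in> Basis"
      have f': "diff_upto n (\<lambda>x. dir_deriv b f (g x))" if "b \<in> Basis" for b
        using Suc.prems(1) that by (intro IH) (simp add: diff_upto_Suc)
      have g': "diff_upto n (dir_deriv v (\<lambda>x. complex_of_real (g x \<bullet> b)))" if "b \<in> Basis" for b
        using bspec[OF Suc.prems(2) that] v by (simp add: diff_upto_Suc)
      show "diff_upto n (dir_deriv v (\<lambda>x. f (g x)))"
        unfolding dir_deriv_ext[OF deriv[OF Suc.prems]]
        by (intro diff_upto_sum diff_upto_mult f' g')
    qed
  }
qed

lemma smooth_fun_compose: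
  fixes f :: "'b::euclidean_space \<Rightarrow> complex" and g :: "'a::euclidean_space \<Rightarrow> 'b"
  assumes "smooth_fun f" "\<And>b. b \<in> Basis \<Longrightarrow> smooth_fun (\<lambda>x. complex_of_real (g x \<bullet> b))"
  shows "smooth_fun (\<lambda>x. f (g x))"
  using assms diff_upto_compose unfolding smooth_fun_iff by blast

lemma smooth_fun_affine:
  assumes "smooth_fun f"
  shows "smooth_fun (\<lambda>x. f (a + c *\<^sub>R x))"
proof (rule smooth_fun_compose[OF assms])
  fix b :: 'a
  have "smooth_fun (\<lambda>x. complex_of_real (a \<bullet> b) + complex_of_real c * complex_of_real (x \<bullet> b))"
    by (intro smooth_fun_add smooth_fun_mult smooth_fun_const smooth_fun_inner)
  then show "smooth_fun (\<lambda>x. complex_of_real ((a + c *\<^sub>R x) \<bullet> b))"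
    by (simp add: inner_add_left)
qed

text \<open>Dominated convergence for the difference quotients along an arbitrary null sequence: the
  Lipschitz bound and the bound on the derivative contribute B each, so 2 B is a majorant.\<close>

lemma has_derivative_lebesgue_integral:
  fixes f :: "'a::euclidean_space \<Rightarrow> 'b \<Rightarrow> complex"
  assumes D: "\<And>w. w \<in> space M \<Longrightarrow> ((\<lambda>y. f y w) has_derivative D w) (at x)"
    and f: "\<And>y. integrable M (f y)"
    and Di: "\<And>v. integrable M (\<lambda>w. D w v)"
    and B: "integrable M B"
    and lip: "\<And>y w. w \<in> space M \<Longrightarrow> norm (y - x) \<le> 1 \<Longrightarrow> norm (f y w - f x w) \<le> B w * norm (y - x)"
    and DB: "\<And>v w. w \<in> space M \<Longrightarrow> norm (D w v) \<le> B w * norm v"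
  shows "((\<lambda>y. \<integral>w. f y w \<partial>M) has_derivative (\<lambda>v. \<integral>w. D w v \<partial>M)) (at x)"
  unfolding has_derivative_at
proof
  have lin: "D w (a + b) = D w a + D w b" "D w (r *\<^sub>R a) = r *\<^sub>R D w a" if "w \<in> space M" for w a b r
    using has_derivative_bounded_linear[OF D[OF that]] by (auto simp: bounded_linear.linear linear_add linear_scale)
  show "bounded_linear (\<lambda>v. \<integral>w. D w v \<partial>M)"
  proof (rule bounded_linear_intro[where K="\<integral>w. B w \<partial>M"])
    show "(\<integral>w. D w (a + b) \<partial>M) = (\<integral>w. D w a \<partial>M) + (\<integral>w. D w b \<partial>M)" for a b
      by (subst Bochner_Integration.integral_add[symmetric])
        (auto intro!: Di Bochner_Integration.integral_cong simp: lin)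
    show "(\<integral>w. D w (r *\<^sub>R a) \<partial>M) = r *\<^sub>R (\<integral>w. D w a \<partial>M)" for a r
      by (simp add: lin Di cong: Bochner_Integration.integral_cong)
    show "norm (\<integral>w. D w a \<partial>M) \<le> norm a * (\<integral>w. B w \<partial>M)" for a
    proof -
      have "norm (\<integral>w. D w a \<partial>M) \<le> (\<integral>w. B w * norm a \<partial>M)"
        by (intro order_trans[OF integral_norm_bound] integral_mono) (auto intro!: Di B DB)
      then show ?thesis by (simp add: mult.commute)
    qed
  qed
  have "(\<lambda>n. norm ((\<integral>w. f (x + h n) w \<partial>M) - (\<integral>w. f x w \<partial>M) - (\<integral>w. D w (h n) \<partial>M)) / norm (h n)) \<longlonglongrightarrow> 0"
    if h: "h \<longlonglongrightarrow> 0" "\<And>n. h n \<noteq> 0" for h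
  proof -
    have "eventually (\<lambda>n. norm (h n) < 1) sequentially"
      using order_tendstoD(2)[OF tendsto_norm[OF h(1)], of 1] by simp
    then obtain N where N: "\<And>n. n \<ge> N \<Longrightarrow> norm (h n) < 1"
      by (auto simp: eventually_sequentially)
    \<comment> \<open>The shift by N keeps the increments below norm 1, where the Lipschitz
      hypothesis is available.\<close>
    define q where "q n w = (f (x + h (n + N)) w - f x w - D w (h (n + N))) /\<^sub>R norm (h (n + N))" for n w
    have "(\<lambda>n. \<integral>w. q n w \<partial>M) \<longlonglongrightarrow> (\<integral>w. 0 \<partial>M)"
    proof (rule integral_dominated_convergence[where w="\<lambda>w. 2 * B w"])
      show "q n \<in> borel_measurable M" for n
        unfolding q_def using f Di by (auto intro!: borel_measurable_scaleR borel_measurable_diff)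
      show "AE w in M. (\<lambda>n. q n w) \<longlonglongrightarrow> 0"
      proof (rule AE_I2)
        fix w assume w: "w \<in> space M"
        have *: "((\<lambda>y. norm (f (x + y) w - f x w - D w y) / norm y) \<longlongrightarrow> 0) (at 0)"
          using D[OF w] by (simp add: has_derivative_at)
        have "(\<lambda>n. norm (f (x + h n) w - f x w - D w (h n)) / norm (h n)) \<longlonglongrightarrow> 0"
          using tendsto_at_iff_sequentially[THEN iffD1, OF *, rule_format, of h] h by (simp add: o_def)
        from LIMSEQ_ignore_initial_segment[OF this, of N]
        have "(\<lambda>n. norm (q n w)) \<longlonglongrightarrow> 0"
          unfolding q_def by (simp add: divide_inverse mult.commute)
        then show "(\<lambda>n. q n w) \<longlonglongrightarrow> 0"
          by (rule tendsto_norm_zero_cancel)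
      qed
      show "AE w in M. norm (q n w) \<le> 2 * B w" for n
      proof (rule AE_I2)
        fix w assume w: "w \<in> space M"
        let ?h = "h (n + N)"
        have "norm (f (x + ?h) w - f x w - D w ?h) \<le> B w * norm ?h + B w * norm ?h"
          using lip[OF w, of "x + ?h"] DB[OF w, of ?h] N[of "n + N"]
            norm_triangle_ineq4[of "f (x + ?h) w - f x w" "D w ?h"] by auto
        moreover have "norm (q n w) = norm (f (x + ?h) w - f x w - D w ?h) / norm ?h"
          by (simp add: q_def divide_inverse mult.commute)
        ultimately show "norm (q n w) \<le> 2 * B w"
          using h(2)[of "n + N"] by (simp add: pos_divide_le_eq)
      qed
    qed (use B in auto)
    then have "(\<lambda>n. norm (\<integral>w. q n w \<partial>M)) \<longlonglongrightarrow> 0"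
      by (simp add: tendsto_norm_zero)
    moreover have "norm (\<integral>w. q n w \<partial>M) = norm ((\<integral>w. f (x + h (n + N)) w \<partial>M) - (\<integral>w. f x w \<partial>M) - (\<integral>w. D w (h (n + N)) \<partial>M)) / norm (h (n + N))" for n
      unfolding q_def using f Di by (simp add: divide_inverse mult.commute)
    ultimately show ?thesis
      using LIMSEQ_offset[of "\<lambda>n. norm ((\<integral>w. f (x + h n) w \<partial>M) - (\<integral>w. f x w \<partial>M) - (\<integral>w. D w (h n) \<partial>M)) / norm (h n)" N] by simp
  qed
  then show "((\<lambda>y. norm ((\<integral>w. f (x + y) w \<partial>M) - (\<integral>w. f x w \<partial>M) - (\<integral>w. D w y \<partial>M)) / norm y) \<longlongrightarrow> 0) (at 0)"
    by (intro tendsto_at_iff_sequentially[THEN iffD2] allI impI) (auto simp: o_def)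
qed

section \<open>Lebesgue measure\<close>

text \<open>A non-integrable f has integral 0 by convention, and g is nonnegative because it bounds
  a norm; so the estimate covers every f.\<close>

lemma integral_norm_bound_integral':
  fixes f :: "'a \<Rightarrow> 'b::{banach, second_countable_topology}"
  assumes "integrable M g" "\<And>x. norm (f x) \<le> g x"
  shows "norm (integral\<^sup>L M f) \<le> integral\<^sup>L M g"
proof (cases "integrable M f")
  case True
  show ?thesis
    by (intro order_trans[OF integral_norm_bound] integral_mono integrable_norm True assms)
next
  case False
  have "0 \<le> g x" for x using assms(2)[of x] norm_ge_zero order_trans by blast
  then show ?thesis using False by (simp add: not_integrable_integral_eq)
qed

lemma ennreal_norm_integral_le:
  fixes f :: "'a \<Rightarrow> 'b::{banach, second_countable_topology}"
  shows "ennreal (norm (integral\<^sup>L M f)) \<le> (\<integral>\<^sup>+x. ennreal (norm (f x)) \<partial>M)"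
  by (cases "integrable M f") (auto simp: integral_norm_bound_ennreal not_integrable_integral_eq)

lemma borel_measurable_cis [measurable (raw)]:
  "f \<in> borel_measurable M \<Longrightarrow> (\<lambda>x. cis (f x)) \<in> borel_measurable M"
  by (rule borel_measurable_continuous_on[OF continuous_on_cis[OF continuous_on_id]])

lemma lborel_distr_reflect: "distr lborel borel (\<lambda>x::'a::euclidean_space. a - x) = lborel"
proof -
  show ?thesis
    by (subst (2) lborel_affine[of "-1" a]) (simp_all add: density_1)
qed

lemma nn_integral_lborel_reflect:
  fixes f :: "'a::euclidean_space \<Rightarrow> ennreal"
  assumes "f \<in> borel_measurable borel"
  shows "(\<integral>\<^sup>+x. f (a - x) \<partial>lborel) = (\<integral>\<^sup>+x. f x \<partial>lborel)"
  by (subst (2) lborel_distr_reflect[of a, symmetric], subst nn_integral_distr) (use assms in auto)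

lemma integral_lborel_reflect:
  fixes f :: "'a::euclidean_space \<Rightarrow> 'b::{banach, second_countable_topology}"
  assumes "f \<in> borel_measurable borel"
  shows "(LINT x|lborel. f (a - x)) = (LINT x|lborel. f x)"
  by (subst (2) lborel_distr_reflect[of a, symmetric], subst integral_distr) (use assms in auto)

lemma integrable_lborel_reflect:
  fixes f :: "'a::euclidean_space \<Rightarrow> 'b::{banach, second_countable_topology}"
  assumes "integrable lborel f"
  shows "integrable lborel (\<lambda>x. f (a - x))"
  using assms
  by (subst (asm) lborel_distr_reflect[of a, symmetric], subst (asm) integrable_distr_eq) auto

lemma integral_lborel_translate:
  fixes f :: "'a::euclidean_space \<Rightarrow> 'b::{banach, second_countable_topology}"
  assumes "f \<in> borel_measurable borel"
  shows "(LINT x|lborel. f (a + x)) = (LINT x|lborel. f x)"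
  by (subst (2) lborel_distr_plus[of a, symmetric], subst integral_distr) (use assms in auto)

lemma integrable_lborel_translate:
  fixes f :: "'a::euclidean_space \<Rightarrow> 'b::{banach, second_countable_topology}"
  assumes "integrable lborel f"
  shows "integrable lborel (\<lambda>x. f (a + x))"
  using assms
  by (subst (asm) lborel_distr_plus[of a, symmetric], subst (asm) integrable_distr_eq) auto

lemma nn_integral_lborel_scale:
  fixes f :: "'a::euclidean_space \<Rightarrow> ennreal"
  assumes [measurable]: "f \<in> borel_measurable borel" and "c > 0"
  shows "(\<integral>\<^sup>+x. ennreal (c ^ DIM('a)) * f (c *\<^sub>R x) \<partial>lborel) = (\<integral>\<^sup>+x. f x \<partial>lborel)"
proof -
  have "lborel = density (distr lborel borel (\<lambda>x::'a. 0 + c *\<^sub>R x)) (\<lambda>_. \<bar>c\<bar>^DIM('a))"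
    by (rule lborel_affine) (use assms in auto)
  then have "(\<integral>\<^sup>+x. f x \<partial>lborel) = (\<integral>\<^sup>+x. f x \<partial>density (distr lborel borel (\<lambda>x::'a. c *\<^sub>R x)) (\<lambda>_. \<bar>c\<bar>^DIM('a)))"
    by simp
  also have "\<dots> = (\<integral>\<^sup>+x. ennreal (c ^ DIM('a)) * f (c *\<^sub>R x) \<partial>lborel)"
    using \<open>c > 0\<close> by (subst nn_integral_density) (auto simp: nn_integral_distr)
  finally show ?thesis by simp
qed

lemma
  fixes f :: "'a::euclidean_space \<Rightarrow> 'b::{banach, second_countable_topology}"
  assumes f[measurable]: "f \<in> borel_measurable borel" and "c > 0"
  shows integral_lborel_scale:
      "(LINT x|lborel. c ^ DIM('a) *\<^sub>R f (c *\<^sub>R x)) = (LINT x|lborel. f x)"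
    and integrable_lborel_scale_iff:
      "integrable lborel (\<lambda>x. f (c *\<^sub>R x)) \<longleftrightarrow> integrable lborel f"
proof -
  have eq: "lborel = density (distr lborel borel (\<lambda>x::'a. c *\<^sub>R x)) (\<lambda>_. ennreal (c^DIM('a)))"
    using lborel_affine[of c "0::'a"] \<open>c > 0\<close> by simp
  have *: "c ^ DIM('a) \<ge> 0" using \<open>c > 0\<close> by simp
  have "(LINT x|lborel. f x) = (LINT x|density (distr lborel borel (\<lambda>x::'a. c *\<^sub>R x)) (\<lambda>_. ennreal (c^DIM('a))). f x)"
    using eq by simp
  also have "\<dots> = (LINT x|lborel. c ^ DIM('a) *\<^sub>R f (c *\<^sub>R x))"
    using * by (subst integral_density) (auto simp del: integral_scaleR_right intro!: integral_distr)
  finally show "(LINT x|lborel. c ^ DIM('a) *\<^sub>R f (c *\<^sub>R x)) = (LINT x|lborel. f x)" by simp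
  have "integrable lborel f \<longleftrightarrow> integrable (density (distr lborel borel (\<lambda>x::'a. c *\<^sub>R x)) (\<lambda>_. ennreal (c^DIM('a)))) f"
    using eq by simp
  also have "\<dots> \<longleftrightarrow> integrable (distr lborel borel (\<lambda>x::'a. c *\<^sub>R x)) (\<lambda>x. c ^ DIM('a) *\<^sub>R f x)"
    using * by (subst integrable_density) auto
  also have "\<dots> \<longleftrightarrow> integrable lborel (\<lambda>x. c ^ DIM('a) *\<^sub>R f (c *\<^sub>R x))"
    by (subst integrable_distr_eq) auto
  also have "\<dots> \<longleftrightarrow> integrable lborel (\<lambda>x. f (c *\<^sub>R x))"
    using \<open>c > 0\<close>
      integrable_scaleR_right[of "inverse (c ^ DIM('a))" lborel "\<lambda>x. c ^ DIM('a) *\<^sub>R f (c *\<^sub>R x)"]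
    by auto
  finally show "integrable lborel (\<lambda>x. f (c *\<^sub>R x)) \<longleftrightarrow> integrable lborel f" ..
qed

text \<open>Integrating \<open>f x * g y\<close> over two translation invariant measures and substituting
  \<open>x + y\<close> for \<open>x\<close> shows that the measures are proportional; the unit ball
  determines the factor.\<close>

lemma lborel_distr_orthogonal:
  fixes A :: "'a::euclidean_space \<Rightarrow> 'a"
  assumes A: "orthogonal_transformation A"
  shows "distr lborel borel A = lborel"
proof -
  have lin: "linear A" and nA: "norm (A x) = norm x" for x
    using A by (auto simp: orthogonal_transformation)
  have [measurable]: "A \<in> borel_measurable borel"
    using lin linear_continuous_on linear_conv_bounded_linear borel_measurable_continuous_onI by blast
  define M where "M = distr lborel borel A"
  have nnM: "(\<integral>\<^sup>+x. f x \<partial>M) = (\<integral>\<^sup>+x. f (A x) \<partial>lborel)"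
    if [measurable]: "f \<in> borel_measurable borel" for f
    unfolding M_def by (subst nn_integral_distr) auto
  have nnt: "(\<integral>\<^sup>+x. f (a + x) \<partial>lborel) = (\<integral>\<^sup>+x. f x \<partial>lborel)"
    if [measurable]: "f \<in> borel_measurable borel" for f :: "'a \<Rightarrow> ennreal" and a
    by (subst (2) lborel_distr_plus[of a, symmetric], subst nn_integral_distr) auto
  obtain B where B: "A (B a) = a" for a
    using A orthogonal_transformation_surj surj_f_inv_f by metis
  have Mt: "(\<integral>\<^sup>+x. f (a + x) \<partial>M) = (\<integral>\<^sup>+x. f x \<partial>M)"
    if [measurable]: "f \<in> borel_measurable borel" for f a
    using nnt[of "\<lambda>x. f (A x)" "B a"] lin by (simp add: nnM linear_add B)
  define g :: "'a \<Rightarrow> ennreal" where "g = indicator (ball 0 1)"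
  have [measurable]: "g \<in> borel_measurable borel"
    unfolding g_def by (intro borel_measurable_indicator) auto
  have gs: "g (x - y) = g (y - x)" for x y
    by (simp add: g_def indicator_def norm_minus_commute)
  have sets: "sets M = sets borel" by (simp add: M_def)
  \<comment> \<open>Required for Fubini below. Balls around the origin are their own preimages under
    A, so M gives them finite mass.\<close>
  interpret M: sigma_finite_measure M
  proof
    have "emeasure M (ball 0 (real n)) \<noteq> \<infinity>" for n
    proof -
      have "A -` ball 0 (real n) = ball 0 (real n)" by (auto simp: nA)
      then show ?thesis
        using emeasure_lborel_ball_finite[of 0 "real n"]
        by (auto simp: M_def emeasure_distr dest: less_imp_neq)
    qed
    moreover have "(\<Union>n. ball 0 (real n)) = (UNIV :: 'a set)"
      by (auto intro: reals_Archimedean2)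
    ultimately show "\<exists>F. countable F \<and> F \<subseteq> sets M \<and> \<Union>F = space M \<and> (\<forall>a\<in>F. emeasure M a \<noteq> \<infinity>)"
      by (intro exI[of _ "range (\<lambda>n. ball 0 (real n))"]) (auto simp: M_def)
  qed
  interpret P: pair_sigma_finite M "lborel :: 'a measure" ..
  have [measurable_cong]: "sets M = sets borel" by fact
  define v where "v = emeasure lborel (ball (0::'a) 1)"
  have v: "v \<noteq> 0" "v \<noteq> \<infinity>"
    unfolding v_def using emeasure_lborel_ball_finite[of "0::'a" 1]
    by (auto simp: content_ball_pos measure_def dest: ) (metis content_ball_pos enn2real_0 less_irrefl measure_def zero_less_one)
  have gv: "(\<integral>\<^sup>+x. g x \<partial>lborel) = v" unfolding g_def v_def by simp
  have gM: "(\<integral>\<^sup>+x. g x \<partial>M) = v"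
  proof -
    have "(\<integral>\<^sup>+x. g x \<partial>M) = (\<integral>\<^sup>+x. g (A x) \<partial>lborel)" by (rule nnM) simp
    also have "\<dots> = (\<integral>\<^sup>+x. g x \<partial>lborel)" by (simp add: g_def indicator_def nA)
    finally show ?thesis by (simp add: gv)
  qed
  have gM': "(\<integral>\<^sup>+x. g (y - x) \<partial>M) = v" for y
  proof -
    have "(\<integral>\<^sup>+x. g (y - x) \<partial>M) = (\<integral>\<^sup>+x. g (- y + x) \<partial>M)"
      by (intro nn_integral_cong) (use gs in auto)
    then show ?thesis using Mt[of g "-y"] gM by simp
  qed
  have eq: "(\<integral>\<^sup>+x. f x \<partial>M) = (\<integral>\<^sup>+x. f x \<partial>lborel)" if [measurable]: "f \<in> borel_measurable borel" for f
  proof -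
    have "(\<integral>\<^sup>+x. f x \<partial>M) * v = (\<integral>\<^sup>+y. \<integral>\<^sup>+x. f x * g y \<partial>M \<partial>lborel)"
      by (simp add: nn_integral_multc nn_integral_cmult gv)
    also have "\<dots> = (\<integral>\<^sup>+y. \<integral>\<^sup>+x. f (y + x) * g y \<partial>M \<partial>lborel)"
      by (rule nn_integral_cong) (simp add: nn_integral_multc Mt)
    also have "\<dots> = (\<integral>\<^sup>+x. \<integral>\<^sup>+y. f (y + x) * g y \<partial>lborel \<partial>M)"
      by (rule P.Fubini') measurable
    also have "\<dots> = (\<integral>\<^sup>+x. \<integral>\<^sup>+y. f y * g (y - x) \<partial>lborel \<partial>M)"
    proof (rule nn_integral_cong)
      fix x
      show "(\<integral>\<^sup>+y. f (y + x) * g y \<partial>lborel) = (\<integral>\<^sup>+y. f y * g (y - x) \<partial>lborel)"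
        using nnt[of "\<lambda>y. f y * g (y - x)" x] by (simp add: add.commute)
    qed
    also have "\<dots> = (\<integral>\<^sup>+y. \<integral>\<^sup>+x. f y * g (y - x) \<partial>M \<partial>lborel)"
      by (rule P.Fubini'[symmetric]) measurable
    also have "\<dots> = (\<integral>\<^sup>+x. f x \<partial>lborel) * v"
      by (simp add: nn_integral_cmult gM' nn_integral_multc)
    finally show ?thesis using v by (metis mult_divide_eq_ennreal infinity_ennreal_def)
  qed
  have "M = lborel"
  proof (rule measure_eqI)
    fix S assume "S \<in> sets M"
    then have [measurable]: "S \<in> sets borel" by (simp add: sets)
    then show "emeasure M S = emeasure lborel S"
      using eq[of "indicator S"] by (simp add: sets)
  qed (simp add: sets)
  then show ?thesis by (simp add: M_def)
qed

lemma integral_lborel_orthogonal: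
  fixes f :: "'a::euclidean_space \<Rightarrow> 'b::{banach, second_countable_topology}"
    and A :: "'a \<Rightarrow> 'a"
  assumes "f \<in> borel_measurable borel" "orthogonal_transformation A"
  shows "(LINT x|lborel. f (A x)) = (LINT x|lborel. f x)"
proof -
  have "A \<in> borel_measurable borel"
    using assms(2) linear_continuous_on linear_conv_bounded_linear borel_measurable_continuous_onI
      orthogonal_transformation_linear by blast
  then show ?thesis
    by (subst (2) lborel_distr_orthogonal[OF assms(2), symmetric], subst integral_distr)
      (use assms in auto)
qed

section \<open>Product integrals, polynomial weights and Gaussians\<close>

lemma
  fixes f :: "'a::euclidean_space \<Rightarrow> real \<Rightarrow> complex"
  assumes f: "\<And>b. b \<in> Basis \<Longrightarrow> integrable lborel (f b)"
  shows integrable_lborel_prod: "integrable lborel (\<lambda>x. \<Prod>b\<in>Basis. f b (x \<bullet> b))"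
    and integral_lborel_prod:
      "(LINT x|lborel. (\<Prod>b\<in>Basis. f b (x \<bullet> b))) = (\<Prod>b\<in>Basis. (LINT x|lborel. f b x))"
proof -
  interpret product_sigma_finite "\<lambda>_::'a. lborel :: real measure" by standard
  have [measurable]: "b \<in> Basis \<Longrightarrow> f b \<in> borel_measurable borel" for b
    using f[of b] by auto
  have meas: "(\<lambda>x. \<Prod>b\<in>Basis. f b (x \<bullet> b)) \<in> borel_measurable borel"
    by measurable
  have cong: "(\<Prod>b\<in>Basis. f b ((\<Sum>b\<in>Basis. x b *\<^sub>R b) \<bullet> b)) = (\<Prod>b\<in>Basis. f b (x b))" for x :: "'a \<Rightarrow> real"
    by (intro prod.cong) (auto simp: inner_sum_left inner_Basis if_distrib cong: if_cong)
  have m2: "(\<lambda>x. \<Sum>b\<in>Basis. x b *\<^sub>R b) \<in> (\<Pi>\<^sub>M b\<in>Basis. lborel) \<rightarrow>\<^sub>M (borel :: 'a measure)"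
    by measurable
  show "integrable lborel (\<lambda>x. \<Prod>b\<in>Basis. f b (x \<bullet> b))"
    by (subst lborel_eq, subst integrable_distr_eq[OF m2 meas])
      (auto simp: cong intro!: product_integrable_prod f)
  show "(LINT x|lborel. (\<Prod>b\<in>Basis. f b (x \<bullet> b))) = (\<Prod>b\<in>Basis. (LINT x|lborel. f b x))"
    by (subst lborel_eq, subst integral_distr[OF m2 meas])
      (auto simp: cong intro!: product_integral_prod f)
qed

text \<open>The function is dominated by the product of the one-dimensional integrable functions 1 /
  (1 + x_b^2). Each of the d factors 1 + x_b^2 is at most (1 + norm x)^2, whence the exponent 2
  d.\<close>

lemma integrable_inverse_power_norm:
  assumes "N \<ge> 2 * DIM('a)"
  shows "integrable lborel (\<lambda>x::'a::euclidean_space. 1 / (1 + norm x) ^ N)"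
proof -
  have int: "integrable lborel (\<lambda>x::real. complex_of_real (inverse (1 + x\<^sup>2)))"
    using integrable_inverse_1_plus_square
    by (intro integrable_bounded_linear[OF bounded_linear_of_real]) (simp add: set_integrable_def)
  have "integrable lborel (\<lambda>x::'a. \<Prod>b\<in>Basis. complex_of_real (inverse (1 + (x \<bullet> b)\<^sup>2)))"
    by (rule integrable_lborel_prod[of "\<lambda>b x. complex_of_real (inverse (1 + x\<^sup>2))", OF int])
  then show ?thesis
  proof (rule Bochner_Integration.integrable_bound)
    show "AE x::'a in lborel. norm (1 / (1 + norm x) ^ N) \<le> norm (\<Prod>b\<in>Basis. complex_of_real (inverse (1 + (x \<bullet> b)\<^sup>2)))"
    proof (rule AE_I2)
      fix x :: 'a
      have "(\<Prod>b\<in>Basis. 1 + (x \<bullet> b)\<^sup>2) \<le> (\<Prod>b\<in>(Basis::'a set). (1 + norm x)\<^sup>2)"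
      proof (rule prod_mono, rule conjI)
        fix b :: 'a assume "b \<in> Basis"
        then have "\<bar>x \<bullet> b\<bar> \<le> norm x" by (rule Basis_le_norm)
        then have "(x \<bullet> b)\<^sup>2 \<le> (norm x)\<^sup>2" by (metis abs_ge_zero power2_abs power_mono)
        then show "1 + (x \<bullet> b)\<^sup>2 \<le> (1 + norm x)\<^sup>2"
          using norm_ge_zero[of x] by (simp add: power2_sum add_increasing2)
      qed auto
      also have "\<dots> = (1 + norm x) ^ (2 * DIM('a))" by (simp add: power_mult)
      also have "\<dots> \<le> (1 + norm x) ^ N" using assms by (intro power_increasing) auto
      finally have "1 / (1 + norm x) ^ N \<le> 1 / (\<Prod>b\<in>Basis. 1 + (x \<bullet> b)\<^sup>2)"
        by (intro divide_left_mono mult_pos_pos prod_pos zero_less_power) (auto intro: add_pos_nonneg)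
      also have "\<dots> = norm (\<Prod>b\<in>Basis. complex_of_real (inverse (1 + (x \<bullet> b)\<^sup>2)))"
        unfolding prod_norm[symmetric] norm_of_real
        using prod_inversef[of "\<lambda>b. 1 + (x \<bullet> b)\<^sup>2" Basis] by (simp add: divide_inverse o_def)
      finally show "norm (1 / (1 + norm x) ^ N) \<le> norm (\<Prod>b\<in>Basis. complex_of_real (inverse (1 + (x \<bullet> b)\<^sup>2)))"
        by simp
    qed
  qed simp
qed

text \<open>The integrand is a product over the coordinates, and each factor is the characteristic
  function of the standard normal distribution up to the factor sqrt (2 pi).\<close>

lemma
  fixes \<xi> :: "'a::euclidean_space"
  shows integrable_cis_gaussian:
      "integrable lborel (\<lambda>z. cis (z \<bullet> \<xi>) * of_real (exp (- (norm z)\<^sup>2 / 2)))"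
    and integral_cis_gaussian:
      "(LINT z|lborel. cis (z \<bullet> \<xi>) * of_real (exp (- (norm z)\<^sup>2 / 2))) =
        of_real (sqrt (2 * pi) ^ DIM('a) * exp (- (norm \<xi>)\<^sup>2 / 2))"
proof -
  define f where "f b x = cis (x * (\<xi> \<bullet> b)) * of_real (exp (- x\<^sup>2 / 2))" for b x
  have 1: "integrable lborel (\<lambda>x. of_real (exp (- x\<^sup>2 / 2)) :: complex)"
  proof -
    have "integrable lborel (\<lambda>x. sqrt (2 * pi) * std_normal_density x)"
      by (intro integrable_mult_right integrable_normal_density) simp
    then show ?thesis by (simp add: std_normal_density_def)
  qed
  have f: "integrable lborel (f b)" for b
    by (rule Bochner_Integration.integrable_bound[OF 1]) (auto simp: f_def[abs_def] norm_mult)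
  have fi: "(LINT x|lborel. f b x) = of_real (sqrt (2 * pi) * exp (- (\<xi> \<bullet> b)\<^sup>2 / 2))" for b
  proof -
    have "of_real (exp (- (\<xi> \<bullet> b)\<^sup>2 / 2)) = (LINT x|lborel. std_normal_density x *\<^sub>R iexp ((\<xi> \<bullet> b) * x))"
      using fun_cong[OF char_std_normal_distribution, of "\<xi> \<bullet> b"]
      unfolding char_def by (subst (asm) integral_density) auto
    also have "\<dots> = (LINT x|lborel. of_real (1 / sqrt (2 * pi)) * f b x)"
      by (intro Bochner_Integration.integral_cong)
        (auto simp: std_normal_density_def f_def cis_conv_exp scaleR_conv_of_real mult_ac)
    finally have "of_real (exp (- (\<xi> \<bullet> b)\<^sup>2 / 2)) = of_real (1 / sqrt (2 * pi)) * (LINT x|lborel. f b x)"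
      by simp
    then show ?thesis by (simp add: field_simps)
  qed
  have sq: "(norm z)\<^sup>2 = (\<Sum>b\<in>Basis. (z \<bullet> b)\<^sup>2)" for z :: 'a
    by (simp add: norm_eq_sqrt_inner euclidean_inner[of z z] power2_eq_square)
       (metis (mono_tags, lifting) euclidean_inner inner_ge_zero sum.cong real_sqrt_mult_self abs_of_nonneg)
  have prod: "(\<Prod>b\<in>Basis. f b (z \<bullet> b)) = cis (z \<bullet> \<xi>) * of_real (exp (- (norm z)\<^sup>2 / 2))" for z
  proof -
    have "(\<Prod>b\<in>Basis. cis ((z \<bullet> b) * (\<xi> \<bullet> b))) = cis (z \<bullet> \<xi>)"
      by (simp add: cis_conv_exp exp_sum[symmetric] euclidean_inner[of z \<xi>] sum_distrib_left)
    moreover have "(\<Prod>b\<in>Basis. complex_of_real (exp (- (z \<bullet> b)\<^sup>2 / 2))) = of_real (exp (- (norm z)\<^sup>2 / 2))"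
      by (simp add: exp_sum[symmetric] sq sum_negf sum_divide_distrib flip: of_real_prod)
    ultimately show ?thesis by (simp add: f_def prod.distrib)
  qed
  show "integrable lborel (\<lambda>z. cis (z \<bullet> \<xi>) * of_real (exp (- (norm z)\<^sup>2 / 2)))"
    using integrable_lborel_prod[of f, OF f] by (simp add: prod)
  have "(LINT z|lborel. cis (z \<bullet> \<xi>) * of_real (exp (- (norm z)\<^sup>2 / 2))) = (\<Prod>b\<in>Basis. of_real (sqrt (2 * pi) * exp (- (\<xi> \<bullet> b)\<^sup>2 / 2)))"
    using integral_lborel_prod[of f, OF f] by (simp add: prod fi)
  also have "\<dots> = of_real (sqrt (2 * pi) ^ DIM('a) * exp (- (norm \<xi>)\<^sup>2 / 2))"
    by (simp add: prod.distrib exp_sum[symmetric] sq sum_negf sum_divide_distrib flip: of_real_prod)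
  finally show "(LINT z|lborel. cis (z \<bullet> \<xi>) * of_real (exp (- (norm z)\<^sup>2 / 2))) =
        of_real (sqrt (2 * pi) ^ DIM('a) * exp (- (norm \<xi>)\<^sup>2 / 2))" .
qed

section \<open>Test functions and their inverse Fourier transforms\<close>

abbreviation test_fun :: "('a::euclidean_space \<Rightarrow> complex) \<Rightarrow> bool" where
  "test_fun \<equiv> test_fun_on UNIV"

lemma test_fun_iff: "test_fun f \<longleftrightarrow> smooth_fun f \<and> bounded {x. f x \<noteq> 0}"
  by (simp add: test_fun_on_def compact_closure)

lemma test_fun_mult:
  assumes "smooth_fun f" "test_fun m"
  shows "test_fun (\<lambda>x. f x * m x)"
  using assms bounded_subset[of "{x. m x \<noteq> 0}" "{x. f x * m x \<noteq> 0}"]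
  by (auto simp: test_fun_iff intro: smooth_fun_mult)

lemma test_fun_add:
  assumes "test_fun f" "test_fun g"
  shows "test_fun (\<lambda>x. f x + g x)"
proof -
  have "{x. f x + g x \<noteq> 0} \<subseteq> {x. f x \<noteq> 0} \<union> {x. g x \<noteq> 0}" by auto
  then have "bounded {x. f x + g x \<noteq> 0}"
    by (rule bounded_subset[rotated]) (use assms in \<open>simp add: test_fun_iff\<close>)
  then show ?thesis using assms by (simp add: test_fun_iff smooth_fun_add)
qed

lemma test_fun_cmult: "test_fun m \<Longrightarrow> test_fun (\<lambda>x. c * m x)"
  by (rule test_fun_mult[OF smooth_fun_const])

lemma test_fun_diff:
  assumes "test_fun f" "test_fun g"
  shows "test_fun (\<lambda>x. f x - g x)"
  using test_fun_add[OF assms(1) test_fun_cmult[OF assms(2), of "-1"]] by simp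

lemma test_fun_sum:
  assumes "finite I" "\<And>i. i \<in> I \<Longrightarrow> test_fun (f i)"
  shows "test_fun (\<lambda>x. \<Sum>i\<in>I. f i x)"
  using assms
proof (induction I)
  case empty
  then show ?case by (simp add: test_fun_iff smooth_fun_const)
qed (simp add: test_fun_add)

lemma test_fun_affine:
  fixes m :: "'a::euclidean_space \<Rightarrow> complex"
  assumes "test_fun m" "c \<noteq> 0"
  shows "test_fun (\<lambda>x. m (a + c *\<^sub>R x))"
proof -
  have "bounded ((*\<^sub>R) (1 / c) ` (\<lambda>y. y - a) ` {x. m x \<noteq> 0})"
    by (intro bounded_scaling bounded_translation_minus) (use assms(1) in \<open>auto simp: test_fun_iff\<close>)
  then have "bounded ((\<lambda>y. (1 / c) *\<^sub>R (y - a)) ` {x. m x \<noteq> 0})"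
    by (simp add: image_image)
  moreover have "{x. m (a + c *\<^sub>R x) \<noteq> 0} \<subseteq> (\<lambda>y. (1 / c) *\<^sub>R (y - a)) ` {x. m x \<noteq> 0}"
  proof
    fix x assume "x \<in> {x. m (a + c *\<^sub>R x) \<noteq> 0}"
    then show "x \<in> (\<lambda>y. (1 / c) *\<^sub>R (y - a)) ` {x. m x \<noteq> 0}"
      using assms(2) by (intro image_eqI[of _ _ "a + c *\<^sub>R x"]) auto
  qed
  ultimately show ?thesis
    using assms by (auto simp: test_fun_iff intro: smooth_fun_affine bounded_subset)
qed

lemma test_fun_scale:
  fixes m :: "'a::euclidean_space \<Rightarrow> complex"
  assumes "test_fun m" "c \<noteq> 0"
  shows "test_fun (\<lambda>x. m (c *\<^sub>R x))"
  using test_fun_affine[OF assms, of 0] by simp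

lemma dir_deriv_nonzero_support: "{x. dir_deriv v f x \<noteq> 0} \<subseteq> closure {x. f x \<noteq> 0}"
proof
  fix x assume x: "x \<in> {x. dir_deriv v f x \<noteq> 0}"
  show "x \<in> closure {x. f x \<noteq> 0}"
  proof (rule ccontr)
    assume "x \<notin> closure {x. f x \<noteq> 0}"
    then have "x \<in> - closure {x. f x \<noteq> 0}" by simp
    moreover have "0 = f y" if "y \<in> - closure {x. f x \<noteq> 0}" for y
      using that closure_subset[of "{x. f x \<noteq> 0}"] by auto
    ultimately have "(f has_derivative (\<lambda>v. 0)) (at x)"
      by (rule has_derivative_transform_within_open[OF has_derivative_const open_Compl[OF closed_closure]])
    from dir_deriv_eqI[OF this] x show False by simp
  qed
qed

lemma test_fun_dir_deriv:
  assumes "test_fun m" "b \<in> Basis"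
  shows "test_fun (dir_deriv b m)"
  using assms bounded_subset[OF bounded_closure dir_deriv_nonzero_support[of b m]]
  by (auto simp: test_fun_iff smooth_fun_dir_deriv)

lemma test_fun_dir_derivs:
  assumes "test_fun m" "set vs \<subseteq> Basis"
  shows "test_fun (dir_derivs vs m)"
  using assms by (induction vs) (auto intro: test_fun_dir_deriv)

lemma integrable_continuous_bounded_support:
  fixes f :: "'a::euclidean_space \<Rightarrow> 'b::euclidean_space"
  assumes "continuous_on UNIV f" "bounded {x. f x \<noteq> 0}"
  shows "integrable lborel f"
proof -
  have "integrable lborel (\<lambda>x. indicator (closure {x. f x \<noteq> 0}) x *\<^sub>R f x)"
    using assms by (intro borel_integrable_compact) (auto simp: compact_closure intro: continuous_on_subset)
  also have "(\<lambda>x. indicator (closure {x. f x \<noteq> 0}) x *\<^sub>R f x) = f"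
    using closure_subset[of "{x. f x \<noteq> 0}"] by (auto simp: indicator_def fun_eq_iff)
  finally show ?thesis .
qed

lemma bounded_range_continuous_bounded_support:
  fixes f :: "'a::euclidean_space \<Rightarrow> 'b::euclidean_space"
  assumes "continuous_on UNIV f" "bounded {x. f x \<noteq> 0}"
  shows "bounded (range f)"
proof -
  have "compact (f ` closure {x. f x \<noteq> 0})"
    using assms by (intro compact_continuous_image) (auto simp: compact_closure intro: continuous_on_subset)
  then have "bounded (insert 0 (f ` closure {x. f x \<noteq> 0}))" by (simp add: compact_imp_bounded)
  moreover have "range f \<subseteq> insert 0 (f ` closure {x. f x \<noteq> 0})"
    using closure_subset[of "{x. f x \<noteq> 0}"] by auto
  ultimately show ?thesis by (rule bounded_subset)
qed

lemma test_fun_continuous: "test_fun m \<Longrightarrow> continuous_on S m"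
  by (simp add: test_fun_iff smooth_fun_continuous)

lemma test_fun_measurable: "test_fun m \<Longrightarrow> m \<in> borel_measurable borel"
  by (intro borel_measurable_continuous_onI test_fun_continuous)

lemma test_fun_integrable_mult:
  assumes "test_fun m" "continuous_on UNIV g"
  shows "integrable lborel (\<lambda>x. m x * g x)"
proof (rule integrable_continuous_bounded_support)
  have "{x. m x * g x \<noteq> 0} \<subseteq> {x. m x \<noteq> 0}" by auto
  then show "bounded {x. m x * g x \<noteq> 0}"
    by (rule bounded_subset[rotated]) (use assms in \<open>simp add: test_fun_iff\<close>)
qed (intro continuous_on_mult test_fun_continuous assms)

lemma test_fun_integrable: "test_fun m \<Longrightarrow> integrable lborel m"
  using test_fun_integrable_mult[of m "\<lambda>_. 1"] by simp

lemma test_fun_bounded: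
  assumes "test_fun m"
  obtains C where "\<And>x. norm (m x) \<le> C"
  using bounded_range_continuous_bounded_support[OF test_fun_continuous[OF assms]] assms
  by (auto simp: test_fun_iff bounded_iff)

lemma dir_deriv_eq_sum:
  assumes "smooth_fun f"
  shows "dir_deriv v f x = (\<Sum>b\<in>Basis. of_real (v \<bullet> b) * dir_deriv b f x)"
proof -
  interpret bounded_linear "\<lambda>v. dir_deriv v f x"
    using smooth_fun_has_derivative[OF assms] by (rule has_derivative_bounded_linear)
  show ?thesis
    by (subst euclidean_representation[of v, symmetric], subst sum) (simp add: scale scaleR_conv_of_real)
qed

lemma dir_deriv_measurable:
  assumes "smooth_fun f"
  shows "dir_deriv v f \<in> borel_measurable borel"
proof -
  have "continuous_on UNIV (\<lambda>x. \<Sum>b\<in>Basis. of_real (v \<bullet> b) * dir_deriv b f x)"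
    by (intro continuous_intros smooth_fun_continuous smooth_fun_dir_deriv assms)
  moreover have "dir_deriv v f = (\<lambda>x. \<Sum>b\<in>Basis. of_real (v \<bullet> b) * dir_deriv b f x)"
    by (rule ext) (rule dir_deriv_eq_sum[OF assms])
  ultimately show ?thesis
    by (simp only: borel_measurable_continuous_onI)
qed

lemma norm_dir_deriv_le:
  assumes "smooth_fun f"
  shows "norm (dir_deriv v f x) \<le> (\<Sum>b\<in>Basis. norm (dir_deriv b f x)) * norm v"
proof -
  have "norm (dir_deriv v f x) \<le> (\<Sum>b\<in>Basis. norm v * norm (dir_deriv b f x))"
    by (subst dir_deriv_eq_sum[OF assms], rule sum_norm_le) (auto simp: norm_mult intro!: mult_right_mono Basis_le_norm)
  then show ?thesis by (simp add: sum_distrib_left mult.commute)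
qed

lemma smooth_fun_lipschitz:
  assumes f: "smooth_fun f"
    and K: "\<And>z. z \<in> closed_segment x y \<Longrightarrow> (\<Sum>b\<in>Basis. norm (dir_deriv b f z)) \<le> K"
  shows "norm (f x - f y) \<le> K * norm (x - y)"
proof (rule differentiable_bound[of "closed_segment x y" f "\<lambda>z v. dir_deriv v f z"])
  show "(f has_derivative (\<lambda>v. dir_deriv v f z)) (at z within closed_segment x y)" for z
    using smooth_fun_has_derivative[OF f] by (rule has_derivative_at_withinI)
  show "onorm (\<lambda>v. dir_deriv v f z) \<le> K" if "z \<in> closed_segment x y" for z
    by (rule onorm_le) (meson K that norm_dir_deriv_le[OF f] order_trans mult_right_mono norm_ge_zero)
qed auto

text \<open>The integral of u (y + w) over w does not depend on y, so its derivative at y = 0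
  vanishes; differentiating under the integral gives the claim.\<close>

lemma integral_dir_deriv_test_fun:
  fixes u :: "'a::euclidean_space \<Rightarrow> complex"
  assumes u: "test_fun u"
  shows "(LINT x|lborel. dir_deriv v u x) = 0"
proof -
  have su: "smooth_fun u" using u by (simp add: test_fun_iff)
  obtain R where R: "\<And>x. u x \<noteq> 0 \<Longrightarrow> norm x \<le> R"
    using u by (auto simp: test_fun_iff bounded_iff)
  define g where "g b = (SOME C. \<forall>x. norm (dir_deriv b u x) \<le> C)" for b
  have g: "norm (dir_deriv b u x) \<le> g b" if "b \<in> Basis" for b x
    using test_fun_bounded[OF test_fun_dir_deriv[OF u that]]
      someI_ex[of "\<lambda>C. \<forall>x. norm (dir_deriv b u x) \<le> C"] unfolding g_def by metis
  define K where "K = (\<Sum>b\<in>Basis. g b)"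
  have K: "(\<Sum>b\<in>Basis. norm (dir_deriv b u x)) \<le> K" for x
    unfolding K_def by (intro sum_mono g)
  have K0: "K \<ge> 0" using order_trans[OF sum_nonneg K] by simp
  \<comment> \<open>Translations by at most 1 move the support of u from the ball of radius R into
    the ball of radius R + 1, so this majorant serves all admissible increments.\<close>
  define B where "B w = K * indicator (cball (0::'a) (R + 1)) w" for w
  have lip: "norm (u x - u y) \<le> K * norm (x - y)" for x y
    by (rule smooth_fun_lipschitz[OF su K])
  have du: "norm (dir_deriv v u x) \<le> B x * norm v" for v x
  proof (cases "norm x \<le> R + 1")
    case True
    have "norm (dir_deriv v u x) \<le> K * norm v"
      using norm_dir_deriv_le[OF su, of v x] mult_right_mono[OF K, of "norm v" x] by simp
    then show ?thesis using True by (simp add: B_def)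
  next
    case False
    have "closure {x. u x \<noteq> 0} \<subseteq> cball 0 R" by (intro closure_minimal) (auto dest: R)
    then have "dir_deriv v u x = 0" using False dir_deriv_nonzero_support[of v u] by auto
    then show ?thesis using K0 by (simp add: B_def)
  qed
  have "((\<lambda>y. LINT w|lborel. u (y + w)) has_derivative (\<lambda>v. LINT w|lborel. dir_deriv v u w)) (at 0)"
  proof (rule has_derivative_lebesgue_integral[where B=B])
    show "((\<lambda>y. u (y + w)) has_derivative (\<lambda>v. dir_deriv v u w)) (at 0)" for w
      by (rule has_derivative_compose[where g=u and f="\<lambda>y. y + w", THEN has_derivative_eq_rhs])
        (auto intro!: derivative_eq_intros smooth_fun_has_derivative[OF su])
    show "integrable lborel (\<lambda>w. u (y + w))" for y
      by (rule integrable_lborel_translate[OF test_fun_integrable[OF u]])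
    show B: "integrable lborel B"
      unfolding B_def by (intro integrable_mult_right integrable_real_indicator) (use emeasure_lborel_cball_finite[of "0::'a" "R + 1"] in auto)
    show "integrable lborel (\<lambda>w. dir_deriv v u w)" for v
    proof (rule Bochner_Integration.integrable_bound[OF integrable_mult_left[OF B]])
      show "(\<lambda>w. dir_deriv v u w) \<in> borel_measurable lborel"
        using dir_deriv_measurable[OF su] by simp
      show "AE w in lborel. norm (dir_deriv v u w) \<le> norm (B w * norm v)"
        using du K0 by (auto simp: B_def)
    qed
    show "norm (u (y + w) - u (0 + w)) \<le> B w * norm (y - 0)" if "norm (y - 0) \<le> 1" for y w
    proof (cases "norm w \<le> R + 1")
      case True
      then show ?thesis using lip[of "y + w" w] by (simp add: B_def)
    next
      case False
      have "norm w \<le> norm (y + w) + norm y" using norm_triangle_ineq4[of "y + w" y] by simp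
      then have "u (y + w) = 0" "u w = 0" using False that R[of w] R[of "y + w"] by force+
      then show ?thesis using K0 by (simp add: B_def)
    qed
  qed (use du in auto)
  moreover have "(\<lambda>y. LINT w|lborel. u (y + w)) = (\<lambda>y. LINT w|lborel. u w)"
    using test_fun_measurable[OF u] by (simp add: integral_lborel_translate)
  ultimately have "((\<lambda>y::'a. LINT w|lborel. u w) has_derivative (\<lambda>v. LINT w|lborel. dir_deriv v u w)) (at 0)"
    by simp
  from has_derivative_unique[OF this has_derivative_const] show ?thesis by metis
qed

lemma norm_cis_diff_le: "norm (cis a - cis b) \<le> \<bar>a - b\<bar>"
proof -
  have "cis a - cis b = cis b * (iexp (a - b) - 1)"
    by (simp add: algebra_simps cis_conv_exp flip: exp_add)
  then have "norm (cis a - cis b) = norm (iexp (a - b) - 1)" by (simp add: norm_mult)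
  then show ?thesis using iexp_approx1[of "a - b" 0] by simp
qed

lemma has_derivative_cis_inner:
  "((\<lambda>x. c * cis (z \<bullet> x)) has_derivative (\<lambda>v. c * (\<i> * of_real (z \<bullet> v) * cis (z \<bullet> x)))) (at x)"
  by (auto intro!: derivative_eq_intros simp: scaleR_conv_of_real mult_ac)

lemma smooth_fun_cis: "smooth_fun (\<lambda>x::'a::euclidean_space. c * cis (z \<bullet> x))"
proof -
  have "diff_upto n (\<lambda>x::'a. c * cis (z \<bullet> x))" for n c
  proof (induction n arbitrary: c)
    case 0
    then show ?case
      using has_derivative_cis_inner unfolding diff_upto_0 differentiable_on_def by (blast intro: differentiableI)
  next
    case (Suc n)
    have "dir_deriv b (\<lambda>x. c * cis (z \<bullet> x)) = (\<lambda>x. (c * \<i> * of_real (z \<bullet> b)) * cis (z \<bullet> x))" for b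
      by (subst dir_deriv_ext[OF has_derivative_cis_inner]) (simp add: mult_ac)
    then show ?case
      using Suc has_derivative_cis_inner unfolding diff_upto_Suc differentiable_on_def
      by (metis differentiableI)
  qed
  then show ?thesis by (simp add: smooth_fun_iff)
qed

section \<open>Convolution kernels of Fourier multipliers\<close>

text \<open>Up to normalisation the inverse Fourier transform of \<open>m\<close>: the convolution kernel of the
  Fourier multiplier \<open>m\<close>.\<close>

definition kern :: "('a::euclidean_space \<Rightarrow> complex) \<Rightarrow> 'a \<Rightarrow> complex" where
  "kern m z = of_real (1 / (2 * pi) ^ DIM('a)) * (LINT \<xi>|lborel. m \<xi> * cis (z \<bullet> \<xi>))"

lemma kern_integrable:
  assumes "test_fun m"
  shows "integrable lborel (\<lambda>\<xi>. m \<xi> * cis (z \<bullet> \<xi>))"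
  by (intro test_fun_integrable_mult assms continuous_intros)

lemma kern_add:
  assumes "test_fun m" "test_fun k"
  shows "kern (\<lambda>\<xi>. m \<xi> + k \<xi>) z = kern m z + kern k z"
  by (simp add: kern_def distrib_left distrib_right kern_integrable assms)

lemma kern_has_derivative:
  fixes m :: "'a::euclidean_space \<Rightarrow> complex"
  assumes m: "test_fun m"
  shows "(kern m has_derivative (\<lambda>v. kern (\<lambda>\<xi>. \<i> * of_real (\<xi> \<bullet> v) * m \<xi>) z)) (at z)"
proof -
  have "((\<lambda>z. LINT \<xi>|lborel. m \<xi> * cis (z \<bullet> \<xi>)) has_derivative
      (\<lambda>v. LINT \<xi>|lborel. m \<xi> * (\<i> * of_real (\<xi> \<bullet> v) * cis (z \<bullet> \<xi>)))) (at z)"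
  proof (rule has_derivative_lebesgue_integral[where B="\<lambda>\<xi>. norm (m \<xi> * of_real (norm \<xi>))"])
    show "((\<lambda>z. m \<xi> * cis (z \<bullet> \<xi>)) has_derivative (\<lambda>v. m \<xi> * (\<i> * of_real (\<xi> \<bullet> v) * cis (z \<bullet> \<xi>)))) (at z)" for \<xi>
      using has_derivative_cis_inner[of "m \<xi>" \<xi> z] by (simp add: inner_commute)
    show "integrable lborel (\<lambda>\<xi>. m \<xi> * cis (y \<bullet> \<xi>))" for y
      by (rule kern_integrable[OF m])
    show "integrable lborel (\<lambda>\<xi>. m \<xi> * (\<i> * of_real (\<xi> \<bullet> v) * cis (z \<bullet> \<xi>)))" for v
      by (intro test_fun_integrable_mult m continuous_intros)
    show "integrable lborel (\<lambda>\<xi>. norm (m \<xi> * of_real (norm \<xi>)))"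
      by (intro integrable_norm test_fun_integrable_mult m continuous_intros)
    show "norm (m \<xi> * cis (y \<bullet> \<xi>) - m \<xi> * cis (z \<bullet> \<xi>)) \<le> norm (m \<xi> * of_real (norm \<xi>)) * norm (y - z)" for y \<xi>
    proof -
      have "norm (cis (y \<bullet> \<xi>) - cis (z \<bullet> \<xi>)) \<le> norm (y - z) * norm \<xi>"
        using order_trans[OF norm_cis_diff_le Cauchy_Schwarz_ineq2[of "y - z" \<xi>, unfolded inner_diff_left]] .
      then have "norm (m \<xi>) * norm (cis (y \<bullet> \<xi>) - cis (z \<bullet> \<xi>)) \<le> norm (m \<xi>) * (norm (y - z) * norm \<xi>)"
        by (rule mult_left_mono) simp
      then show ?thesis by (simp add: norm_mult right_diff_distrib[symmetric] mult_ac)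
    qed
    show "norm (m \<xi> * (\<i> * of_real (\<xi> \<bullet> v) * cis (z \<bullet> \<xi>))) \<le> norm (m \<xi> * of_real (norm \<xi>)) * norm v" for v \<xi>
      using mult_left_mono[OF Cauchy_Schwarz_ineq2[of \<xi> v], of "norm (m \<xi>)"]
      by (simp add: norm_mult mult.assoc)
  qed
  from has_derivative_mult_right[OF this, of "of_real (1 / (2 * pi) ^ DIM('a))"]
  show ?thesis
    unfolding kern_def[abs_def] by (simp add: mult_ac)
qed

lemma test_fun_mult_inner:
  "test_fun m \<Longrightarrow> test_fun (\<lambda>\<xi>. \<i> * of_real (\<xi> \<bullet> v) * m \<xi>)"
  by (intro test_fun_mult smooth_fun_mult smooth_fun_const smooth_fun_inner)

lemma dir_deriv_kern:
  assumes "test_fun m"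
  shows "dir_deriv v (kern m) = kern (\<lambda>\<xi>. \<i> * of_real (\<xi> \<bullet> v) * m \<xi>)"
  by (rule dir_deriv_ext[OF kern_has_derivative[OF assms]])

text \<open>Differentiating a kernel multiplies its symbol by a linear function, which keeps it a
  test function. Every bound for kernels of test functions therefore extends to all their
  derivatives.\<close>

lemma dir_derivs_kern:
  assumes "test_fun m"
  shows "\<exists>k. test_fun k \<and> dir_derivs vs (kern m) = kern k"
proof (induction vs)
  case (Cons v vs)
  then show ?case using dir_deriv_kern test_fun_mult_inner by (metis dir_derivs.simps(2))
qed (use assms in auto)

lemma smooth_fun_kern:
  assumes "test_fun m"
  shows "smooth_fun (kern m)"
  unfolding smooth_fun_def
proof (intro allI impI)
  fix vs
  obtain k where "test_fun k" "dir_derivs vs (kern m) = kern k"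
    using dir_derivs_kern[OF assms] by blast
  then show "dir_derivs vs (kern m) differentiable_on UNIV"
    by (auto simp: differentiable_on_def intro: differentiableI kern_has_derivative)
qed

text \<open>Integration by parts: the derivative in direction b of the symbol times the exponential
  has integral 0.\<close>

lemma mult_kern:
  fixes m :: "'a::euclidean_space \<Rightarrow> complex"
  assumes m: "test_fun m" and b: "b \<in> Basis"
  shows "of_real (z \<bullet> b) * kern m z = kern (\<lambda>\<xi>. \<i> * dir_deriv b m \<xi>) z"
proof -
  have c: "smooth_fun (\<lambda>\<xi>. 1 * cis (z \<bullet> \<xi>))" by (rule smooth_fun_cis)
  have sm: "diff_upto 0 m" "diff_upto 0 (\<lambda>\<xi>. 1 * cis (z \<bullet> \<xi>))"
    using m c by (auto simp: test_fun_iff smooth_fun_iff)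
  have t: "test_fun (\<lambda>\<xi>. m \<xi> * (1 * cis (z \<bullet> \<xi>)))"
    using test_fun_mult[OF c m] by (simp add: mult.commute)
  have "0 = (LINT \<xi>|lborel. m \<xi> * (\<i> * of_real (z \<bullet> b) * cis (z \<bullet> \<xi>)) + dir_deriv b m \<xi> * cis (z \<bullet> \<xi>))"
    using integral_dir_deriv_test_fun[OF t, of b]
    unfolding dir_deriv_mult[OF sm] dir_deriv_ext[OF has_derivative_cis_inner] by simp
  also have "\<dots> = \<i> * of_real (z \<bullet> b) * (LINT \<xi>|lborel. m \<xi> * cis (z \<bullet> \<xi>)) + (LINT \<xi>|lborel. dir_deriv b m \<xi> * cis (z \<bullet> \<xi>))"
  proof -
    have eq: "m \<xi> * (\<i> * of_real (z \<bullet> b) * cis (z \<bullet> \<xi>)) = (\<i> * of_real (z \<bullet> b)) * (m \<xi> * cis (z \<bullet> \<xi>))" for \<xi>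
      by (simp add: mult_ac)
    show ?thesis
      unfolding eq
      by (subst Bochner_Integration.integral_add)
        (simp_all only: integral_mult_right_zero integrable_mult_right kern_integrable m test_fun_dir_deriv[OF m b])
  qed
  finally have "\<i> * (\<i> * of_real (z \<bullet> b) * (LINT \<xi>|lborel. m \<xi> * cis (z \<bullet> \<xi>)) + (LINT \<xi>|lborel. dir_deriv b m \<xi> * cis (z \<bullet> \<xi>))) = 0"
    by simp
  then have "of_real (z \<bullet> b) * (LINT \<xi>|lborel. m \<xi> * cis (z \<bullet> \<xi>)) = \<i> * (LINT \<xi>|lborel. dir_deriv b m \<xi> * cis (z \<bullet> \<xi>))"
    by (simp add: distrib_left flip: mult.assoc)
  then show ?thesis
    by (simp add: kern_def mult_ac)
qed

text \<open>Induction on the power of the weight: 1 + norm z is at most 1 plus the sum of the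
  coordinates' absolute values, and \<open>mult_kern\<close> trades a coordinate factor for a
  derivative of the symbol.\<close>

lemma kern_bound:
  assumes "test_fun m"
  shows "\<exists>C. \<forall>z. (1 + norm z) ^ N * norm (kern m z) \<le> C"
  using assms
proof (induction N arbitrary: m)
  case 0
  have "norm (kern m z) \<le> \<bar>1 / (2 * pi) ^ DIM('a)\<bar> * (LINT \<xi>|lborel. norm (m \<xi>))" for z
    using integral_norm_bound[of lborel "\<lambda>\<xi>. m \<xi> * cis (z \<bullet> \<xi>)"]
    unfolding kern_def norm_mult norm_of_real
    by (intro mult_left_mono) (auto simp: norm_mult)
  then show ?case by auto
next
  case (Suc N)
  obtain C where C: "(1 + norm z) ^ N * norm (kern m z) \<le> C" for z
    using Suc by blast
  have "\<forall>b\<in>Basis. \<exists>C. \<forall>z. (1 + norm z) ^ N * norm (kern (\<lambda>\<xi>. \<i> * dir_deriv b m \<xi>) z) \<le> C"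
    by (intro ballI Suc.IH test_fun_cmult test_fun_dir_deriv Suc.prems)
  then obtain D where D: "(1 + norm z) ^ N * norm (kern (\<lambda>\<xi>. \<i> * dir_deriv b m \<xi>) z) \<le> D b" if "b \<in> Basis" for b z
    by metis
  have "(1 + norm z) ^ Suc N * norm (kern m z) \<le> C + (\<Sum>b\<in>Basis. D b)" for z
  proof -
    have "(1 + norm z) ^ Suc N * norm (kern m z) = (1 + norm z) ^ N * norm (kern m z) + norm z * ((1 + norm z) ^ N * norm (kern m z))"
      by (simp add: algebra_simps)
    also have "\<dots> \<le> (1 + norm z) ^ N * norm (kern m z) + (\<Sum>b\<in>Basis. \<bar>z \<bullet> b\<bar>) * ((1 + norm z) ^ N * norm (kern m z))"
      by (intro add_mono mult_right_mono norm_le_l1) auto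
    also have "\<dots> = (1 + norm z) ^ N * norm (kern m z) + (\<Sum>b\<in>Basis. (1 + norm z) ^ N * norm (of_real (z \<bullet> b) * kern m z))"
      unfolding sum_distrib_right by (intro arg_cong2[where f="(+)"] sum.cong) (auto simp: norm_mult)
    also have "\<dots> \<le> C + (\<Sum>b\<in>Basis. D b)"
      by (intro add_mono C sum_mono) (simp add: mult_kern[OF Suc.prems] D)
    finally show ?thesis .
  qed
  then show ?case by blast
qed

lemma schwartz_fun_kern:
  assumes m: "test_fun m"
  shows "schwartz_fun (kern m)"
  unfolding schwartz_fun_def
proof (intro conjI allI impI smooth_fun_kern[OF m])
  fix vs N
  obtain k where k: "test_fun k" "dir_derivs vs (kern m) = kern k"
    using dir_derivs_kern[OF m] by blast
  then show "bounded (range (\<lambda>x. of_real ((1 + norm x) ^ N) * dir_derivs vs (kern m) x))"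
    using kern_bound[OF k(1), of N] by (auto simp: bounded_iff norm_mult norm_power simp del: of_real_power)
qed

lemma kern_scale:
  fixes m :: "'a::euclidean_space \<Rightarrow> complex"
  assumes m: "test_fun m" and "c > 0"
  shows "kern (\<lambda>\<xi>. m ((1 / c) *\<^sub>R \<xi>)) z = of_real (c ^ DIM('a)) * kern m (c *\<^sub>R z)"
proof -
  have [measurable]: "m \<in> borel_measurable borel" using m by (rule test_fun_measurable)
  have "(LINT \<xi>|lborel. m ((1 / c) *\<^sub>R \<xi>) * cis (z \<bullet> \<xi>)) = (LINT \<xi>|lborel. c ^ DIM('a) *\<^sub>R (m ((1 / c) *\<^sub>R (c *\<^sub>R \<xi>)) * cis (z \<bullet> (c *\<^sub>R \<xi>))))"
    by (rule integral_lborel_scale[where f="\<lambda>\<xi>. m ((1 / c) *\<^sub>R \<xi>) * cis (z \<bullet> \<xi>)", symmetric])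
      (use \<open>c > 0\<close> in auto)
  also have "\<dots> = of_real (c ^ DIM('a)) * (LINT \<xi>|lborel. m \<xi> * cis ((c *\<^sub>R z) \<bullet> \<xi>))"
    using \<open>c > 0\<close> by (simp add: scaleR_conv_of_real)
  finally show ?thesis by (simp add: kern_def mult_ac)
qed

lemma kern_orthogonal:
  fixes m :: "'a::euclidean_space \<Rightarrow> complex"
  assumes m: "test_fun m" and A: "orthogonal_transformation A"
    and inv: "\<And>\<xi>. m (A \<xi>) = m \<xi>"
  shows "kern m (A z) = kern m z"
proof -
  have [measurable]: "m \<in> borel_measurable borel" using m by (rule test_fun_measurable)
  have "(LINT \<xi>|lborel. m \<xi> * cis (A z \<bullet> \<xi>)) = (LINT \<xi>|lborel. m (A \<xi>) * cis (A z \<bullet> A \<xi>))"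
    by (rule integral_lborel_orthogonal[where f="\<lambda>\<xi>. m \<xi> * cis (A z \<bullet> \<xi>)", symmetric])
      (use A in auto)
  then show ?thesis using A by (simp add: kern_def inv orthogonal_transformation_def)
qed

section \<open>Fourier inversion\<close>

lemma kern_measurable: "test_fun m \<Longrightarrow> kern m \<in> borel_measurable borel"
  by (intro borel_measurable_continuous_onI smooth_fun_continuous smooth_fun_kern)

text \<open>Decay of order N + 2 d leaves the integrable weight 1 / (1 + norm z)^(2 d) after the
  moment is taken out.\<close>

lemma kern_integrable_moment:
  fixes m :: "'a::euclidean_space \<Rightarrow> complex"
  assumes m: "test_fun m"
  shows "integrable lborel (\<lambda>z. (1 + norm z) ^ N * norm (kern m z))"
proof -
  obtain C where C: "(1 + norm z) ^ (N + 2 * DIM('a)) * norm (kern m z) \<le> C" for z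
    using kern_bound[OF m] by blast
  show ?thesis
  proof (rule Bochner_Integration.integrable_bound)
    show "integrable lborel (\<lambda>z::'a. C * (1 / (1 + norm z) ^ (2 * DIM('a))))"
      by (intro integrable_mult_right integrable_inverse_power_norm) simp
    show "(\<lambda>z. (1 + norm z) ^ N * norm (kern m z)) \<in> borel_measurable lborel"
      using kern_measurable[OF m] by measurable
    have "(1 + norm z) ^ N * norm (kern m z) \<le> C * (1 / (1 + norm z) ^ (2 * DIM('a)))" for z
      using C[of z] add_pos_nonneg[OF zero_less_one norm_ge_zero[of z]]
      by (simp add: power_add pos_le_divide_eq mult_ac)
    moreover have "norm ((1 + norm z) ^ N * norm (kern m z)) = (1 + norm z) ^ N * norm (kern m z)" for z
      by simp
    ultimately show "AE z in lborel. norm ((1 + norm z) ^ N * norm (kern m z)) \<le> norm (C * (1 / (1 + norm z) ^ (2 * DIM('a))))"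
      unfolding real_norm_def by (intro AE_I2) (metis abs_ge_self order_trans)
  qed
qed

lemma integrable_kern:
  assumes "test_fun m"
  shows "integrable lborel (kern m)"
proof -
  have "integrable lborel (\<lambda>z. norm (kern m z))"
    using kern_integrable_moment[OF assms, of 0] by simp
  then show ?thesis
    using kern_measurable[OF assms] by (subst (asm) integrable_norm_iff) auto
qed

text \<open>The product a x * b y is integrable on the product space, and this carries over to every
  measurable function that it dominates.\<close>

lemma Fubini_dominated:
  fixes f :: "'a::euclidean_space \<Rightarrow> 'b::euclidean_space \<Rightarrow> complex"
  assumes [measurable]: "case_prod f \<in> borel_measurable (borel \<Otimes>\<^sub>M borel)"
    and a: "integrable lborel a" and b: "integrable lborel b"
    and bound: "\<And>x y. norm (f x y) \<le> norm (a x * b y :: complex)"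
  shows "(LINT x|lborel. LINT y|lborel. f x y) = (LINT y|lborel. LINT x|lborel. f x y)"
proof -
  have [measurable]: "a \<in> borel_measurable borel" "b \<in> borel_measurable borel"
    using a b by auto
  have ab: "integrable (lborel \<Otimes>\<^sub>M lborel) (\<lambda>(x, y). a x * b y)"
  proof (rule lborel_pair.Fubini_integrable)
    have "(\<lambda>x. LINT y|lborel. norm (case (x, y) of (x, y) \<Rightarrow> a x * b y)) = (\<lambda>x. norm (a x) * (LINT y|lborel. norm (b y)))"
      by (simp add: norm_mult)
    then show "integrable lborel (\<lambda>x. LINT y|lborel. norm (case (x, y) of (x, y) \<Rightarrow> a x * b y))"
      using a by simp
  qed (use b in auto)
  have f: "integrable (lborel \<Otimes>\<^sub>M lborel) (\<lambda>(x, y). f x y)"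
    by (rule Bochner_Integration.integrable_bound[OF ab]) (use bound in auto)
  show "(LINT x|lborel. LINT y|lborel. f x y) = (LINT y|lborel. LINT x|lborel. f x y)"
    by (rule lborel_pair.Fubini_integral[OF f, symmetric])
qed

lemma integral_cis_gaussian_scaled:
  fixes \<xi> :: "'a::euclidean_space"
  assumes "e > 0"
  shows integrable_cis_gaussian_scaled:
      "integrable lborel (\<lambda>z. cis (z \<bullet> \<xi>) * of_real (exp (- (norm (e *\<^sub>R z))\<^sup>2 / 2)))" (is ?I)
    and "(LINT z|lborel. cis (z \<bullet> \<xi>) * of_real (exp (- (norm (e *\<^sub>R z))\<^sup>2 / 2))) =
        of_real ((sqrt (2 * pi) / e) ^ DIM('a) * exp (- (norm ((1 / e) *\<^sub>R \<xi>))\<^sup>2 / 2))" (is ?E)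
proof -
  define g where "g z = cis (z \<bullet> ((1 / e) *\<^sub>R \<xi>)) * of_real (exp (- (norm z)\<^sup>2 / 2))" for z :: 'a
  have g: "integrable lborel g" "(LINT z|lborel. g z) = of_real (sqrt (2 * pi) ^ DIM('a) * exp (- (norm ((1 / e) *\<^sub>R \<xi>))\<^sup>2 / 2))"
    unfolding g_def by (rule integrable_cis_gaussian integral_cis_gaussian)+
  have eq: "cis (z \<bullet> \<xi>) * of_real (exp (- (norm (e *\<^sub>R z))\<^sup>2 / 2)) = g (e *\<^sub>R z)" for z
    using assms by (simp add: g_def)
  have [measurable]: "g \<in> borel_measurable borel" using g(1) by auto
  show ?I
    unfolding eq using integrable_lborel_scale_iff[of g e] g(1) assms by simp
  have "of_real (e ^ DIM('a)) * (LINT z|lborel. g (e *\<^sub>R z)) = of_real (sqrt (2 * pi) ^ DIM('a) * exp (- (norm ((1 / e) *\<^sub>R \<xi>))\<^sup>2 / 2))"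
    using integral_lborel_scale[of g e] assms g(2) by (simp add: scaleR_conv_of_real)
  then show ?E
    unfolding eq using assms by (simp add: field_simps)
qed

text \<open>Both sides of Parseval's identity for \<open>\<phi>\<close> and a Gaussian converge as the Gaussian
  flattens.\<close>

lemma kern_inversion:
  fixes \<phi> :: "'a::euclidean_space \<Rightarrow> complex"
  assumes \<phi>: "test_fun \<phi>"
  shows "(LINT z|lborel. kern \<phi> z * cis (- (z \<bullet> \<xi>))) = \<phi> \<xi>"
proof (rule LIMSEQ_unique)
  define e where "e n = 1 / real (Suc n)" for n
  have e: "e n > 0" "e \<longlonglongrightarrow> 0" for n
    unfolding e_def using LIMSEQ_inverse_real_of_nat by (auto simp: inverse_eq_divide)
  define G where "G n z = complex_of_real (exp (- (norm (e n *\<^sub>R z))\<^sup>2 / 2))" for n and z :: 'a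
  define G1 where "G1 z = complex_of_real (exp (- (norm z)\<^sup>2 / 2))" for z :: 'a
  have G1: "norm (G1 z) \<le> 1" "norm (G n z) \<le> 1" for n z by (auto simp: G_def G1_def)
  have [measurable]: "G n \<in> borel_measurable borel" "G1 \<in> borel_measurable borel" for n
    unfolding G_def[abs_def] G1_def[abs_def] by measurable
  have [measurable]: "\<phi> \<in> borel_measurable borel" "kern \<phi> \<in> borel_measurable borel"
    using \<phi> by (auto intro: test_fun_measurable kern_measurable)
  have Gint: "integrable lborel (G n)" for n
    using integrable_cis_gaussian_scaled[OF e(1)[of n], of 0] by (simp add: G_def[abs_def])
  have G1int: "integrable lborel G1" "(LINT z|lborel. G1 z) = of_real (sqrt (2 * pi) ^ DIM('a))"
    using integrable_cis_gaussian[of 0] integral_cis_gaussian[of "0::'a"] by (simp_all add: G1_def[abs_def])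
  let ?c = "complex_of_real (1 / (2 * pi) ^ DIM('a))"
  let ?I = "\<lambda>n. LINT z|lborel. kern \<phi> z * cis (- (z \<bullet> \<xi>)) * G n z"
  show "?I \<longlonglongrightarrow> (LINT z|lborel. kern \<phi> z * cis (- (z \<bullet> \<xi>)))"
  proof (rule integral_dominated_convergence[where w="\<lambda>z. norm (kern \<phi> z)"])
    show "AE z in lborel. (\<lambda>n. kern \<phi> z * cis (- (z \<bullet> \<xi>)) * G n z) \<longlonglongrightarrow> kern \<phi> z * cis (- (z \<bullet> \<xi>))"
    proof (rule AE_I2)
      fix z
      have "(\<lambda>n. kern \<phi> z * cis (- (z \<bullet> \<xi>)) * G n z) \<longlonglongrightarrow> kern \<phi> z * cis (- (z \<bullet> \<xi>)) * of_real (exp (- (norm (0 *\<^sub>R z))\<^sup>2 / 2))"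
        unfolding G_def by (intro tendsto_intros e) auto
      then show "(\<lambda>n. kern \<phi> z * cis (- (z \<bullet> \<xi>)) * G n z) \<longlonglongrightarrow> kern \<phi> z * cis (- (z \<bullet> \<xi>))" by simp
    qed
    show "AE z in lborel. norm (kern \<phi> z * cis (- (z \<bullet> \<xi>)) * G n z) \<le> norm (kern \<phi> z)" for n
      using mult_left_mono[OF G1(2)] by (auto simp: norm_mult)
    show "integrable lborel (\<lambda>z. norm (kern \<phi> z))"
      by (intro integrable_norm integrable_kern \<phi>)
  qed measurable
  \<comment> \<open>By Fubini, the Gaussian formula and a change of variables, the damped integral
    is an average of \<phi> against a Gaussian of width \<open>e n\<close> around \<xi>.\<close>
  have I: "?I n = ?c * of_real (sqrt (2 * pi) ^ DIM('a)) * (LINT w|lborel. \<phi> (\<xi> + e n *\<^sub>R w) * G1 w)" for n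
  proof -
    let ?S = "complex_of_real ((sqrt (2 * pi) / e n) ^ DIM('a))"
    have "?I n = (LINT z|lborel. LINT \<eta>|lborel. ?c * (\<phi> \<eta> * (cis (z \<bullet> (\<eta> - \<xi>)) * G n z)))"
    proof (rule Bochner_Integration.integral_cong[OF refl])
      fix z
      have "kern \<phi> z * cis (- (z \<bullet> \<xi>)) * G n z = ?c * (LINT \<eta>|lborel. (\<phi> \<eta> * cis (z \<bullet> \<eta>)) * (cis (- (z \<bullet> \<xi>)) * G n z))"
        by (simp add: kern_def)
      also have "\<dots> = (LINT \<eta>|lborel. ?c * (\<phi> \<eta> * (cis (z \<bullet> (\<eta> - \<xi>)) * G n z)))"
      proof -
        have "cis (z \<bullet> (\<eta> - \<xi>)) = cis (z \<bullet> \<eta>) * cis (- (z \<bullet> \<xi>))" for \<eta>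
          by (simp add: cis_mult inner_diff_right)
        then show ?thesis
          by (subst integral_mult_right_zero[symmetric]) (simp add: mult_ac)
      qed
      finally show "kern \<phi> z * cis (- (z \<bullet> \<xi>)) * G n z = \<dots>" .
    qed
    also have "\<dots> = (LINT \<eta>|lborel. LINT z|lborel. ?c * (\<phi> \<eta> * (cis (z \<bullet> (\<eta> - \<xi>)) * G n z)))"
      by (rule Fubini_dominated[OF _ Gint[of n] integrable_mult_right[OF test_fun_integrable[OF \<phi>], of ?c]])
        (measurable, simp add: norm_mult norm_divide mult_ac)
    also have "\<dots> = (LINT \<eta>|lborel. ?c * (\<phi> \<eta> * (?S * G1 ((1 / e n) *\<^sub>R (\<eta> - \<xi>)))))"
      using integral_cis_gaussian_scaled(2)[where ?'a='a, OF e(1)[of n]] by (simp add: G_def G1_def)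
    also have "\<dots> = ?c * ?S * (LINT \<eta>|lborel. \<phi> \<eta> * G1 ((1 / e n) *\<^sub>R (\<eta> - \<xi>)))"
      by (subst integral_mult_right_zero[symmetric]) (simp add: mult_ac)
    also have "(LINT \<eta>|lborel. \<phi> \<eta> * G1 ((1 / e n) *\<^sub>R (\<eta> - \<xi>))) = (LINT \<eta>|lborel. \<phi> (\<xi> + \<eta>) * G1 ((1 / e n) *\<^sub>R \<eta>))"
      using integral_lborel_translate[of "\<lambda>\<eta>. \<phi> \<eta> * G1 ((1 / e n) *\<^sub>R (\<eta> - \<xi>))" \<xi>] by simp
    also have "\<dots> = (LINT \<eta>|lborel. e n ^ DIM('a) *\<^sub>R (\<phi> (\<xi> + e n *\<^sub>R \<eta>) * G1 \<eta>))"
      using integral_lborel_scale[of "\<lambda>\<eta>. \<phi> (\<xi> + \<eta>) * G1 ((1 / e n) *\<^sub>R \<eta>)" "e n"] e(1)[of n] by simp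
    also have "\<dots> = of_real (e n ^ DIM('a)) * (LINT \<eta>|lborel. \<phi> (\<xi> + e n *\<^sub>R \<eta>) * G1 \<eta>)"
      by (simp add: scaleR_conv_of_real)
    finally show ?thesis
      using e(1)[of n] by (simp add: power_divide)
  qed
  have "(\<lambda>n. LINT w|lborel. \<phi> (\<xi> + e n *\<^sub>R w) * G1 w) \<longlonglongrightarrow> (LINT w|lborel. \<phi> \<xi> * G1 w)"
  proof -
    obtain C where C: "norm (\<phi> x) \<le> C" for x by (rule test_fun_bounded[OF \<phi>]) blast
    show ?thesis
    proof (rule integral_dominated_convergence[where w="\<lambda>w. C * norm (G1 w)"])
      show "AE w in lborel. (\<lambda>n. \<phi> (\<xi> + e n *\<^sub>R w) * G1 w) \<longlonglongrightarrow> \<phi> \<xi> * G1 w"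
      proof (rule AE_I2)
        fix w
        have "(\<lambda>n. \<xi> + e n *\<^sub>R w) \<longlonglongrightarrow> \<xi> + 0 *\<^sub>R w" by (intro tendsto_intros e)
        moreover have "isCont \<phi> (\<xi> + 0 *\<^sub>R w)"
          using test_fun_continuous[OF \<phi>, of UNIV] by (simp add: continuous_on_eq_continuous_at)
        ultimately have "(\<lambda>n. \<phi> (\<xi> + e n *\<^sub>R w)) \<longlonglongrightarrow> \<phi> (\<xi> + 0 *\<^sub>R w)"
          by (rule isCont_tendsto_compose[rotated])
        then show "(\<lambda>n. \<phi> (\<xi> + e n *\<^sub>R w) * G1 w) \<longlonglongrightarrow> \<phi> \<xi> * G1 w"
          by (intro tendsto_mult tendsto_const) simp
      qed
      show "AE w in lborel. norm (\<phi> (\<xi> + e n *\<^sub>R w) * G1 w) \<le> C * norm (G1 w)" for n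
        using C by (intro AE_I2) (auto simp: norm_mult intro: mult_right_mono)
    qed (use G1int in auto)
  qed
  then have "?I \<longlonglongrightarrow> ?c * of_real (sqrt (2 * pi) ^ DIM('a)) * (LINT w|lborel. \<phi> \<xi> * G1 w)"
    unfolding I by (intro tendsto_mult tendsto_const)
  \<comment> \<open>One factor sqrt (2 pi)^d comes from transforming the Gaussian, the other is its
    total mass; together they cancel the normalisation of \<open>kern\<close>.\<close>
  moreover have "?c * of_real (sqrt (2 * pi) ^ DIM('a)) * (LINT w|lborel. \<phi> \<xi> * G1 w) = \<phi> \<xi>"
  proof -
    have "1 / (2 * pi) ^ DIM('a) * (sqrt (2 * pi) ^ DIM('a) * sqrt (2 * pi) ^ DIM('a)) = 1"
      unfolding power_mult_distrib[symmetric] by simp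
    then have *: "?c * (of_real (sqrt (2 * pi) ^ DIM('a)) * of_real (sqrt (2 * pi) ^ DIM('a))) = 1"
      by (simp only: of_real_mult[symmetric] of_real_1)
    have "c * S * (a * S) = (c * (S * S)) * a" for a c S :: complex
      by (simp only: mult_ac)
    then show ?thesis
      unfolding integral_mult_right_zero G1int(2) by (simp only: * mult_1)
  qed
  ultimately show "?I \<longlonglongrightarrow> \<phi> \<xi>" by simp
qed

lemma integral_kern:
  assumes "test_fun \<phi>"
  shows "(LINT z|lborel. kern \<phi> z) = \<phi> 0"
  using kern_inversion[OF assms, of 0] by simp

text \<open>The convolution theorem: inserting the integral for \<open>kern m\<close> and exchanging
  the integrals leaves the transform of \<open>kern \<phi>\<close>, which the inversion formula
  evaluates. The form with x - y lets T act on y afterwards.\<close>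

lemma kern_mult:
  fixes m \<phi> :: "'a::euclidean_space \<Rightarrow> complex"
  assumes m: "test_fun m" and \<phi>: "test_fun \<phi>"
  shows "kern (\<lambda>\<xi>. m \<xi> * \<phi> \<xi>) (x - y) = (LINT w|lborel. kern m (x - w) * kern \<phi> (w - y))"
proof -
  have [measurable]: "m \<in> borel_measurable borel" "\<phi> \<in> borel_measurable borel"
    "kern \<phi> \<in> borel_measurable borel" "kern m \<in> borel_measurable borel"
    using m \<phi> by (auto intro: test_fun_measurable kern_measurable)
  let ?c = "complex_of_real (1 / (2 * pi) ^ DIM('a))"
  have "(LINT w|lborel. kern m (x - w) * kern \<phi> (w - y)) = (LINT w|lborel. kern m (x - y - w) * kern \<phi> w)"
    using integral_lborel_translate[of "\<lambda>w. kern m (x - w) * kern \<phi> (w - y)" y] by (simp add: diff_diff_eq)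
  also have "\<dots> = (LINT w|lborel. LINT \<xi>|lborel. ?c * (m \<xi> * cis ((x - y - w) \<bullet> \<xi>) * kern \<phi> w))"
    by (simp add: kern_def[of m])
  also have "\<dots> = (LINT \<xi>|lborel. LINT w|lborel. ?c * (m \<xi> * cis ((x - y - w) \<bullet> \<xi>) * kern \<phi> w))"
    by (rule Fubini_dominated[OF _ integrable_kern[OF \<phi>] integrable_mult_right[OF test_fun_integrable[OF m], of ?c]])
      (measurable, simp add: norm_mult norm_divide mult_ac)
  also have "\<dots> = (LINT \<xi>|lborel. LINT w|lborel. (?c * m \<xi> * cis ((x - y) \<bullet> \<xi>)) * (kern \<phi> w * cis (- (w \<bullet> \<xi>))))"
  proof -
    have "cis ((x - y - w) \<bullet> \<xi>) = cis ((x - y) \<bullet> \<xi>) * cis (- (w \<bullet> \<xi>))" for w \<xi>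
      by (simp add: cis_mult inner_diff_left)
    then show ?thesis by (simp add: mult_ac)
  qed
  also have "\<dots> = (LINT \<xi>|lborel. (?c * m \<xi> * cis ((x - y) \<bullet> \<xi>)) * \<phi> \<xi>)"
    by (simp only: integral_mult_right_zero kern_inversion[OF \<phi>])
  also have "\<dots> = kern (\<lambda>\<xi>. m \<xi> * \<phi> \<xi>) (x - y)"
    unfolding kern_def by (subst integral_mult_right_zero[symmetric]) (simp add: mult_ac)
  finally show ?thesis by simp
qed

section \<open>Tempered distributions\<close>

lemma dir_derivs_add:
  assumes "smooth_fun f" "smooth_fun g" "set vs \<subseteq> Basis"
  shows "dir_derivs vs (\<lambda>x. f x + g x) = (\<lambda>x. dir_derivs vs f x + dir_derivs vs g x)"
  using assms(3)
proof (induction vs)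
  case (Cons v vs)
  have "diff_upto 0 (dir_derivs vs f)" "diff_upto 0 (dir_derivs vs g)"
    using Cons.prems smooth_fun_dir_derivs[OF assms(1), of vs] smooth_fun_dir_derivs[OF assms(2), of vs]
    by (auto simp: smooth_fun_iff)
  then show ?case using Cons by (simp add: dir_deriv_add)
qed simp

lemma dir_derivs_cmult:
  assumes "smooth_fun f" "set vs \<subseteq> Basis"
  shows "dir_derivs vs (\<lambda>x. c * f x) = (\<lambda>x. c * dir_derivs vs f x)"
  using assms(2)
proof (induction vs)
  case (Cons v vs)
  have "diff_upto 0 (\<lambda>x. c)" "diff_upto 0 (dir_derivs vs f)"
    using Cons.prems smooth_fun_dir_derivs[OF assms(1), of vs]
    by (auto simp: smooth_fun_iff diff_upto_const)
  then show ?case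
    using Cons dir_deriv_mult[of 0 "\<lambda>x. c" "dir_derivs vs f" v] by (simp add: dir_deriv_const)
qed simp

lemma dir_derivs_diff:
  assumes "smooth_fun f" "smooth_fun g" "set vs \<subseteq> Basis"
  shows "dir_derivs vs (\<lambda>x. f x + (-1) * g x) = (\<lambda>x. dir_derivs vs f x - dir_derivs vs g x)"
  unfolding dir_derivs_add[OF assms(1) smooth_fun_mult[OF smooth_fun_const assms(2)] assms(3)]
    dir_derivs_cmult[OF assms(2,3)] by simp

lemma dir_derivs_reflect:
  fixes k :: "'a::euclidean_space \<Rightarrow> complex"
  assumes "smooth_fun k" "set vs \<subseteq> Basis"
  shows "dir_derivs vs (\<lambda>y. k (x - y)) = (\<lambda>y. (-1) ^ length vs * dir_derivs vs k (x - y))"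
  using assms(2)
proof (induction vs)
  case (Cons v vs)
  let ?g = "dir_derivs vs k"
  have g: "smooth_fun ?g" using Cons.prems assms(1) by (intro smooth_fun_dir_derivs) auto
  have "((\<lambda>y. (-1) ^ length vs * ?g (x - y)) has_derivative (\<lambda>v. (-1) ^ length vs * dir_deriv (- v) ?g (x - y))) (at y)" for y
    by (rule has_derivative_mult_right)
      (rule has_derivative_compose[OF _ smooth_fun_has_derivative[OF g], THEN has_derivative_eq_rhs];
        auto intro!: derivative_eq_intros)
  note dir_deriv_ext[OF this]
  moreover have "dir_deriv (- v) ?g z = - dir_deriv v ?g z" for z
    by (rule linear_neg[OF bounded_linear.linear[OF has_derivative_bounded_linear[OF smooth_fun_has_derivative[OF g]]]])
  ultimately show ?case
    using Cons by simp
qed simp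

lemma schwartz_fun_smooth: "schwartz_fun f \<Longrightarrow> smooth_fun f"
  by (simp add: schwartz_fun_def)

lemma schwartz_fun_iff:
  "schwartz_fun f \<longleftrightarrow> smooth_fun f \<and>
    (\<forall>vs N. set vs \<subseteq> Basis \<longrightarrow> (\<exists>C. \<forall>x. (1 + norm x) ^ N * norm (dir_derivs vs f x) \<le> C))"
proof -
  have "norm (of_real ((1 + norm x) ^ N) * dir_derivs vs f x) = (1 + norm x) ^ N * norm (dir_derivs vs f x)" for x vs N
    by (simp add: norm_mult norm_power del: of_real_power)
  then show ?thesis by (simp add: schwartz_fun_def bounded_iff del: of_real_power)
qed

text \<open>One constant serves all derivatives up to order M because there are only finitely many
  lists of basis vectors of bounded length.\<close>

lemma schwartz_fun_bound:
  fixes f :: "'a::euclidean_space \<Rightarrow> complex"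
  assumes "schwartz_fun f"
  obtains C where "C \<ge> 0"
    "\<And>vs x. set vs \<subseteq> Basis \<Longrightarrow> length vs \<le> M \<Longrightarrow> (1 + norm x) ^ N * norm (dir_derivs vs f x) \<le> C"
proof -
  define c where "c vs = (SOME C. \<forall>x. (1 + norm x) ^ N * norm (dir_derivs vs f x) \<le> C)" for vs
  have c: "(1 + norm x) ^ N * norm (dir_derivs vs f x) \<le> c vs" if "set vs \<subseteq> Basis" for vs x
    using assms that someI_ex[of "\<lambda>C. \<forall>x. (1 + norm x) ^ N * norm (dir_derivs vs f x) \<le> C"]
    unfolding c_def schwartz_fun_iff by blast
  let ?S = "{vs. set vs \<subseteq> Basis \<and> length vs \<le> M}"
  have fin: "finite ?S" by (rule finite_lists_length_le) simp
  show ?thesis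
  proof (rule that[of "\<Sum>vs\<in>?S. \<bar>c vs\<bar>"])
    fix vs :: "'a list" and x :: 'a assume "set vs \<subseteq> Basis" "length vs \<le> M"
    then have "\<bar>c vs\<bar> \<le> (\<Sum>vs\<in>?S. \<bar>c vs\<bar>)"
      using fin by (intro member_le_sum) auto
    then show "(1 + norm x) ^ N * norm (dir_derivs vs f x) \<le> (\<Sum>vs\<in>?S. \<bar>c vs\<bar>)"
      using c[OF \<open>set vs \<subseteq> Basis\<close>, of x] by linarith
  qed (auto intro: sum_nonneg)
qed

section \<open>Closure properties of Schwartz functions and weighted bounds for translates\<close>

lemma schwartz_fun_add:
  fixes f :: "'a::euclidean_space \<Rightarrow> complex"
  assumes "schwartz_fun f" "schwartz_fun g"
  shows "schwartz_fun (\<lambda>x. f x + g x)"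
  unfolding schwartz_fun_iff
proof (intro conjI allI impI)
  show "smooth_fun (\<lambda>x. f x + g x)"
    using assms by (intro smooth_fun_add schwartz_fun_smooth)
  fix vs :: "'a list" and N assume vs: "set vs \<subseteq> Basis"
  obtain C D where C: "(1 + norm x) ^ N * norm (dir_derivs vs f x) \<le> C"
    and D: "(1 + norm x) ^ N * norm (dir_derivs vs g x) \<le> D" for x
    using assms vs unfolding schwartz_fun_iff by meson
  have "(1 + norm x) ^ N * norm (dir_derivs vs (\<lambda>x. f x + g x) x) \<le> C + D" for x
  proof -
    have "(1 + norm x) ^ N * norm (dir_derivs vs f x + dir_derivs vs g x)
        \<le> (1 + norm x) ^ N * (norm (dir_derivs vs f x) + norm (dir_derivs vs g x))"
      by (intro mult_left_mono norm_triangle_ineq) auto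
    also have "\<dots> \<le> C + D" using C[of x] D[of x] by (simp add: distrib_left)
    finally show ?thesis
      using assms vs by (simp add: dir_derivs_add schwartz_fun_smooth)
  qed
  then show "\<exists>C. \<forall>x. (1 + norm x) ^ N * norm (dir_derivs vs (\<lambda>x. f x + g x) x) \<le> C" by blast
qed

lemma schwartz_fun_cmult:
  fixes f :: "'a::euclidean_space \<Rightarrow> complex"
  assumes "schwartz_fun f"
  shows "schwartz_fun (\<lambda>x. c * f x)"
  unfolding schwartz_fun_iff
proof (intro conjI allI impI)
  show "smooth_fun (\<lambda>x. c * f x)"
    using assms by (intro smooth_fun_mult smooth_fun_const schwartz_fun_smooth)
  fix vs :: "'a list" and N assume vs: "set vs \<subseteq> Basis"
  obtain C where C: "(1 + norm x) ^ N * norm (dir_derivs vs f x) \<le> C" for x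
    using assms vs unfolding schwartz_fun_iff by meson
  have "(1 + norm x) ^ N * norm (dir_derivs vs (\<lambda>x. c * f x) x) \<le> norm c * C" for x
    using mult_left_mono[OF C[of x] norm_ge_zero[of c]] assms vs
    by (simp add: dir_derivs_cmult schwartz_fun_smooth norm_mult mult_ac)
  then show "\<exists>C. \<forall>x. (1 + norm x) ^ N * norm (dir_derivs vs (\<lambda>x. c * f x) x) \<le> C" by blast
qed

lemma schwartz_fun_sum:
  fixes f :: "'i \<Rightarrow> 'a::euclidean_space \<Rightarrow> complex"
  assumes "finite I" "\<And>i. i \<in> I \<Longrightarrow> schwartz_fun (f i)"
  shows "schwartz_fun (\<lambda>x. \<Sum>i\<in>I. c i * f i x)"
  using assms
proof (induction I)
  case empty
  have "dir_derivs vs (\<lambda>x. 0) = (\<lambda>x::'a. 0)" for vs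
    by (induction vs) (auto simp: dir_deriv_const)
  then show ?case by (auto simp: schwartz_fun_iff smooth_fun_const)
qed (auto intro!: schwartz_fun_add schwartz_fun_cmult)

lemma schwartz_fun_dir_derivs:
  assumes "schwartz_fun f" "set vs \<subseteq> Basis"
  shows "schwartz_fun (dir_derivs vs f)"
  using assms unfolding schwartz_fun_iff
  by (auto simp: smooth_fun_dir_derivs dir_derivs_append[symmetric])

text \<open>Peetre's inequality for the weight 1 + norm; it moves polynomial weights between y, x
  and x - y.\<close>

lemma one_plus_norm_le: "1 + norm y \<le> (1 + norm x) * (1 + norm (x - y))"
proof -
  have "norm y \<le> norm x + norm (x - y)" using norm_triangle_sub[of y x] by (simp add: norm_minus_commute)
  also have "\<dots> \<le> norm x + norm (x - y) + norm x * norm (x - y)" by simp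
  finally show ?thesis by (simp add: algebra_simps)
qed

lemma schwartz_fun_reflect_bound:
  fixes k :: "'a::euclidean_space \<Rightarrow> complex"
  assumes k: "schwartz_fun k"
  obtains C where "C \<ge> 0"
    "\<And>vs x y. set vs \<subseteq> Basis \<Longrightarrow> length vs \<le> M \<Longrightarrow>
      (1 + norm y) ^ N * norm (dir_derivs vs (\<lambda>y. k (x - y)) y) \<le> C * (1 + norm x) ^ N"
proof -
  obtain C where C: "C \<ge> 0" "\<And>vs x. set vs \<subseteq> Basis \<Longrightarrow> length vs \<le> M \<Longrightarrow> (1 + norm x) ^ N * norm (dir_derivs vs k x) \<le> C"
    by (rule schwartz_fun_bound[OF k, of M N]) blast
  show ?thesis
  proof (rule that[OF C(1)])
    fix vs :: "'a list" and x y :: 'a assume vs: "set vs \<subseteq> Basis" "length vs \<le> M"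
    have "(1 + norm y) ^ N * norm (dir_derivs vs k (x - y)) \<le> ((1 + norm x) * (1 + norm (x - y))) ^ N * norm (dir_derivs vs k (x - y))"
      by (intro mult_right_mono power_mono one_plus_norm_le) auto
    also have "\<dots> \<le> (1 + norm x) ^ N * C"
      using C(2)[OF vs, of "x - y"] by (simp add: power_mult_distrib mult.assoc mult_left_mono)
    finally show "(1 + norm y) ^ N * norm (dir_derivs vs (\<lambda>y. k (x - y)) y) \<le> C * (1 + norm x) ^ N"
      using vs k by (simp add: dir_derivs_reflect schwartz_fun_smooth norm_mult norm_power mult.commute)
  qed
qed

lemma schwartz_fun_reflect:
  fixes k :: "'a::euclidean_space \<Rightarrow> complex"
  assumes k: "schwartz_fun k"
  shows "schwartz_fun (\<lambda>y. k (x - y))"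
  unfolding schwartz_fun_iff
proof (intro conjI allI impI)
  show "smooth_fun (\<lambda>y. k (x - y))"
    using smooth_fun_affine[OF schwartz_fun_smooth[OF k], of x "-1"] by simp
  fix vs :: "'a list" and N assume vs: "set vs \<subseteq> Basis"
  obtain C where "\<And>ws x y. set ws \<subseteq> Basis \<Longrightarrow> length ws \<le> length vs \<Longrightarrow>
      (1 + norm y) ^ N * norm (dir_derivs ws (\<lambda>y. k (x - y)) y) \<le> C * (1 + norm x) ^ N"
    by (rule schwartz_fun_reflect_bound[OF k, of "length vs" N]) blast
  then show "\<exists>C. \<forall>y. (1 + norm y) ^ N * norm (dir_derivs vs (\<lambda>y. k (x - y)) y) \<le> C"
    using vs by blast
qed

text \<open>Mean value inequality for a derivative of k between a - y and b - y, which uses one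
  derivative more. It yields continuity of convolutions and the convergence of approximating
  superpositions in the topology that controls T.\<close>

lemma schwartz_fun_reflect_lipschitz:
  fixes k :: "'a::euclidean_space \<Rightarrow> complex"
  assumes k: "schwartz_fun k"
  obtains C where "C \<ge> 0"
    "\<And>vs a b y. set vs \<subseteq> Basis \<Longrightarrow> length vs \<le> M \<Longrightarrow>
      (1 + norm y) ^ N * norm (dir_derivs vs (\<lambda>y. k (a - y)) y - dir_derivs vs (\<lambda>y. k (b - y)) y)
        \<le> C * norm (a - b) * (1 + norm a + norm b) ^ N"
proof -
  obtain C where C: "C \<ge> 0" "\<And>vs x. set vs \<subseteq> Basis \<Longrightarrow> length vs \<le> Suc M \<Longrightarrow> (1 + norm x) ^ N * norm (dir_derivs vs k x) \<le> C"
    by (rule schwartz_fun_bound[OF k, of "Suc M" N]) blast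
  show ?thesis
  proof (rule that[of "real DIM('a) * C"])
    fix vs :: "'a list" and a b y :: 'a assume vs: "set vs \<subseteq> Basis" "length vs \<le> M"
    let ?g = "dir_derivs vs k" and ?R = "1 + norm a + norm b"
    have g: "smooth_fun ?g" using vs k by (intro smooth_fun_dir_derivs schwartz_fun_smooth)
    have pos: "(1 + norm y) ^ N > 0" by (intro zero_less_power add_pos_nonneg) auto
    have "norm (?g (a - y) - ?g (b - y)) \<le> (real DIM('a) * (C * ?R ^ N / (1 + norm y) ^ N)) * norm ((a - y) - (b - y))"
    proof (rule smooth_fun_lipschitz[OF g])
      fix z assume "z \<in> closed_segment (a - y) (b - y)"
      then obtain u where u: "0 \<le> u" "u \<le> 1" "z = (1 - u) *\<^sub>R (a - y) + u *\<^sub>R (b - y)"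
        by (auto simp: closed_segment_def)
      \<comment> \<open>A point of the segment is a convex combination of a and b, minus y; so the
        weight at y costs at most the factor \<open>?R ^ N\<close>, uniformly on the
        segment.\<close>
      have z: "z = ((1 - u) *\<^sub>R a + u *\<^sub>R b) - y" by (simp add: u algebra_simps)
      have "norm ((1 - u) *\<^sub>R a + u *\<^sub>R b) \<le> norm a + norm b"
        using u norm_triangle_ineq[of "(1 - u) *\<^sub>R a" "u *\<^sub>R b"]
          mult_left_le_one_le[of "norm a" "1 - u"] mult_left_le_one_le[of "norm b" u] by simp
      moreover have "1 + norm y \<le> (1 + norm ((1 - u) *\<^sub>R a + u *\<^sub>R b)) * (1 + norm z)"
        unfolding z by (rule one_plus_norm_le)
      ultimately have yz: "1 + norm y \<le> ?R * (1 + norm z)"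
        by (smt (verit, best) mult_right_mono norm_ge_zero)
      have "norm (dir_deriv c ?g z) \<le> C * ?R ^ N / (1 + norm y) ^ N" if "c \<in> Basis" for c
      proof -
        have "(1 + norm y) ^ N * norm (dir_deriv c ?g z) \<le> (?R * (1 + norm z)) ^ N * norm (dir_deriv c ?g z)"
          by (intro mult_right_mono power_mono yz) auto
        also have "\<dots> \<le> ?R ^ N * C"
          using C(2)[of "c # vs" z] vs that by (simp add: power_mult_distrib mult.assoc mult_left_mono)
        finally show ?thesis using pos by (simp add: pos_le_divide_eq mult.commute)
      qed
      from sum_mono[OF this, of Basis "\<lambda>c. c"]
      show "(\<Sum>c\<in>Basis. norm (dir_deriv c ?g z)) \<le> real DIM('a) * (C * ?R ^ N / (1 + norm y) ^ N)"
        by simp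
    qed
    then have "(1 + norm y) ^ N * norm (?g (a - y) - ?g (b - y)) \<le> real DIM('a) * C * norm (a - b) * ?R ^ N"
      using mult_left_mono[OF _ less_imp_le[OF pos]] pos by (fastforce simp: field_simps)
    moreover have "dir_derivs vs (\<lambda>y. k (a - y)) y - dir_derivs vs (\<lambda>y. k (b - y)) y = (-1) ^ length vs * (?g (a - y) - ?g (b - y))"
      using vs k by (simp add: dir_derivs_reflect schwartz_fun_smooth algebra_simps)
    ultimately show "(1 + norm y) ^ N * norm (dir_derivs vs (\<lambda>y. k (a - y)) y - dir_derivs vs (\<lambda>y. k (b - y)) y)
        \<le> real DIM('a) * C * norm (a - b) * ?R ^ N"
      by (simp add: norm_mult norm_power)
  qed (use C in auto)
qed

text \<open>The lower bound needs the hypothesis as well: the supremum of an unbounded set of reals is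
  unspecified.\<close>

lemma schwartz_seminorm_bounds:
  fixes f :: "'a::euclidean_space \<Rightarrow> complex"
  assumes "\<And>vs x. set vs \<subseteq> Basis \<Longrightarrow> length vs \<le> N \<Longrightarrow> (1 + norm x) ^ N * norm (dir_derivs vs f x) \<le> B"
  shows "0 \<le> schwartz_seminorm N f" "schwartz_seminorm N f \<le> B"
proof -
  let ?S = "{vs. set vs \<subseteq> Basis \<and> length vs \<le> N} \<times> (UNIV :: 'a set)"
  let ?F = "\<lambda>(vs, x). (1 + norm x) ^ N * norm (dir_derivs vs f x)"
  have ne: "([], 0) \<in> ?S" by simp
  have bdd: "bdd_above (?F ` ?S)" using assms by (intro bdd_aboveI[of _ B]) auto
  have "0 \<le> ?F ([], 0)" by simp
  also have "\<dots> \<le> Sup (?F ` ?S)" by (rule cSUP_upper[OF ne bdd])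
  finally show "0 \<le> schwartz_seminorm N f" unfolding schwartz_seminorm_def .
  have "Sup (?F ` ?S) \<le> B" by (intro cSUP_least) (use ne in blast, use assms in auto)
  then show "schwartz_seminorm N f \<le> B" unfolding schwartz_seminorm_def .
qed

text \<open>Continuity of T in a form that accepts any common bound B for the weighted derivatives,
  which avoids handling the supremum again. The absolute value of C appears because the definition
  does not fix its sign.\<close>

lemma tempered_bound:
  fixes T :: "'a::euclidean_space distribution"
  assumes "tempered_distribution T"
  obtains C N where "C \<ge> 0"
    "\<And>f B. schwartz_fun f \<Longrightarrow>
      (\<And>vs x. set vs \<subseteq> Basis \<Longrightarrow> length vs \<le> N \<Longrightarrow> (1 + norm x) ^ N * norm (dir_derivs vs f x) \<le> B) \<Longrightarrow>
      norm (T f) \<le> C * B"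
proof -
  obtain C N where CN: "\<And>f. schwartz_fun f \<Longrightarrow> norm (T f) \<le> C * schwartz_seminorm N f"
    using assms unfolding tempered_distribution_def by blast
  show ?thesis
  proof (rule that[of "\<bar>C\<bar>" N])
    fix f :: "'a \<Rightarrow> complex" and B assume f: "schwartz_fun f"
      "\<And>vs x. set vs \<subseteq> Basis \<Longrightarrow> length vs \<le> N \<Longrightarrow> (1 + norm x) ^ N * norm (dir_derivs vs f x) \<le> B"
    have "norm (T f) \<le> \<bar>C\<bar> * schwartz_seminorm N f"
      using CN[OF f(1)] schwartz_seminorm_bounds(1)[of N f B] f(2)
      by (smt (verit, best) abs_ge_self mult_right_mono)
    also have "\<dots> \<le> \<bar>C\<bar> * B"
      using schwartz_seminorm_bounds(2)[of N f B] f(2) by (intro mult_left_mono) auto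
    finally show "norm (T f) \<le> \<bar>C\<bar> * B" .
  qed auto
qed

lemma
  assumes "tempered_distribution T" "schwartz_fun f"
  shows tempered_add: "schwartz_fun g \<Longrightarrow> T (\<lambda>x. f x + g x) = T f + T g"
    and tempered_cmult: "T (\<lambda>x. c * f x) = c * T f"
    and tempered_diff: "schwartz_fun g \<Longrightarrow> T (\<lambda>x. f x - g x) = T f - T g"
proof -
  have add: "T (\<lambda>x. f x + g x) = T f + T g" if "schwartz_fun f" "schwartz_fun g" for f g
    using assms(1) that unfolding tempered_distribution_def by blast
  have cmult: "T (\<lambda>x. c * f x) = c * T f" if "schwartz_fun f" for c f
    using assms(1) that unfolding tempered_distribution_def by blast
  show "T (\<lambda>x. f x + g x) = T f + T g" if "schwartz_fun g"
    by (rule add[OF assms(2) that])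
  show "T (\<lambda>x. c * f x) = c * T f"
    by (rule cmult[OF assms(2)])
  show "T (\<lambda>x. f x - g x) = T f - T g" if "schwartz_fun g"
    using add[OF assms(2) schwartz_fun_cmult[OF that, of "-1"]] cmult[OF that, of "-1"] by simp
qed

lemma tempered_sum:
  assumes T: "tempered_distribution T" and "finite I" "\<And>i. i \<in> I \<Longrightarrow> schwartz_fun (f i)"
  shows "T (\<lambda>x. \<Sum>i\<in>I. c i * f i x) = (\<Sum>i\<in>I. c i * T (f i))"
  using assms(2,3)
proof (induction I)
  case empty
  have "schwartz_fun (\<lambda>x::'a. 0)" using schwartz_fun_sum[of "{}"] by simp
  from tempered_cmult[OF T this, of 0] show ?case by simp
next
  case (insert i I)
  then show ?case
    by (simp add: tempered_add[OF T] tempered_cmult[OF T] schwartz_fun_cmult schwartz_fun_sum)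
qed

section \<open>Convolution of tempered distributions with Schwartz functions\<close>

definition conv_dist :: "('a::euclidean_space \<Rightarrow> complex) \<Rightarrow> 'a distribution \<Rightarrow> 'a \<Rightarrow> complex" where
  "conv_dist k T x = T (\<lambda>y. k (x - y))"

lemma conv_dist_bound:
  fixes k :: "'a::euclidean_space \<Rightarrow> complex"
  assumes T: "tempered_distribution T" and k: "schwartz_fun k"
  obtains C N where "C \<ge> 0" "\<And>x. norm (conv_dist k T x) \<le> C * (1 + norm x) ^ N"
proof -
  obtain C N where C: "C \<ge> 0" "\<And>f B. schwartz_fun f \<Longrightarrow>
      (\<And>vs x. set vs \<subseteq> Basis \<Longrightarrow> length vs \<le> N \<Longrightarrow> (1 + norm x) ^ N * norm (dir_derivs vs f x) \<le> B) \<Longrightarrow>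
      norm (T f) \<le> C * B"
    by (rule tempered_bound[OF T]) blast
  obtain D where D: "D \<ge> 0" "\<And>vs x y. set vs \<subseteq> Basis \<Longrightarrow> length vs \<le> N \<Longrightarrow>
      (1 + norm y) ^ N * norm (dir_derivs vs (\<lambda>y. k (x - y)) y) \<le> D * (1 + norm x) ^ N"
    by (rule schwartz_fun_reflect_bound[OF k, of N N]) blast
  show ?thesis
  proof (rule that[of "C * D" N])
    show "norm (conv_dist k T x) \<le> C * D * (1 + norm x) ^ N" for x
      using C(2)[OF schwartz_fun_reflect[OF k] D(2)] by (simp add: conv_dist_def mult.assoc)
  qed (use C D in simp)
qed

lemma conv_dist_lipschitz:
  fixes k :: "'a::euclidean_space \<Rightarrow> complex"
  assumes T: "tempered_distribution T" and k: "schwartz_fun k"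
  obtains C N where "C \<ge> 0"
    "\<And>a b. norm (conv_dist k T a - conv_dist k T b) \<le> C * norm (a - b) * (1 + norm a + norm b) ^ N"
proof -
  obtain C N where C: "C \<ge> 0" "\<And>f B. schwartz_fun f \<Longrightarrow>
      (\<And>vs x. set vs \<subseteq> Basis \<Longrightarrow> length vs \<le> N \<Longrightarrow> (1 + norm x) ^ N * norm (dir_derivs vs f x) \<le> B) \<Longrightarrow>
      norm (T f) \<le> C * B"
    by (rule tempered_bound[OF T]) blast
  obtain D where D: "D \<ge> 0" "\<And>vs a b y. set vs \<subseteq> Basis \<Longrightarrow> length vs \<le> N \<Longrightarrow>
      (1 + norm y) ^ N * norm (dir_derivs vs (\<lambda>y. k (a - y)) y - dir_derivs vs (\<lambda>y. k (b - y)) y)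
        \<le> D * norm (a - b) * (1 + norm a + norm b) ^ N"
    by (rule schwartz_fun_reflect_lipschitz[OF k, of N N]) blast
  show ?thesis
  proof (rule that[of "C * D" N])
    fix a b :: 'a
    have s: "schwartz_fun (\<lambda>y. k (a - y))" "schwartz_fun (\<lambda>y. (-1) * k (b - y))"
      by (intro schwartz_fun_cmult schwartz_fun_reflect k)+
    have "norm (T (\<lambda>y. k (a - y) + (-1) * k (b - y))) \<le> C * (D * norm (a - b) * (1 + norm a + norm b) ^ N)"
    proof (rule C(2)[OF schwartz_fun_add[OF s]])
      fix vs :: "'a list" and x :: 'a assume vs: "set vs \<subseteq> Basis" "length vs \<le> N"
      have "dir_derivs vs (\<lambda>y. k (a - y) + (-1) * k (b - y)) = (\<lambda>y. dir_derivs vs (\<lambda>y. k (a - y)) y + (-1) * dir_derivs vs (\<lambda>y. k (b - y)) y)"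
        using vs s schwartz_fun_reflect[OF k]
        by (subst dir_derivs_add, simp_all only: schwartz_fun_smooth, subst dir_derivs_cmult, simp_all add: schwartz_fun_smooth)
      then show "(1 + norm x) ^ N * norm (dir_derivs vs (\<lambda>y. k (a - y) + (-1) * k (b - y)) x) \<le> D * norm (a - b) * (1 + norm a + norm b) ^ N"
        using D(2)[OF vs, of x a b] by simp
    qed
    then show "norm (conv_dist k T a - conv_dist k T b) \<le> C * D * norm (a - b) * (1 + norm a + norm b) ^ N"
      using tempered_diff[OF T schwartz_fun_reflect[OF k] schwartz_fun_reflect[OF k], of a b]
      by (simp add: conv_dist_def mult.assoc)
  qed (use C D in simp)
qed

lemma conv_dist_continuous:
  fixes k :: "'a::euclidean_space \<Rightarrow> complex"
  assumes T: "tempered_distribution T" and k: "schwartz_fun k"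
  shows "continuous_on UNIV (conv_dist k T)"
proof -
  obtain C N where C: "C \<ge> 0"
    "\<And>a b. norm (conv_dist k T a - conv_dist k T b) \<le> C * norm (a - b) * (1 + norm a + norm b) ^ N"
    by (rule conv_dist_lipschitz[OF T k]) blast
  have "(conv_dist k T \<longlongrightarrow> conv_dist k T b) (at b)" for b
  proof (rule Lim_null_comparison[THEN Lim_null[THEN iffD2]])
    show "\<forall>\<^sub>F a in at b. norm (conv_dist k T a - conv_dist k T b) \<le> C * norm (a - b) * (1 + norm a + norm b) ^ N"
      using C(2) by auto
    have "((\<lambda>a. C * norm (a - b) * (1 + norm a + norm b) ^ N) \<longlongrightarrow> C * norm (b - b) * (1 + norm b + norm b) ^ N) (at b)"
      by (intro tendsto_intros)
    then show "((\<lambda>a. C * norm (a - b) * (1 + norm a + norm b) ^ N) \<longlongrightarrow> 0) (at b)" by simp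
  qed
  then show ?thesis by (simp add: continuous_on_def)
qed

lemma dir_derivs_superposition:
  fixes k u :: "'a::euclidean_space \<Rightarrow> complex"
  assumes k: "schwartz_fun k" and u: "integrable lborel u" and vs: "set vs \<subseteq> Basis"
  shows "dir_derivs vs (\<lambda>y. LINT w|lborel. u w * k (w - y)) =
    (\<lambda>y. LINT w|lborel. u w * dir_derivs vs (\<lambda>y. k (w - y)) y)"
    and "(\<lambda>y. LINT w|lborel. u w * dir_derivs vs (\<lambda>y. k (w - y)) y) differentiable_on UNIV"
proof -
  \<comment> \<open>The constant c takes up the sign that reflection produces at each
    differentiation, so the same statement can be used at every step of the induction.\<close>
  have main: "((\<lambda>y. LINT w|lborel. u w * (c * g (w - y))) has_derivative
      (\<lambda>v. LINT w|lborel. u w * (c * (- dir_deriv v g (w - y))))) (at y)"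
    if g: "schwartz_fun g" for g c y
  proof -
    have sg: "smooth_fun g" using g by (rule schwartz_fun_smooth)
    obtain C where C: "C \<ge> 0" "\<And>vs x. set vs \<subseteq> Basis \<Longrightarrow> length vs \<le> 1 \<Longrightarrow> (1 + norm x) ^ 0 * norm (dir_derivs vs g x) \<le> C"
      by (rule schwartz_fun_bound[OF g, of 1 0]) blast
    have g0: "norm (g x) \<le> C" for x using C(2)[of "[]" x] by simp
    define K where "K = real DIM('a) * C"
    have dg: "(\<Sum>b\<in>Basis. norm (dir_deriv b g x)) \<le> K" for x
      using sum_mono[of Basis "\<lambda>b. norm (dir_deriv b g x)" "\<lambda>_. C"] C(2)[of "[b]" x for b]
      by (simp add: K_def)
    have [measurable]: "g \<in> borel_measurable borel" "u \<in> borel_measurable borel"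
      using u by (auto intro: borel_measurable_continuous_onI smooth_fun_continuous sg)
    have dgm: "dir_deriv v g \<in> borel_measurable borel" for v
      by (rule dir_deriv_measurable[OF sg])
    have ndg: "norm (dir_deriv v g x) \<le> K * norm v" for v x
      using norm_dir_deriv_le[OF sg, of v x] mult_right_mono[OF dg[of x] norm_ge_zero[of v]] by linarith
    have K0: "K \<ge> 0" using C(1) by (simp add: K_def)
    show ?thesis
    proof (rule has_derivative_lebesgue_integral[where B="\<lambda>w. norm (u w) * (norm c * K)"])
      show "((\<lambda>y. u w * (c * g (w - y))) has_derivative (\<lambda>v. u w * (c * (- dir_deriv v g (w - y))))) (at y)" for w
      proof (intro has_derivative_mult_right)
        have "((\<lambda>y. g (w - y)) has_derivative (\<lambda>v. dir_deriv (- v) g (w - y))) (at y)"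
          by (rule has_derivative_compose[OF _ smooth_fun_has_derivative[OF sg], THEN has_derivative_eq_rhs])
            (auto intro!: derivative_eq_intros)
        moreover have "dir_deriv (- v) g (w - y) = - dir_deriv v g (w - y)" for v
          by (rule linear_neg[OF bounded_linear.linear[OF has_derivative_bounded_linear[OF smooth_fun_has_derivative[OF sg]]]])
        ultimately show "((\<lambda>y. g (w - y)) has_derivative (\<lambda>v. - dir_deriv v g (w - y))) (at y)"
          by simp
      qed
      show B: "integrable lborel (\<lambda>w. norm (u w) * (norm c * K))"
        by (intro integrable_mult_left integrable_norm u)
      show "integrable lborel (\<lambda>w. u w * (c * g (w - y)))" for y
      proof (rule Bochner_Integration.integrable_bound[OF integrable_mult_left[OF integrable_norm[OF u], of "norm c * C"]])
        show "AE w in lborel. norm (u w * (c * g (w - y))) \<le> norm (norm (u w) * (norm c * C))"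
          using g0 C(1) by (intro AE_I2) (simp add: norm_mult mult_left_mono)
      qed measurable
      show "integrable lborel (\<lambda>w. u w * (c * (- dir_deriv v g (w - y))))" for v
      proof (rule Bochner_Integration.integrable_bound[OF integrable_mult_left[OF B, of "norm v"]])
        show "(\<lambda>w. u w * (c * (- dir_deriv v g (w - y)))) \<in> borel_measurable lborel"
          using measurable_compose[of "\<lambda>w. w - y" lborel borel, OF _ dgm[of v]] by measurable
        show "AE w in lborel. norm (u w * (c * (- dir_deriv v g (w - y)))) \<le> norm (norm (u w) * (norm c * K) * norm v)"
          using ndg K0 by (intro AE_I2) (simp add: norm_mult mult_left_mono mult.assoc)
      qed
      show "norm (u w * (c * g (w - z)) - u w * (c * g (w - y))) \<le> norm (u w) * (norm c * K) * norm (z - y)" for z w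
      proof -
        have "norm (g (w - z) - g (w - y)) \<le> K * norm ((w - z) - (w - y))"
          by (rule smooth_fun_lipschitz[OF sg dg])
        then have "norm (u w * c) * norm (g (w - z) - g (w - y)) \<le> norm (u w * c) * (K * norm (z - y))"
          by (intro mult_left_mono) (auto simp: norm_minus_commute)
        then show ?thesis by (simp add: norm_mult mult.assoc flip: right_diff_distrib)
      qed
      show "norm (u w * (c * (- dir_deriv v g (w - y)))) \<le> norm (u w) * (norm c * K) * norm v" for v w
        using mult_left_mono[OF ndg[of v "w - y"], of "norm (u w) * norm c"] by (simp add: norm_mult mult.assoc)
    qed
  qed
  have refl: "dir_derivs ws (\<lambda>y. k (w - y)) = (\<lambda>y. (-1) ^ length ws * dir_derivs ws k (w - y))"
    if "set ws \<subseteq> Basis" for ws w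
    using schwartz_fun_smooth[OF k] that by (rule dir_derivs_reflect)
  show "dir_derivs vs (\<lambda>y. LINT w|lborel. u w * k (w - y)) =
    (\<lambda>y. LINT w|lborel. u w * dir_derivs vs (\<lambda>y. k (w - y)) y)"
    using vs
  proof (induction vs)
    case (Cons v vs)
    note dir_deriv_ext[OF main[OF schwartz_fun_dir_derivs[OF k, of vs], of "(-1) ^ length vs"], of v]
    moreover have "dir_deriv v (\<lambda>y. (-1) ^ length vs * dir_derivs vs k (w - y)) =
        (\<lambda>y. (-1) ^ length vs * (- dir_deriv v (dir_derivs vs k) (w - y)))" for w
      using refl[of "v # vs" w] refl[of vs w] Cons.prems by simp
    ultimately show ?case
      using Cons by (simp add: refl)
  qed simp
  show "(\<lambda>y. LINT w|lborel. u w * dir_derivs vs (\<lambda>y. k (w - y)) y) differentiable_on UNIV"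
    unfolding refl[OF vs] differentiable_on_def
    using main[OF schwartz_fun_dir_derivs[OF k vs], of "(-1) ^ length vs"] by (auto intro: differentiableI)
qed

text \<open>The weighted bounds of the translate k (w - y) grow polynomially in w; the moments of u
  absorb this growth.\<close>

lemma schwartz_fun_superposition:
  fixes k u :: "'a::euclidean_space \<Rightarrow> complex"
  assumes k: "schwartz_fun k" and um: "u \<in> borel_measurable borel"
    and u: "\<And>N. integrable lborel (\<lambda>w. (1 + norm w) ^ N * norm (u w))"
  shows "schwartz_fun (\<lambda>y. LINT w|lborel. u w * k (w - y))"
proof -
  have u0: "integrable lborel u"
    using u[of 0] um by (simp add: integrable_norm_iff)
  show ?thesis
    unfolding schwartz_fun_iff
  proof (intro conjI allI impI)
    show "smooth_fun (\<lambda>y. LINT w|lborel. u w * k (w - y))"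
      unfolding smooth_fun_def by (simp add: dir_derivs_superposition[OF k u0])
    fix vs :: "'a list" and N assume vs: "set vs \<subseteq> Basis"
    obtain C where C: "C \<ge> 0" "\<And>ws x y. set ws \<subseteq> Basis \<Longrightarrow> length ws \<le> length vs \<Longrightarrow>
        (1 + norm y) ^ N * norm (dir_derivs ws (\<lambda>y. k (x - y)) y) \<le> C * (1 + norm x) ^ N"
      by (rule schwartz_fun_reflect_bound[OF k, of "length vs" N]) blast
    have "(1 + norm y) ^ N * norm (LINT w|lborel. u w * dir_derivs vs (\<lambda>y. k (w - y)) y)
        \<le> C * (LINT w|lborel. (1 + norm w) ^ N * norm (u w))" for y
    proof -
      have "norm (LINT w|lborel. of_real ((1 + norm y) ^ N) * (u w * dir_derivs vs (\<lambda>y. k (w - y)) y))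
          \<le> (LINT w|lborel. C * ((1 + norm w) ^ N * norm (u w)))"
      proof (rule integral_norm_bound_integral')
        show "integrable lborel (\<lambda>w. C * ((1 + norm w) ^ N * norm (u w)))"
          by (intro integrable_mult_right u)
        fix w
        show "norm (of_real ((1 + norm y) ^ N) * (u w * dir_derivs vs (\<lambda>y. k (w - y)) y)) \<le> C * ((1 + norm w) ^ N * norm (u w))"
          using mult_left_mono[OF C(2)[OF vs order_refl, of y w] norm_ge_zero[of "u w"]]
          by (simp add: norm_mult norm_power mult_ac del: of_real_power)
      qed
      then show ?thesis by (simp add: norm_mult norm_power del: of_real_power)
    qed
    then show "\<exists>C. \<forall>y. (1 + norm y) ^ N * norm (dir_derivs vs (\<lambda>y. LINT w|lborel. u w * k (w - y)) y) \<le> C"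
      using dir_derivs_superposition(1)[OF k u0 vs] by auto
  qed
qed

text \<open>Approximating the point of evaluation by simple functions turns the superposition into a
  finite sum, to which \<open>T\<close> applies termwise.\<close>

lemma tempered_superposition:
  fixes k u :: "'a::euclidean_space \<Rightarrow> complex"
  assumes T: "tempered_distribution T" and k: "schwartz_fun k" and um: "u \<in> borel_measurable borel"
    and u: "\<And>N. integrable lborel (\<lambda>w. (1 + norm w) ^ N * norm (u w))"
  shows "T (\<lambda>y. LINT w|lborel. u w * k (w - y)) = (LINT w|lborel. u w * conv_dist k T w)"
proof -
  have u0: "integrable lborel u"
    using u[of 0] um by (simp add: integrable_norm_iff)
  note um[measurable]
  \<comment> \<open>Simple functions that converge to the identity. Their finite range makes the
    integral a finite sum, and the bound by twice the norm provides the integrable majorants for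
    both limits below.\<close>
  obtain s :: "nat \<Rightarrow> 'a \<Rightarrow> 'a" where s: "\<And>i. simple_function borel (s i)" "\<And>x. (\<lambda>i. s i x) \<longlonglongrightarrow> x"
    "\<And>i x. dist (s i x) 0 \<le> 2 * dist x 0"
    using borel_measurable_implies_sequence_metric[of "\<lambda>x::'a. x" borel 0] by auto
  have sfin: "finite (range (s i))" for i using simple_functionD(1)[OF s(1)[of i]] by simp
  have sm[measurable]: "s i \<in> borel_measurable borel" for i
    using s(1) by (rule borel_measurable_simple_function)
  have sn: "norm (s i x) \<le> 2 * norm x" for i x using s(3)[of i x] by simp
  have sw: "1 + norm (s i w) + norm w \<le> 3 * (1 + norm w)" for i w using sn[of i w] by simp
  define c where "c i t = (LINT w|lborel. indicator (s i -` {t}) w *\<^sub>R u w)" for i t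
  have cint: "integrable lborel (\<lambda>w. indicator (s i -` {t}) w *\<^sub>R u w)" for i t
    using integrable_mult_indicator[of "s i -` {t}" lborel u] u0 measurable_sets[OF sm[of i], of "{t}"] by simp
  have simple: "(LINT w|lborel. u w * g (s i w)) = (\<Sum>t\<in>range (s i). c i t * g t)"
    for g :: "'a \<Rightarrow> complex" and i
  proof -
    have eq: "u w * g (s i w) = (\<Sum>t\<in>range (s i). (indicator (s i -` {t}) w *\<^sub>R u w) * g t)" for w
    proof -
      have "(\<Sum>t\<in>range (s i). (indicator (s i -` {t}) w *\<^sub>R u w) * g t) = (\<Sum>t\<in>range (s i). if t = s i w then u w * g t else 0)"
        by (intro sum.cong) (auto simp: indicator_def)
      then show ?thesis using sfin by (simp add: sum.delta)
    qed
    show "(LINT w|lborel. u w * g (s i w)) = (\<Sum>t\<in>range (s i). c i t * g t)"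
      unfolding eq c_def by (subst Bochner_Integration.integral_sum)
        (intro integrable_mult_left cint, simp only: integral_mult_left_zero)
  qed
  define U where "U y = (LINT w|lborel. u w * k (w - y))" for y
  define V where "V i y = (LINT w|lborel. u w * k (s i w - y))" for i y
  have U: "schwartz_fun U" unfolding U_def by (rule schwartz_fun_superposition[OF k um u])
  have Vsum: "V i = (\<lambda>y. \<Sum>t\<in>range (s i). c i t * k (t - y))" for i
    unfolding V_def by (rule ext, rule simple)
  have V: "schwartz_fun (V i)" for i
    unfolding Vsum by (intro schwartz_fun_sum sfin schwartz_fun_reflect k)
  have TV: "T (V i) = (LINT w|lborel. u w * conv_dist k T (s i w))" for i
    unfolding Vsum simple
    by (subst tempered_sum[OF T sfin schwartz_fun_reflect[OF k]]) (simp add: conv_dist_def)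
  have dU: "dir_derivs vs U y = (LINT w|lborel. u w * dir_derivs vs (\<lambda>y. k (w - y)) y)" if "set vs \<subseteq> Basis" for vs y
    using dir_derivs_superposition(1)[OF k u0 that] by (simp add: U_def[abs_def])
  have dsum: "dir_derivs vs (\<lambda>y. \<Sum>t\<in>S. a t * k (t - y)) y = (\<Sum>t\<in>S. a t * dir_derivs vs (\<lambda>y. k (t - y)) y)"
    if vs: "set vs \<subseteq> Basis" and "finite S" for vs y S a
    using that(2)
  proof (induction S)
    case empty
    have "dir_derivs vs (\<lambda>x. 0) = (\<lambda>x::'a. 0)" for vs :: "'a list"
      by (induction vs) (auto simp: dir_deriv_const)
    then show ?case by simp
  next
    case (insert t S)
    have sc: "schwartz_fun (\<lambda>y. k (t - y))" by (rule schwartz_fun_reflect[OF k])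
    have sm1: "smooth_fun (\<lambda>y. a t * k (t - y))"
      by (intro schwartz_fun_smooth schwartz_fun_cmult sc)
    have sm2: "smooth_fun (\<lambda>y. \<Sum>t\<in>S. a t * k (t - y))"
      by (intro schwartz_fun_smooth schwartz_fun_sum insert.hyps schwartz_fun_reflect k)
    show ?case
      using insert dir_derivs_add[OF sm1 sm2 vs] dir_derivs_cmult[OF schwartz_fun_smooth[OF sc] vs, of "a t"] by simp
  qed
  have dV: "dir_derivs vs (V i) y = (LINT w|lborel. u w * dir_derivs vs (\<lambda>y. k (s i w - y)) y)" if "set vs \<subseteq> Basis" for vs y i
    unfolding Vsum dsum[OF that sfin] by (rule simple[symmetric])
  obtain C N where C: "C \<ge> 0" "\<And>f B. schwartz_fun f \<Longrightarrow>
      (\<And>vs x. set vs \<subseteq> Basis \<Longrightarrow> length vs \<le> N \<Longrightarrow> (1 + norm x) ^ N * norm (dir_derivs vs f x) \<le> B) \<Longrightarrow>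
      norm (T f) \<le> C * B"
    by (rule tempered_bound[OF T]) blast
  obtain D where D: "D \<ge> 0" "\<And>vs a b y. set vs \<subseteq> Basis \<Longrightarrow> length vs \<le> N \<Longrightarrow>
      (1 + norm y) ^ N * norm (dir_derivs vs (\<lambda>y. k (a - y)) y - dir_derivs vs (\<lambda>y. k (b - y)) y)
        \<le> D * norm (a - b) * (1 + norm a + norm b) ^ N"
    by (rule schwartz_fun_reflect_lipschitz[OF k, of N N]) blast
  \<comment> \<open>Up to a constant, \<open>E i\<close> bounds all weighted derivatives of
    \<open>V i\<close> - U of order at most N. It tends to 0 by dominated convergence with a moment
    of u of order N + 1.\<close>
  define E where "E i = (LINT w|lborel. norm (u w) * (norm (s i w - w) * (1 + norm w) ^ N))" for i
  have Ebd: "norm (u w) * (norm (s i w - w) * (1 + norm w) ^ N) \<le> 3 * ((1 + norm w) ^ Suc N * norm (u w))" for i w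
  proof -
    have "norm (s i w - w) \<le> 3 * (1 + norm w)"
      using norm_triangle_ineq4[of "s i w" w] sn[of i w] by simp
    then have "norm (s i w - w) * (1 + norm w) ^ N \<le> 3 * (1 + norm w) * (1 + norm w) ^ N"
      by (rule mult_right_mono) simp
    from mult_left_mono[OF this norm_ge_zero[of "u w"]] show ?thesis by (simp add: algebra_simps)
  qed
  have Eint: "integrable lborel (\<lambda>w. norm (u w) * (norm (s i w - w) * (1 + norm w) ^ N))" for i
    by (rule Bochner_Integration.integrable_bound[OF integrable_mult_right[OF u[of "Suc N"], of 3]])
      (measurable, use Ebd in \<open>auto simp: abs_mult simp del: power_Suc\<close>)
  have E: "E \<longlonglongrightarrow> 0"
  proof -
    have "E \<longlonglongrightarrow> (LINT w::'a|lborel. 0)"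
      unfolding E_def
    proof (rule integral_dominated_convergence[where w="\<lambda>w. 3 * ((1 + norm w) ^ Suc N * norm (u w))"])
      show "AE w in lborel. (\<lambda>i. norm (u w) * (norm (s i w - w) * (1 + norm w) ^ N)) \<longlonglongrightarrow> 0"
      proof (rule AE_I2)
        fix w
        have "(\<lambda>i. norm (u w) * (norm (s i w - w) * (1 + norm w) ^ N)) \<longlonglongrightarrow> norm (u w) * (norm (w - w) * (1 + norm w) ^ N)"
          by (intro tendsto_intros s)
        then show "(\<lambda>i. norm (u w) * (norm (s i w - w) * (1 + norm w) ^ N)) \<longlonglongrightarrow> 0" by simp
      qed
      show "AE w in lborel. norm (norm (u w) * (norm (s i w - w) * (1 + norm w) ^ N)) \<le> 3 * ((1 + norm w) ^ Suc N * norm (u w))" for i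
        using Ebd by (auto simp: abs_mult simp del: power_Suc)
      show "integrable lborel (\<lambda>w. 3 * ((1 + norm w) ^ Suc N * norm (u w)))"
        by (intro integrable_mult_right u)
    qed measurable
    then show ?thesis by simp
  qed
  have TVU: "norm (T (V i) - T U) \<le> C * (D * 3 ^ N * E i)" for i
  proof -
    have nU: "schwartz_fun (\<lambda>y. (-1) * U y)" by (rule schwartz_fun_cmult[OF U])
    have "norm (T (\<lambda>y. V i y + (-1) * U y)) \<le> C * (D * 3 ^ N * E i)"
    proof (rule C(2)[OF schwartz_fun_add[OF V nU]])
      fix vs :: "'a list" and y :: 'a assume vs: "set vs \<subseteq> Basis" "length vs \<le> N"
      let ?d = "\<lambda>a. dir_derivs vs (\<lambda>y. k (a - y)) y"
      have dm: "?d = (\<lambda>a. (-1) ^ length vs * dir_derivs vs k (a - y))"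
        using dir_derivs_reflect[OF schwartz_fun_smooth[OF k] vs(1)] by (auto simp: fun_eq_iff)
      have dc: "continuous_on UNIV (dir_derivs vs k)"
        using k vs by (intro smooth_fun_continuous smooth_fun_dir_derivs schwartz_fun_smooth)
      have [measurable]: "?d \<in> borel_measurable borel"
        unfolding dm
        by (intro borel_measurable_continuous_onI continuous_intros continuous_on_compose2[OF dc]) auto
      obtain G where G: "\<And>a. norm (?d a) \<le> G"
      proof -
        obtain G where G: "\<And>vs' x. set vs' \<subseteq> Basis \<Longrightarrow> length vs' \<le> length vs \<Longrightarrow> (1 + norm x) ^ 0 * norm (dir_derivs vs' k x) \<le> G"
          by (rule schwartz_fun_bound[OF k, of "length vs" 0]) blast
        have "norm (?d a) \<le> G" for a
          using G[OF vs(1) order_refl, of "a - y"] fun_cong[OF dm, of a] by (simp add: norm_mult norm_power)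
        then show ?thesis by (rule that)
      qed
      have int: "integrable lborel (\<lambda>w. u w * ?d (r w))" if [measurable]: "r \<in> borel_measurable borel" for r
      proof (rule Bochner_Integration.integrable_bound[OF integrable_mult_left[OF integrable_norm[OF u0], of G]])
        show "AE w in lborel. norm (u w * ?d (r w)) \<le> norm (norm (u w) * G)"
        proof (rule AE_I2)
          fix w
          have "norm (u w) * norm (?d (r w)) \<le> norm (u w) * \<bar>G\<bar>"
            using G[of "r w"] by (intro mult_left_mono) auto
          then show "norm (u w * ?d (r w)) \<le> norm (norm (u w) * G)" by (simp add: norm_mult abs_mult)
        qed
      qed measurable
      have "dir_derivs vs (\<lambda>y. V i y + (-1) * U y) y = dir_derivs vs (V i) y - dir_derivs vs U y"
        using dir_derivs_diff[OF schwartz_fun_smooth[OF V] schwartz_fun_smooth[OF U] vs(1)] by (rule fun_cong)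
      also have "\<dots> = (LINT w|lborel. u w * (?d (s i w) - ?d w))"
        using int[of "s i"] int[of "\<lambda>w. w"] by (simp add: dU dV vs right_diff_distrib)
      finally have eq: "dir_derivs vs (\<lambda>y. V i y + (-1) * U y) y = (LINT w|lborel. u w * (?d (s i w) - ?d w))" .
      have "norm (LINT w|lborel. of_real ((1 + norm y) ^ N) * (u w * (?d (s i w) - ?d w)))
        \<le> (LINT w|lborel. D * 3 ^ N * (norm (u w) * (norm (s i w - w) * (1 + norm w) ^ N)))"
      proof (rule integral_norm_bound_integral')
        show "integrable lborel (\<lambda>w. D * 3 ^ N * (norm (u w) * (norm (s i w - w) * (1 + norm w) ^ N)))"
          by (intro integrable_mult_right Eint)
        fix w
        have "(1 + norm y) ^ N * norm (?d (s i w) - ?d w) \<le> D * norm (s i w - w) * (1 + norm (s i w) + norm w) ^ N"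
          by (rule D(2)[OF vs])
        also have "\<dots> \<le> D * norm (s i w - w) * (3 * (1 + norm w)) ^ N"
          by (intro mult_left_mono power_mono sw) (use D(1) in auto)
        also have "\<dots> = D * norm (s i w - w) * (3 ^ N * (1 + norm w) ^ N)"
          by (simp only: power_mult_distrib)
        finally have "norm (u w) * ((1 + norm y) ^ N * norm (?d (s i w) - ?d w)) \<le> norm (u w) * (D * norm (s i w - w) * (3 ^ N * (1 + norm w) ^ N))"
          by (rule mult_left_mono) simp
        then show "norm (of_real ((1 + norm y) ^ N) * (u w * (?d (s i w) - ?d w))) \<le> D * 3 ^ N * (norm (u w) * (norm (s i w - w) * (1 + norm w) ^ N))"
          by (simp add: norm_mult norm_power mult_ac del: of_real_power)
      qed
      then show "(1 + norm y) ^ N * norm (dir_derivs vs (\<lambda>y. V i y + (-1) * U y) y) \<le> D * 3 ^ N * E i"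
        unfolding eq E_def by (simp add: norm_mult norm_power del: of_real_power)
    qed
    then show ?thesis using tempered_diff[OF T V U, of i] by simp
  qed
  have lim1: "(\<lambda>i. T (V i)) \<longlonglongrightarrow> T U"
  proof (rule Lim_null_comparison[THEN Lim_null[THEN iffD2]])
    show "\<forall>\<^sub>F i in sequentially. norm (T (V i) - T U) \<le> C * (D * 3 ^ N * E i)"
      using TVU by simp
    have "(\<lambda>i. C * (D * 3 ^ N * E i)) \<longlonglongrightarrow> C * (D * 3 ^ N * 0)" by (intro tendsto_intros E)
    then show "(\<lambda>i. C * (D * 3 ^ N * E i)) \<longlonglongrightarrow> 0" by simp
  qed
  obtain C' N' where C': "C' \<ge> 0" "\<And>x. norm (conv_dist k T x) \<le> C' * (1 + norm x) ^ N'"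
    by (rule conv_dist_bound[OF T k]) blast
  have cont: "continuous_on UNIV (conv_dist k T)" by (rule conv_dist_continuous[OF T k])
  then have [measurable]: "conv_dist k T \<in> borel_measurable borel" by (rule borel_measurable_continuous_onI)
  \<comment> \<open>The same values also converge to the right-hand side, by continuity and
    polynomial growth of the convolution; the two limits must agree.\<close>
  have lim2: "(\<lambda>i. T (V i)) \<longlonglongrightarrow> (LINT w|lborel. u w * conv_dist k T w)"
    unfolding TV
  proof (rule integral_dominated_convergence[where w="\<lambda>w. C' * 2 ^ N' * ((1 + norm w) ^ N' * norm (u w))"])
    show "AE w in lborel. (\<lambda>i. u w * conv_dist k T (s i w)) \<longlonglongrightarrow> u w * conv_dist k T w"
    proof (rule AE_I2)
      fix w
      have "isCont (conv_dist k T) w" using cont by (simp add: continuous_on_eq_continuous_at)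
      from isCont_tendsto_compose[OF this s(2)] show "(\<lambda>i. u w * conv_dist k T (s i w)) \<longlonglongrightarrow> u w * conv_dist k T w"
        by (intro tendsto_intros)
    qed
    show "AE w in lborel. norm (u w * conv_dist k T (s i w)) \<le> C' * 2 ^ N' * ((1 + norm w) ^ N' * norm (u w))" for i
    proof (rule AE_I2)
      fix w
      have "norm (conv_dist k T (s i w)) \<le> C' * (1 + norm (s i w)) ^ N'" by (rule C'(2))
      also have "\<dots> \<le> C' * (2 * (1 + norm w)) ^ N'"
        using sn[of i w] C'(1) by (intro mult_left_mono power_mono) auto
      also have "\<dots> = C' * (2 ^ N' * (1 + norm w) ^ N')"
        by (simp only: power_mult_distrib)
      finally have "norm (u w) * norm (conv_dist k T (s i w)) \<le> norm (u w) * (C' * (2 ^ N' * (1 + norm w) ^ N'))"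
        by (rule mult_left_mono) simp
      then show "norm (u w * conv_dist k T (s i w)) \<le> C' * 2 ^ N' * ((1 + norm w) ^ N' * norm (u w))"
        by (simp add: norm_mult mult_ac)
    qed
    show "integrable lborel (\<lambda>w. C' * 2 ^ N' * ((1 + norm w) ^ N' * norm (u w)))"
      by (intro integrable_mult_right u)
  qed measurable
  show ?thesis
    using LIMSEQ_unique[OF lim1 lim2] by (simp add: U_def[abs_def])
qed

section \<open>Littlewood-Paley blocks as convolutions\<close>

lemma schwartz_fun_test_fun:
  assumes u: "test_fun u"
  shows "schwartz_fun u"
  unfolding schwartz_fun_def
proof (intro conjI allI impI)
  show "smooth_fun u" using u by (simp add: test_fun_iff)
  fix vs :: "'a list" and N assume "set vs \<subseteq> Basis"
  from test_fun_dir_derivs[OF u this] have d: "test_fun (dir_derivs vs u)" .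
  show "bounded (range (\<lambda>x. of_real ((1 + norm x) ^ N) * dir_derivs vs u x))"
  proof (rule bounded_range_continuous_bounded_support)
    show "continuous_on UNIV (\<lambda>x. of_real ((1 + norm x) ^ N) * dir_derivs vs u x)"
      by (intro continuous_intros test_fun_continuous d)
    have "{x. of_real ((1 + norm x) ^ N) * dir_derivs vs u x \<noteq> 0} \<subseteq> {x. dir_derivs vs u x \<noteq> 0}" by auto
    then show "bounded {x. of_real ((1 + norm x) ^ N) * dir_derivs vs u x \<noteq> 0}"
      by (rule bounded_subset[rotated]) (use d in \<open>simp add: test_fun_iff\<close>)
  qed
qed

lemma test_fun_moments:
  assumes u: "test_fun u"
  shows "integrable lborel (\<lambda>w. (1 + norm w) ^ N * norm (u w))"
proof -
  have "integrable lborel (\<lambda>w. u w * of_real ((1 + norm w) ^ N))"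
    by (intro test_fun_integrable_mult u continuous_intros)
  from integrable_norm[OF this] show ?thesis
    by (simp add: norm_mult norm_power mult.commute del: of_real_power)
qed

lemma kern_reflect_moments:
  fixes m :: "'a::euclidean_space \<Rightarrow> complex"
  assumes m: "test_fun m"
  shows "integrable lborel (\<lambda>w. (1 + norm w) ^ N * norm (kern m (x - w)))"
proof (rule Bochner_Integration.integrable_bound)
  have [measurable]: "kern m \<in> borel_measurable borel" using m by (rule kern_measurable)
  show "integrable lborel (\<lambda>w. (1 + norm x) ^ N * ((1 + norm (x - w)) ^ N * norm (kern m (x - w))))"
    by (intro integrable_mult_right integrable_lborel_reflect[OF kern_integrable_moment[OF m]])
  show "AE w in lborel. norm ((1 + norm w) ^ N * norm (kern m (x - w)))
      \<le> norm ((1 + norm x) ^ N * ((1 + norm (x - w)) ^ N * norm (kern m (x - w))))"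
  proof (rule AE_I2)
    fix w
    have "(1 + norm w) ^ N * norm (kern m (x - w)) \<le> ((1 + norm x) * (1 + norm (x - w))) ^ N * norm (kern m (x - w))"
      by (intro mult_right_mono power_mono one_plus_norm_le) auto
    then show "norm ((1 + norm w) ^ N * norm (kern m (x - w)))
      \<le> norm ((1 + norm x) ^ N * ((1 + norm (x - w)) ^ N * norm (kern m (x - w))))"
      by (simp add: power_mult_distrib abs_mult mult.assoc)
  qed
  show "(\<lambda>w. (1 + norm w) ^ N * norm (kern m (x - w))) \<in> borel_measurable lborel"
    by measurable
qed

text \<open>Gives the uniqueness for the definite description in \<open>lp_block\<close>. If g and h
  differ at x0, then the real part of the conjugate of g x0 - h x0 times g - h is positive near x0,
  and pairing it with a nonnegative bump there is strictly positive. The bump is made from the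
  generator.\<close>

lemma agrees_with_on_UNIV_unique:
  fixes \<phi> g h :: "'a::euclidean_space \<Rightarrow> complex"
  assumes \<phi>: "lp_generator \<phi>" and g: "agrees_with_on UNIV T g" and h: "agrees_with_on UNIV T h"
  shows "g = h"
proof (rule ext, rule ccontr)
  fix x0 assume ne: "g x0 \<noteq> h x0"
  define d where "d x = cnj (g x0 - h x0) * (g x - h x)" for x
  have gc: "continuous_on UNIV g" and hc: "continuous_on UNIV h"
    using g h by (auto simp: agrees_with_on_def)
  have dc: "continuous_on UNIV d" unfolding d_def by (intro continuous_intros gc hc)
  define c where "c = Re (d x0)"
  have d0: "c > 0"
  proof -
    have "d x0 = of_real ((norm (g x0 - h x0))\<^sup>2)"
      unfolding d_def by (metis complex_norm_square mult.commute of_real_power)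
    then show ?thesis using ne by (simp add: c_def)
  qed
  have "open {x. c / 2 < Re (d x)}" by (intro open_Collect_less continuous_intros dc)
  moreover have "x0 \<in> {x. c / 2 < Re (d x)}" using d0 by (simp add: c_def)
  ultimately obtain r where r: "r > 0" "\<And>x. dist x x0 < r \<Longrightarrow> Re (d x) > c / 2"
    unfolding open_dist by blast
  \<comment> \<open>The rescaled generator is 1 up to distance e and vanishes from distance 3/2 e
    on, which is less than r.\<close>
  define e where "e = r / 2"
  have e: "e > 0" using r(1) by (simp add: e_def)
  define b where "b x = \<phi> (- (1 / e) *\<^sub>R x0 + (1 / e) *\<^sub>R x)" for x
  have b: "test_fun b"
    unfolding b_def by (rule test_fun_affine) (use \<phi> e in \<open>auto simp: lp_generator_def\<close>)
  \<comment> \<open>The generator may take complex values; its squared modulus is a nonnegative test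
    function.\<close>
  define f where "f x = cnj (b x) * b x" for x
  have f: "test_fun f"
    unfolding f_def using b by (intro test_fun_mult smooth_fun_cnj) (auto simp: test_fun_iff)
  have bn: "norm (- (1 / e) *\<^sub>R x0 + (1 / e) *\<^sub>R x) = dist x x0 / e" for x
  proof -
    have "- (1 / e) *\<^sub>R x0 + (1 / e) *\<^sub>R x = (1 / e) *\<^sub>R (x - x0)" by (simp add: algebra_simps)
    then show ?thesis using e by (simp add: dist_norm)
  qed
  have f1: "f x = 1" if "dist x x0 \<le> e" for x
    using \<phi> that e bn[of x] by (simp add: f_def b_def lp_generator_def)
  have f0: "f x = 0" if "dist x x0 \<ge> r" for x
  proof -
    have "dist x x0 / e \<ge> 3 / 2" using that e by (simp add: e_def divide_simps)
    then show ?thesis using \<phi> bn[of x] by (simp add: f_def b_def lp_generator_def)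
  qed
  have fr: "f x = of_real ((norm (b x))\<^sup>2)" for x
    unfolding f_def by (metis complex_norm_square mult.commute of_real_power)
  have int: "integrable lborel (\<lambda>x. d x * f x)"
    using test_fun_integrable_mult[OF f dc] by (simp add: mult.commute)
  have "(LINT x|lborel. d x * f x) = 0"
  proof -
    have "(LINT x|lborel. g x * f x) = (LINT x|lborel. h x * f x)"
      using g h f unfolding agrees_with_on_def by metis
    moreover have "integrable lborel (\<lambda>x. g x * f x)" "integrable lborel (\<lambda>x. h x * f x)"
      using test_fun_integrable_mult[OF f gc] test_fun_integrable_mult[OF f hc] by (simp_all add: mult.commute)
    ultimately have "(LINT x|lborel. g x * f x - h x * f x) = 0" by simp
    then have "cnj (g x0 - h x0) * (LINT x|lborel. g x * f x - h x * f x) = 0" by simp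
    then show ?thesis
      by (simp only: integral_mult_right_zero[symmetric] d_def mult.assoc left_diff_distrib)
  qed
  then have "(LINT x|lborel. Re (d x * f x)) = 0"
    using integral_Re[OF int] by simp
  moreover have "(LINT x|lborel. (c / 2) * indicator (ball x0 e) x) \<le> (LINT x|lborel. Re (d x * f x))"
  proof (rule integral_mono)
    show "integrable lborel (\<lambda>x. (c / 2) * indicator (ball x0 e) x :: real)"
      using emeasure_lborel_ball_finite[of x0 e] by (intro integrable_mult_right integrable_real_indicator) auto
    show "integrable lborel (\<lambda>x. Re (d x * f x))" by (rule integrable_Re[OF int])
    fix x
    have Re: "Re (d x * f x) = Re (d x) * (norm (b x))\<^sup>2" by (simp add: fr)
    show "c / 2 * indicator (ball x0 e) x \<le> Re (d x * f x)"
    proof (cases "dist x x0 < e")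
      case True
      then have "f x = 1" "Re (d x) > c / 2" using f1[of x] r(2)[of x] e by (auto simp: e_def)
      then show ?thesis using True by (simp add: dist_commute)
    next
      case False
      then have "Re (d x * f x) \<ge> 0"
        using r(2)[of x] f0[of x] d0 unfolding Re by (cases "dist x x0 < r") (auto simp: fr)
      then show ?thesis using False by (simp add: dist_commute)
    qed
  qed
  moreover have "measure lborel (ball x0 e) > 0" using content_ball_pos[OF e, of x0] by simp
  ultimately show False using d0 by (simp add: mult_le_0_iff)
qed

text \<open>The two normalising factors (2 pi)^(- d/2) multiply to the one in \<open>kern\<close>.
  The identity shows which function T receives when the inverse transform of m times the transform
  of T is tested with f.\<close>

lemma fourier_mult_fourier_inv:
  fixes m f :: "'a::euclidean_space \<Rightarrow> complex"
  assumes m: "test_fun m" and f: "test_fun f"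
  shows "fourier (\<lambda>\<xi>. m \<xi> * fourier_inv f \<xi>) y = (LINT x|lborel. f x * kern m (x - y))"
proof -
  have [measurable]: "m \<in> borel_measurable borel" "f \<in> borel_measurable borel"
    using m f by (auto intro: test_fun_measurable)
  let ?c = "complex_of_real ((2 * pi) powr (- real DIM('a) / 2))"
  have c: "?c * ?c = of_real (1 / (2 * pi) ^ DIM('a))"
  proof -
    have "(2 * pi) powr (- real DIM('a) / 2) * (2 * pi) powr (- real DIM('a) / 2) = 1 / (2 * pi) ^ DIM('a)"
      by (simp add: powr_minus powr_realpow inverse_eq_divide flip: powr_add)
    then show ?thesis by (metis of_real_mult)
  qed
  have "fourier (\<lambda>\<xi>. m \<xi> * fourier_inv f \<xi>) y = ?c * (LINT \<xi>|lborel. LINT x|lborel. ?c * (m \<xi> * (cis ((x - y) \<bullet> \<xi>) * f x)))"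
  proof -
    have "cis (- (\<xi> \<bullet> y)) * (m \<xi> * fourier_inv f \<xi>) = (LINT x|lborel. ?c * (m \<xi> * (cis ((x - y) \<bullet> \<xi>) * f x)))" for \<xi>
    proof -
      have cis: "cis ((x - y) \<bullet> \<xi>) = cis (- (\<xi> \<bullet> y)) * cis (\<xi> \<bullet> x)" for x
        by (simp add: cis_mult inner_diff_left inner_diff_right inner_commute)
      have "cis (- (\<xi> \<bullet> y)) * (m \<xi> * fourier_inv f \<xi>) = (cis (- (\<xi> \<bullet> y)) * m \<xi> * ?c) * (LINT x|lborel. cis (\<xi> \<bullet> x) * f x)"
        unfolding fourier_inv_def by (simp only: mult_ac)
      also have "\<dots> = (LINT x|lborel. (cis (- (\<xi> \<bullet> y)) * m \<xi> * ?c) * (cis (\<xi> \<bullet> x) * f x))"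
        by (rule integral_mult_right_zero[symmetric])
      also have "\<dots> = (LINT x|lborel. ?c * (m \<xi> * (cis ((x - y) \<bullet> \<xi>) * f x)))"
        unfolding cis by (simp only: mult_ac)
      finally show ?thesis .
    qed
    then show ?thesis unfolding fourier_def by (simp only:)
  qed
  also have "(LINT \<xi>|lborel. LINT x|lborel. ?c * (m \<xi> * (cis ((x - y) \<bullet> \<xi>) * f x)))
      = (LINT x|lborel. LINT \<xi>|lborel. ?c * (m \<xi> * (cis ((x - y) \<bullet> \<xi>) * f x)))"
    by (rule Fubini_dominated[OF _ integrable_mult_right[OF test_fun_integrable[OF m], of ?c] test_fun_integrable[OF f]])
      (measurable, simp add: norm_mult)
  also have "?c * \<dots> = (LINT x|lborel. f x * kern m (x - y))"
  proof -
    have "?c * (LINT \<xi>|lborel. ?c * (m \<xi> * (cis ((x - y) \<bullet> \<xi>) * f x))) = f x * kern m (x - y)" for x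
    proof -
      have "(LINT \<xi>|lborel. ?c * (m \<xi> * (cis ((x - y) \<bullet> \<xi>) * f x))) = (LINT \<xi>|lborel. (?c * f x) * (m \<xi> * cis ((x - y) \<bullet> \<xi>)))"
        by (simp only: mult_ac)
      also have "\<dots> = (?c * f x) * (LINT \<xi>|lborel. m \<xi> * cis ((x - y) \<bullet> \<xi>))"
        by (rule integral_mult_right_zero)
      finally have "?c * (LINT \<xi>|lborel. ?c * (m \<xi> * (cis ((x - y) \<bullet> \<xi>) * f x))) = (?c * ?c) * (f x * (LINT \<xi>|lborel. m \<xi> * cis ((x - y) \<bullet> \<xi>)))"
        by (simp only: mult_ac)
      then show ?thesis unfolding c kern_def by (simp only: mult_ac)
    qed
    then show ?thesis by (simp only: integral_mult_right_zero[symmetric])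
  qed
  finally show ?thesis .
qed

lemma integral_conv_dist_kern:
  fixes m f :: "'a::euclidean_space \<Rightarrow> complex"
  assumes T: "tempered_distribution T" and m: "test_fun m" and f: "test_fun f"
  shows "T (\<lambda>y. LINT x|lborel. f x * kern m (x - y)) = (LINT x|lborel. f x * conv_dist (kern m) T x)"
  by (rule tempered_superposition[OF T schwartz_fun_kern[OF m] test_fun_measurable[OF f] test_fun_moments[OF f]])

lemma agrees_with_conv_dist:
  fixes m :: "'a::euclidean_space \<Rightarrow> complex"
  assumes T: "tempered_distribution T" and m: "test_fun m"
  shows "agrees_with_on UNIV (fourier_inv_dist (mult_dist m (fourier_dist T))) (conv_dist (kern m) T)"
  unfolding agrees_with_on_def
proof (intro conjI allI impI)
  show "continuous_on UNIV (conv_dist (kern m) T)"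
    by (rule conv_dist_continuous[OF T schwartz_fun_kern[OF m]])
  fix f :: "'a \<Rightarrow> complex" assume f: "test_fun f"
  have "fourier_inv_dist (mult_dist m (fourier_dist T)) f = T (fourier (\<lambda>\<xi>. m \<xi> * fourier_inv f \<xi>))"
    by (simp add: fourier_inv_dist_def mult_dist_def fourier_dist_def)
  also have "fourier (\<lambda>\<xi>. m \<xi> * fourier_inv f \<xi>) = (\<lambda>y. LINT x|lborel. f x * kern m (x - y))"
    by (rule ext, rule fourier_mult_fourier_inv[OF m f])
  also have "T \<dots> = (LINT x|lborel. conv_dist (kern m) T x * f x)"
    by (subst integral_conv_dist_kern[OF T m f]) (simp add: mult.commute)
  finally show "fourier_inv_dist (mult_dist m (fourier_dist T)) f = (LINT x|lborel. conv_dist (kern m) T x * f x)" .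
qed

lemma test_fun_lp_cutoff:
  assumes "test_fun \<phi>"
  shows "test_fun (lp_cutoff \<phi> j)"
proof (cases "j = 0")
  case True
  then have "lp_cutoff \<phi> j = \<phi>" by (simp add: lp_cutoff_def[abs_def])
  then show ?thesis using assms by simp
next
  case False
  then show ?thesis
    unfolding lp_cutoff_def[abs_def] by simp (intro test_fun_diff test_fun_scale assms; simp)
qed

text \<open>Existence and uniqueness of the representing function turn the definite description into
  a convolution, the form in which every later estimate uses a block.\<close>

lemma lp_block_eq:
  assumes "lp_generator \<phi>" "tempered_distribution T"
  shows "lp_block \<phi> j T = conv_dist (kern (lp_cutoff \<phi> j)) T"
  unfolding lp_block_def
proof (rule the_equality)
  show *: "agrees_with_on UNIV (fourier_inv_dist (mult_dist (lp_cutoff \<phi> j) (fourier_dist T))) (conv_dist (kern (lp_cutoff \<phi> j)) T)"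
    using assms by (intro agrees_with_conv_dist test_fun_lp_cutoff) (auto simp: lp_generator_def)
  show "g = conv_dist (kern (lp_cutoff \<phi> j)) T"
    if "agrees_with_on UNIV (fourier_inv_dist (mult_dist (lp_cutoff \<phi> j) (fourier_dist T))) g" for g
    by (rule agrees_with_on_UNIV_unique[OF assms(1) that *])
qed

text \<open>A factorisation of the symbol becomes an integral of one convolution against the kernel
  of the other factor. Both reproducing formulas below arise from symbols that equal 1 on the
  relevant support.\<close>

lemma conv_dist_mult:
  fixes m \<phi> :: "'a::euclidean_space \<Rightarrow> complex"
  assumes T: "tempered_distribution T" and m: "test_fun m" and \<phi>: "test_fun \<phi>"
  shows "conv_dist (kern (\<lambda>\<xi>. m \<xi> * \<phi> \<xi>)) T x = (LINT w|lborel. kern m (x - w) * conv_dist (kern \<phi>) T w)"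
proof -
  have [measurable]: "kern m \<in> borel_measurable borel" using m by (rule kern_measurable)
  have "(\<lambda>w. kern m (x - w)) \<in> borel_measurable borel" by measurable
  from tempered_superposition[OF T schwartz_fun_kern[OF \<phi>] this kern_reflect_moments[OF m]]
  show ?thesis by (simp add: conv_dist_def[of "kern (\<lambda>\<xi>. m \<xi> * \<phi> \<xi>)"] kern_mult[OF m \<phi>])
qed

lemma conv_dist_kern_add:
  assumes T: "tempered_distribution T" and "test_fun m" "test_fun k"
  shows "conv_dist (kern (\<lambda>\<xi>. m \<xi> + k \<xi>)) T x = conv_dist (kern m) T x + conv_dist (kern k) T x"
  unfolding conv_dist_def kern_add[OF assms(2,3)]
  by (intro tempered_add[OF T] schwartz_fun_reflect schwartz_fun_kern assms)

text \<open>Since A x - y is A applied to x minus the inverse image of y, invariance of the kernel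
  moves the rotation onto the argument of T, where radiality of T removes it.\<close>

lemma conv_dist_kern_orthogonal:
  fixes m :: "'a::euclidean_space \<Rightarrow> complex"
  assumes T: "radial_distribution T" and m: "test_fun m" and A: "orthogonal_transformation A"
    and inv: "\<And>A \<xi>. orthogonal_transformation A \<Longrightarrow> m (A \<xi>) = m \<xi>"
  shows "conv_dist (kern m) T (A x) = conv_dist (kern m) T x"
proof -
  obtain B where B: "orthogonal_transformation B" "\<And>y. A (B y) = y"
    using A orthogonal_transformation_inv orthogonal_transformation_surj surj_f_inv_f by metis
  have "T (\<lambda>y. kern m (A x - y)) = T ((\<lambda>y. kern m (x - y)) \<circ> B)"
  proof -
    have "kern m (A x - y) = kern m (x - B y)" for y
    proof -
      have "A x - y = A (x - B y)"
        using linear_diff[OF orthogonal_transformation_linear[OF A]] B(2) by simp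
      then show ?thesis using kern_orthogonal[OF m A inv[OF A]] by simp
    qed
    then show ?thesis by (simp add: o_def)
  qed
  also have "\<dots> = T (\<lambda>y. kern m (x - y))"
    using T B(1) schwartz_fun_reflect[OF schwartz_fun_kern[OF m]] unfolding radial_distribution_def by blast
  finally show ?thesis by (simp add: conv_dist_def)
qed

text \<open>The kernels of \<open>m (2 powr (- j) *\<^sub>R \<xi>)\<close> form an approximate identity because
  \<open>m 0 = 1\<close> is the integral of \<open>kern m\<close>.\<close>

lemma conv_dist_approx_identity:
  fixes m u :: "'a::euclidean_space \<Rightarrow> complex"
  assumes T: "tempered_distribution T" and m: "test_fun m" and m0: "m 0 = 1"
    and u: "test_fun u"
  shows "(\<lambda>j. LINT x|lborel. u x * conv_dist (kern (\<lambda>\<xi>. m ((1 / 2 ^ j) *\<^sub>R \<xi>))) T x) \<longlonglongrightarrow> T u"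
proof -
  define mj where "mj j \<xi> = m ((1 / 2 ^ j) *\<^sub>R \<xi>)" for j :: nat and \<xi>
  have mj: "test_fun (mj j)" for j
    unfolding mj_def by (rule test_fun_scale[OF m]) simp
  define V where "V j y = (LINT x|lborel. u x * kern (mj j) (x - y))" for j y
  define v where "v z = u (0 - z)" for z
  have us: "schwartz_fun u" by (rule schwartz_fun_test_fun[OF u])
  have v: "schwartz_fun v" unfolding v_def by (rule schwartz_fun_reflect[OF us])
  have [measurable]: "kern (mj j) \<in> borel_measurable borel" "kern m \<in> borel_measurable borel"
    "u \<in> borel_measurable borel" for j
    using m mj u by (auto intro: kern_measurable test_fun_measurable)
  define K where "K j w = kern (mj j) (0 - w)" for j w
  have Kmom: "integrable lborel (\<lambda>w. (1 + norm w) ^ N * norm (K j w))" for j N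
    unfolding K_def by (rule kern_reflect_moments[OF mj])
  have [measurable]: "K j \<in> borel_measurable borel" for j unfolding K_def[abs_def] by measurable
  have K0: "integrable lborel (K j)" for j
    using Kmom[of 0 j] by (simp add: integrable_norm_iff)
  have K1: "(LINT w|lborel. K j w) = 1" for j
    unfolding K_def using integral_lborel_reflect[of "kern (mj j)" 0] integral_kern[OF mj, of j]
    by (simp add: mj_def m0)
  \<comment> \<open>A reflection moves the dependence on y from the kernel to u. The difference V j
    - u is then governed by the smoothness of the fixed function v and not by the kernels, which
    become singular with j.\<close>
  have V: "V j = (\<lambda>y. LINT w|lborel. K j w * v (w - y))" for j
  proof
    fix y
    show "V j y = (LINT w|lborel. K j w * v (w - y))"
      using integral_lborel_reflect[of "\<lambda>x. u x * kern (mj j) (x - y)" y]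
      by (simp add: V_def K_def v_def mult.commute)
  qed
  have Vs: "schwartz_fun (V j)" for j
    unfolding V by (rule schwartz_fun_superposition[OF v _ Kmom]) measurable
  obtain C N where C: "C \<ge> 0" "\<And>f B. schwartz_fun f \<Longrightarrow>
      (\<And>vs x. set vs \<subseteq> Basis \<Longrightarrow> length vs \<le> N \<Longrightarrow> (1 + norm x) ^ N * norm (dir_derivs vs f x) \<le> B) \<Longrightarrow>
      norm (T f) \<le> C * B"
    by (rule tempered_bound[OF T]) blast
  obtain D where D: "D \<ge> 0" "\<And>vs a b y. set vs \<subseteq> Basis \<Longrightarrow> length vs \<le> N \<Longrightarrow>
      (1 + norm y) ^ N * norm (dir_derivs vs (\<lambda>y. v (a - y)) y - dir_derivs vs (\<lambda>y. v (b - y)) y)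
        \<le> D * norm (a - b) * (1 + norm a + norm b) ^ N"
    by (rule schwartz_fun_reflect_lipschitz[OF v, of N N]) blast
  define I where "I = (LINT z|lborel. (1 + norm z) ^ Suc N * norm (kern m z))"
  \<comment> \<open>Rescaling by 2^j turns the factor norm w into norm w / 2^j and only decreases
    the remaining weight, so a fixed moment of \<open>kern m\<close> gives the rate 1 / 2^j.\<close>
  have Kbound: "(LINT w|lborel. norm (K j w) * (norm w * (1 + norm w) ^ N)) \<le> I / 2 ^ j" for j
  proof -
    define g where "g w = norm (kern m w) * (norm ((1 / 2 ^ j) *\<^sub>R w) * (1 + norm ((1 / 2 ^ j) *\<^sub>R w)) ^ N)" for w
    have [measurable]: "g \<in> borel_measurable borel" unfolding g_def[abs_def] by measurable
    have "norm (K j w) * (norm w * (1 + norm w) ^ N) = (2 ^ j) ^ DIM('a) *\<^sub>R g (2 ^ j *\<^sub>R (0 - w))" for w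
      using kern_scale[OF m, of "2 ^ j" "- w"]
      by (simp add: K_def mj_def[abs_def] g_def norm_mult norm_power)
    then have "(LINT w|lborel. norm (K j w) * (norm w * (1 + norm w) ^ N)) = (LINT w|lborel. (2 ^ j) ^ DIM('a) *\<^sub>R g (2 ^ j *\<^sub>R (0 - w)))"
      by simp
    also have "\<dots> = (LINT w|lborel. (2 ^ j) ^ DIM('a) *\<^sub>R g (2 ^ j *\<^sub>R w))"
      by (rule integral_lborel_reflect[where f="\<lambda>w. (2 ^ j) ^ DIM('a) *\<^sub>R g (2 ^ j *\<^sub>R w)"]) measurable
    also have "\<dots> = (LINT w|lborel. g w)"
      by (rule integral_lborel_scale) auto
    also have "\<dots> \<le> (LINT z|lborel. (1 / 2 ^ j) * ((1 + norm z) ^ Suc N * norm (kern m z)))"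
    proof (rule integral_mono')
      show "integrable lborel (\<lambda>z. (1 / 2 ^ j) * ((1 + norm z) ^ Suc N * norm (kern m z)))"
        by (intro integrable_mult_right kern_integrable_moment m)
      fix z :: 'a
      have le: "norm ((1 / 2 ^ j) *\<^sub>R z) \<le> norm z"
        by (simp add: divide_le_eq mult_le_cancel_left1)
      have "norm ((1 / 2 ^ j) *\<^sub>R z) * (1 + norm ((1 / 2 ^ j) *\<^sub>R z)) ^ N \<le> (1 / 2 ^ j) * (1 + norm z) * (1 + norm z) ^ N"
        using le by (intro mult_mono power_mono) (auto simp: divide_right_mono)
      from mult_left_mono[OF this norm_ge_zero[of "kern m z"]]
      show "g z \<le> (1 / 2 ^ j) * ((1 + norm z) ^ Suc N * norm (kern m z))"
        by (simp add: g_def mult_ac)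
    qed (simp)
    finally show ?thesis by (simp add: I_def)
  qed
  have TVU: "norm (T (V j) - T u) \<le> C * (D * (I / 2 ^ j))" for j
  proof -
    have nu: "schwartz_fun (\<lambda>y. (-1) * u y)" by (rule schwartz_fun_cmult[OF us])
    have uv: "u = (\<lambda>y. v (0 - y))" by (simp add: v_def)
    have "norm (T (\<lambda>y. V j y + (-1) * u y)) \<le> C * (D * (I / 2 ^ j))"
    proof (rule C(2)[OF schwartz_fun_add[OF Vs nu]])
      fix vs :: "'a list" and y :: 'a assume vs: "set vs \<subseteq> Basis" "length vs \<le> N"
      let ?d = "\<lambda>a. dir_derivs vs (\<lambda>y. v (a - y)) y"
      have dm: "?d = (\<lambda>a. (-1) ^ length vs * dir_derivs vs v (a - y))"
        using dir_derivs_reflect[OF schwartz_fun_smooth[OF v] vs(1)] by (auto simp: fun_eq_iff)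
      have dc: "continuous_on UNIV (dir_derivs vs v)"
        using v vs by (intro smooth_fun_continuous smooth_fun_dir_derivs schwartz_fun_smooth)
      have [measurable]: "?d \<in> borel_measurable borel"
        unfolding dm
        by (intro borel_measurable_continuous_onI continuous_intros continuous_on_compose2[OF dc]) auto
      obtain G where G: "\<And>a. norm (?d a) \<le> G"
      proof -
        obtain G where G: "\<And>vs' x. set vs' \<subseteq> Basis \<Longrightarrow> length vs' \<le> length vs \<Longrightarrow> (1 + norm x) ^ 0 * norm (dir_derivs vs' v x) \<le> G"
          by (rule schwartz_fun_bound[OF v, of "length vs" 0]) blast
        have "norm (?d a) \<le> G" for a
          using G[OF vs(1) order_refl, of "a - y"] fun_cong[OF dm, of a] by (simp add: norm_mult norm_power)
        then show ?thesis by (rule that)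
      qed
      have int: "integrable lborel (\<lambda>w. K j w * ?d w)"
      proof (rule Bochner_Integration.integrable_bound[OF integrable_mult_left[OF integrable_norm[OF K0[of j]], of G]])
        show "AE w in lborel. norm (K j w * ?d w) \<le> norm (norm (K j w) * G)"
        proof (rule AE_I2)
          fix w
          have "norm (K j w) * norm (?d w) \<le> norm (K j w) * \<bar>G\<bar>"
            using G[of w] by (intro mult_left_mono) auto
          then show "norm (K j w * ?d w) \<le> norm (norm (K j w) * G)" by (simp add: norm_mult abs_mult)
        qed
      qed measurable
      have dV: "dir_derivs vs (V j) y = (LINT w|lborel. K j w * ?d w)"
        unfolding V using dir_derivs_superposition(1)[OF v K0 vs(1)] by (rule fun_cong)
      have "dir_derivs vs (\<lambda>y. V j y + (-1) * u y) y = dir_derivs vs (V j) y - dir_derivs vs u y"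
        using dir_derivs_diff[OF schwartz_fun_smooth[OF Vs] schwartz_fun_smooth[OF us] vs(1)] by (rule fun_cong)
      also have "dir_derivs vs u y = ?d 0"
        by (rule arg_cong[OF uv])
      also have "\<dots> = (LINT w|lborel. K j w * ?d 0)"
        using K1[of j] by simp
      also have "dir_derivs vs (V j) y - (LINT w|lborel. K j w * ?d 0) = (LINT w|lborel. K j w * (?d w - ?d 0))"
        using int K0[of j] by (simp add: dV right_diff_distrib)
      finally have eq: "dir_derivs vs (\<lambda>y. V j y + (-1) * u y) y = (LINT w|lborel. K j w * (?d w - ?d 0))" .
      have "norm (LINT w|lborel. of_real ((1 + norm y) ^ N) * (K j w * (?d w - ?d 0)))
        \<le> (LINT w|lborel. D * (norm (K j w) * (norm w * (1 + norm w) ^ N)))"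
      proof (rule integral_norm_bound_integral')
        show "integrable lborel (\<lambda>w. D * (norm (K j w) * (norm w * (1 + norm w) ^ N)))"
        proof (intro integrable_mult_right, rule Bochner_Integration.integrable_bound[OF Kmom[of "Suc N" j]])
          show "AE w in lborel. norm (norm (K j w) * (norm w * (1 + norm w) ^ N)) \<le> norm ((1 + norm w) ^ Suc N * norm (K j w))"
            by (intro AE_I2) (simp add: abs_mult algebra_simps)
        qed measurable
        fix w
        have "(1 + norm y) ^ N * norm (?d w - ?d 0) \<le> D * norm (w - 0) * (1 + norm w + norm (0::'a)) ^ N"
          by (rule D(2)[OF vs])
        from mult_left_mono[OF this norm_ge_zero[of "K j w"]]
        show "norm (of_real ((1 + norm y) ^ N) * (K j w * (?d w - ?d 0))) \<le> D * (norm (K j w) * (norm w * (1 + norm w) ^ N))"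
          by (simp add: norm_mult norm_power mult_ac del: of_real_power)
      qed
      also have "\<dots> \<le> D * (I / 2 ^ j)"
        using Kbound[of j] D(1) by (simp add: mult_left_mono del: times_divide_eq_right)
      finally show "(1 + norm y) ^ N * norm (dir_derivs vs (\<lambda>y. V j y + (-1) * u y) y) \<le> D * (I / 2 ^ j)"
        unfolding eq by (simp add: norm_mult norm_power del: of_real_power times_divide_eq_right)
    qed
    then show ?thesis using tempered_diff[OF T Vs us, of j] by simp
  qed
  have "(\<lambda>j. T (V j)) \<longlonglongrightarrow> T u"
  proof (rule Lim_null_comparison[THEN Lim_null[THEN iffD2]])
    show "\<forall>\<^sub>F j in sequentially. norm (T (V j) - T u) \<le> C * (D * (I / 2 ^ j))"
      using TVU by simp
    have "(\<lambda>j. C * (D * (I / 2 ^ j))) \<longlonglongrightarrow> C * (D * 0)"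
      by (intro tendsto_mult tendsto_const LIMSEQ_divide_realpow_zero) auto
    then show "(\<lambda>j. C * (D * (I / 2 ^ j))) \<longlonglongrightarrow> 0" by simp
  qed
  moreover have "T (V j) = (LINT x|lborel. u x * conv_dist (kern (mj j)) T x)" for j
    unfolding V_def[abs_def] by (rule integral_conv_dist_kern[OF T mj u])
  ultimately show ?thesis by (simp add: mj_def[abs_def])
qed

section \<open>A radial decomposition\<close>

lemma lp_cutoff_eq:
  "lp_cutoff \<phi> j \<xi> = (if j = 0 then \<phi> \<xi> else \<phi> ((1 / 2 ^ j) *\<^sub>R \<xi>) - \<phi> ((1 / 2 ^ (j - 1)) *\<^sub>R \<xi>))"
proof -
  have "(2::real) powr (- real j) = 1 / 2 ^ j"
    by (simp add: powr_minus powr_realpow inverse_eq_divide)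
  moreover have "(2::real) powr (- real j + 1) = 1 / 2 ^ (j - 1)" if "j \<noteq> 0"
  proof -
    have "- real j + 1 = - real (j - 1)" using that by simp
    then show ?thesis by (simp only: powr_minus powr_realpow inverse_eq_divide)
  qed
  ultimately show ?thesis by (simp add: lp_cutoff_def)
qed

lemma sum_lp_cutoff: "(\<Sum>i\<le>n. lp_cutoff \<phi> i \<xi>) = \<phi> ((1 / 2 ^ n) *\<^sub>R \<xi>)"
  by (induction n) (simp_all add: lp_cutoff_eq)

text \<open>Above the outer radius all dilates occurring in the cutoff vanish; below the inner
  radius the two dilates are both 1 and cancel. R is a parameter because the given generator has R =
  3/2 and the radial one R = 3.\<close>

lemma lp_cutoff_support:
  assumes "\<And>\<xi>. norm \<xi> \<le> 1 \<Longrightarrow> \<phi> \<xi> = 1" "\<And>\<xi>. norm \<xi> \<ge> R \<Longrightarrow> \<phi> \<xi> = 0" "R \<ge> 1"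
    and "lp_cutoff \<phi> j \<xi> \<noteq> 0"
  shows "norm \<xi> < R * 2 ^ j" "j > 0 \<Longrightarrow> norm \<xi> > 2 ^ (j - 1)"
proof -
  have sc: "norm ((1 / 2 ^ k) *\<^sub>R \<xi>) = norm \<xi> / 2 ^ k" for k :: nat by simp
  show "norm \<xi> < R * 2 ^ j"
  proof (rule ccontr)
    assume "\<not> norm \<xi> < R * 2 ^ j"
    then have ge: "R * 2 ^ j \<le> norm \<xi>" by simp
    have "\<phi> ((1 / 2 ^ k) *\<^sub>R \<xi>) = 0" if "k \<le> j" for k
    proof -
      have "R * 2 ^ k \<le> R * 2 ^ j" using that assms(3) by (intro mult_left_mono power_increasing) auto
      then have "R \<le> norm \<xi> / 2 ^ k" using ge by (simp add: pos_le_divide_eq)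
      then show ?thesis using assms(2)[of "(1 / 2 ^ k) *\<^sub>R \<xi>"] by (simp only: sc)
    qed
    from this[of j] this[of "j - 1"] this[of 0] assms(4) show False by (simp add: lp_cutoff_eq split: if_splits)
  qed
  show "norm \<xi> > 2 ^ (j - 1)" if "j > 0"
  proof (rule ccontr)
    assume "\<not> norm \<xi> > 2 ^ (j - 1)"
    then have le: "norm \<xi> \<le> 2 ^ (j - 1)" by simp
    have "\<phi> ((1 / 2 ^ k) *\<^sub>R \<xi>) = 1" if "j - 1 \<le> k" for k
    proof -
      have "(2::real) ^ (j - 1) \<le> 2 ^ k" using that by (intro power_increasing) auto
      from order_trans[OF le this] have "norm \<xi> / 2 ^ k \<le> 1" by (simp add: divide_le_eq)
      then show ?thesis using assms(1)[of "(1 / 2 ^ k) *\<^sub>R \<xi>"] by (simp only: sc)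
    qed
    from this[of j] this[of "j - 1"] that assms(4) show False by (simp add: lp_cutoff_eq)
  qed
qed

abbreviation radial_block :: "('a::euclidean_space \<Rightarrow> complex) \<Rightarrow> nat \<Rightarrow> 'a distribution \<Rightarrow> 'a \<Rightarrow> complex" where
  "radial_block \<psi> j T \<equiv> conv_dist (kern (lp_cutoff \<psi> j)) T"

text \<open>The p-th power of an L_p norm. Later bounds have the form
  \<open>a powr p / (2 ^ i) ^ d\<close>, so that a stands for 2^(i d/p) times the L_p norm.\<close>

abbreviation block_mass :: "('a::euclidean_space \<Rightarrow> complex) \<Rightarrow> real \<Rightarrow> nat \<Rightarrow> 'a distribution \<Rightarrow> ennreal" where
  "block_mass \<phi> p i T \<equiv> \<integral>\<^sup>+w. ennreal (norm (lp_block \<phi> i T w) powr p) \<partial>lborel"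

text \<open>The radius 3 is twice 3/2, because the construction mixes a cutoff with its dilate by
  the factor 2.\<close>

definition radial_generator :: "('a::euclidean_space \<Rightarrow> complex) \<Rightarrow> bool" where
  "radial_generator \<psi> \<longleftrightarrow> test_fun \<psi> \<and>
     (\<forall>A \<xi>. orthogonal_transformation A \<longrightarrow> \<psi> (A \<xi>) = \<psi> \<xi>) \<and>
     (\<forall>\<xi>. norm \<xi> \<le> 1 \<longrightarrow> \<psi> \<xi> = 1) \<and> (\<forall>\<xi>. norm \<xi> \<ge> 3 \<longrightarrow> \<psi> \<xi> = 0) \<and>
     (LINT \<xi>|lborel. \<psi> \<xi>) = 0"

text \<open>Composition with \<open>\<xi> \<mapsto> (\<xi> \<bullet> \<xi>) *\<^sub>R e\<close> makes \<open>\<phi>\<close> radial and keeps it smooth. Combining two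
  dilates yields a vanishing integral, so that the kernels vanish at the origin.\<close>

lemma radial_generator_exists:
  fixes \<phi> :: "'a::euclidean_space \<Rightarrow> complex"
  assumes \<phi>: "lp_generator \<phi>"
  shows "\<exists>\<psi> :: 'a \<Rightarrow> complex. radial_generator \<psi>"
proof -
  obtain e :: 'a where e: "e \<in> Basis" using nonempty_Basis by blast
  define \<phi>1 where "\<phi>1 \<xi> = \<phi> ((\<xi> \<bullet> \<xi>) *\<^sub>R e)" for \<xi> :: 'a
  have nsq: "norm ((\<xi> \<bullet> \<xi>) *\<^sub>R e) = (norm \<xi>)\<^sup>2" for \<xi> :: 'a
    using e by (simp add: power2_norm_eq_inner)
  have one: "\<phi>1 \<xi> = 1" if "norm \<xi> \<le> 1" for \<xi>
  proof -
    have "(norm \<xi>)\<^sup>2 \<le> 1" using that by (simp add: power_le_one)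
    then show ?thesis using \<phi> nsq[of \<xi>] by (simp add: \<phi>1_def lp_generator_def)
  qed
  have zero: "\<phi>1 \<xi> = 0" if "norm \<xi> \<ge> 3 / 2" for \<xi>
  proof -
    have "(3 / 2)\<^sup>2 \<le> (norm \<xi>)\<^sup>2" using that by (intro power_mono) auto
    then have "3 / 2 \<le> (norm \<xi>)\<^sup>2" by (simp add: power2_eq_square)
    then show ?thesis using \<phi> nsq[of \<xi>] by (simp add: \<phi>1_def lp_generator_def)
  qed
  have "smooth_fun \<phi>1"
    unfolding \<phi>1_def
  proof (rule smooth_fun_compose[of \<phi>])
    show "smooth_fun \<phi>" using \<phi> by (simp add: lp_generator_def test_fun_iff)
    fix b :: 'a assume "b \<in> Basis"
    have "smooth_fun (\<lambda>x::'a. (\<Sum>c\<in>Basis. complex_of_real (x \<bullet> c) * complex_of_real (x \<bullet> c)) * complex_of_real (e \<bullet> b))"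
      by (intro smooth_fun_mult smooth_fun_sum smooth_fun_inner smooth_fun_const)
    moreover have "(\<Sum>c\<in>Basis. complex_of_real (x \<bullet> c) * complex_of_real (x \<bullet> c)) * complex_of_real (e \<bullet> b) = complex_of_real ((x \<bullet> x) *\<^sub>R e \<bullet> b)" for x :: 'a
      by (subst (3) euclidean_inner) simp
    ultimately show "smooth_fun (\<lambda>x::'a. complex_of_real ((x \<bullet> x) *\<^sub>R e \<bullet> b))" by simp
  qed
  moreover have "bounded {\<xi>. \<phi>1 \<xi> \<noteq> 0}"
    unfolding bounded_iff using zero by (meson linear mem_Collect_eq)
  ultimately have \<phi>1: "test_fun \<phi>1" by (simp add: test_fun_iff)
  \<comment> \<open>Dilating by 2 multiplies the integral by 2^d, so a solves (1 + a) - a 2^d = 0.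
    The coefficients 1 + a and - a add up to 1, which preserves the value 1 on the unit
    ball.\<close>
  define a :: complex where "a = 1 / (2 ^ DIM('a) - 1)"
  have a: "(1 + a) - a * 2 ^ DIM('a) = 0"
  proof -
    have "(1::real) < 2 ^ DIM('a)" by (intro one_less_power) auto
    then have "complex_of_real (2 ^ DIM('a)) \<noteq> complex_of_real 1" by (metis less_irrefl of_real_eq_iff)
    then have "(2::complex) ^ DIM('a) - 1 \<noteq> 0" by simp
    then show ?thesis by (simp add: a_def field_simps)
  qed
  define \<psi> where "\<psi> \<xi> = (1 + a) * \<phi>1 \<xi> - a * \<phi>1 ((1 / 2) *\<^sub>R \<xi>)" for \<xi>
  show ?thesis
    unfolding radial_generator_def
  proof (intro exI[of _ \<psi>] conjI allI impI)
    have s2: "test_fun (\<lambda>\<xi>. \<phi>1 ((1 / 2) *\<^sub>R \<xi>))" by (rule test_fun_scale[OF \<phi>1]) simp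
    show "test_fun \<psi>"
      unfolding \<psi>_def by (intro test_fun_diff test_fun_cmult \<phi>1 s2)
    show "\<psi> (A \<xi>) = \<psi> \<xi>" if "orthogonal_transformation A" for A \<xi>
      using that by (simp add: \<psi>_def \<phi>1_def orthogonal_transformation_def)
    show "\<psi> \<xi> = 1" if "norm \<xi> \<le> 1" for \<xi>
      using one[OF that] one[of "(1 / 2) *\<^sub>R \<xi>"] that by (simp add: \<psi>_def)
    show "\<psi> \<xi> = 0" if "norm \<xi> \<ge> 3" for \<xi>
      using zero[of \<xi>] zero[of "(1 / 2) *\<^sub>R \<xi>"] that by (simp add: \<psi>_def)
    have "(LINT \<xi>|lborel. 2 ^ DIM('a) *\<^sub>R \<phi>1 ((1 / 2) *\<^sub>R (2 *\<^sub>R \<xi>))) = (LINT \<xi>|lborel. \<phi>1 ((1 / 2) *\<^sub>R \<xi>))"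
      using test_fun_measurable[OF s2] by (rule integral_lborel_scale) simp
    then have "(LINT \<xi>|lborel. \<phi>1 ((1 / 2) *\<^sub>R \<xi>)) = 2 ^ DIM('a) * (LINT \<xi>|lborel. \<phi>1 \<xi>)"
      by (simp add: scaleR_conv_of_real)
    moreover have "(LINT \<xi>|lborel. \<psi> \<xi>) = (1 + a) * (LINT \<xi>|lborel. \<phi>1 \<xi>) - a * (LINT \<xi>|lborel. \<phi>1 ((1 / 2) *\<^sub>R \<xi>))"
      unfolding \<psi>_def
      by (subst Bochner_Integration.integral_diff)
        (intro integrable_mult_right test_fun_integrable \<phi>1 s2, intro integrable_mult_right test_fun_integrable \<phi>1 s2, simp)
    ultimately have "(LINT \<xi>|lborel. \<psi> \<xi>) = ((1 + a) - a * 2 ^ DIM('a)) * (LINT \<xi>|lborel. \<phi>1 \<xi>)"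
      by (simp add: left_diff_distrib mult.assoc)
    then show "(LINT \<xi>|lborel. \<psi> \<xi>) = 0" by (simp add: a)
  qed
qed

text \<open>The kernel vanishes at 0 and is Lipschitz, which bounds it in the unit ball at the price
  of 2^N for the weight; outside, Schwartz decay suffices because norm z is at least 1.\<close>

lemma kern_zero_mean_bound:
  fixes m :: "'a::euclidean_space \<Rightarrow> complex"
  assumes m: "test_fun m" and m0: "(LINT \<xi>|lborel. m \<xi>) = 0"
  obtains C where "C \<ge> 0" "\<And>z. norm (kern m z) \<le> C * norm z / (1 + norm z) ^ N"
proof -
  have k: "schwartz_fun (kern m)" by (rule schwartz_fun_kern[OF m])
  obtain C where C: "C \<ge> 0" "\<And>vs x. set vs \<subseteq> Basis \<Longrightarrow> length vs \<le> 1 \<Longrightarrow> (1 + norm x) ^ N * norm (dir_derivs vs (kern m) x) \<le> C"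
    by (rule schwartz_fun_bound[OF k, of 1 N]) blast
  have d: "norm (dir_deriv b (kern m) x) \<le> C" if "b \<in> Basis" for b x
  proof -
    have "1 * norm (dir_deriv b (kern m) x) \<le> (1 + norm x) ^ N * norm (dir_deriv b (kern m) x)"
      by (intro mult_right_mono) auto
    then show ?thesis using C(2)[of "[b]" x] that by simp
  qed
  have k0: "kern m 0 = 0" by (simp add: kern_def m0)
  have lip: "norm (kern m z) \<le> real DIM('a) * C * norm z" for z
    using smooth_fun_lipschitz[OF schwartz_fun_smooth[OF k], of z 0 "real DIM('a) * C"]
      sum_mono[OF d, of Basis "\<lambda>b. b"] by (simp add: k0)
  show ?thesis
  proof (rule that[of "real DIM('a) * C * 2 ^ N + C"])
    fix z :: 'a
    have pos: "0 < (1 + norm z) ^ N" by (intro zero_less_power add_pos_nonneg) auto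
    show "norm (kern m z) \<le> (real DIM('a) * C * 2 ^ N + C) * norm z / (1 + norm z) ^ N"
    proof (cases "norm z \<le> 1")
      case True
      have "(1 + norm z) ^ N \<le> 2 ^ N" using True by (intro power_mono) auto
      then have "norm (kern m z) * (1 + norm z) ^ N \<le> (real DIM('a) * C * norm z) * 2 ^ N"
        using lip[of z] C(1) by (intro mult_mono) auto
      also have "\<dots> \<le> (real DIM('a) * C * 2 ^ N + C) * norm z"
        using C(1) by (simp add: algebra_simps)
      finally show ?thesis using pos by (simp add: pos_le_divide_eq)
    next
      case False
      have "norm (kern m z) * (1 + norm z) ^ N \<le> C * 1"
        using C(2)[of "[]" z] by (simp add: mult.commute)
      also have "\<dots> \<le> C * norm z" using False C(1) by (intro mult_left_mono) auto
      also have "\<dots> \<le> (real DIM('a) * C * 2 ^ N + C) * norm z"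
        using C(1) by (simp add: algebra_simps)
      finally show ?thesis using pos by (simp add: pos_le_divide_eq)
    qed
  qed (use C in auto)
qed

text \<open>For j > 0 all cutoffs are dilates of the single function \<theta>, whose integral is
  again 0; so two applications of the preceding bound cover all scales with one constant.\<close>

lemma kern_lp_cutoff_bound:
  fixes \<psi> :: "'a::euclidean_space \<Rightarrow> complex"
  assumes \<psi>: "test_fun \<psi>" and \<psi>0: "(LINT \<xi>|lborel. \<psi> \<xi>) = 0"
  obtains C where "C > 0"
    "\<And>j z. norm (kern (lp_cutoff \<psi> j) z) \<le> (2 ^ j) ^ DIM('a) * (C * norm (2 ^ j *\<^sub>R z) / (1 + norm (2 ^ j *\<^sub>R z)) ^ N)"
proof -
  define \<theta> where "\<theta> \<xi> = \<psi> \<xi> - \<psi> (2 *\<^sub>R \<xi>)" for \<xi>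
  have \<psi>2: "test_fun (\<lambda>\<xi>. \<psi> (2 *\<^sub>R \<xi>))" by (rule test_fun_scale[OF \<psi>]) simp
  have \<theta>: "test_fun \<theta>" unfolding \<theta>_def by (intro test_fun_diff \<psi> \<psi>2)
  have "(LINT \<xi>|lborel. 2 ^ DIM('a) *\<^sub>R \<psi> (2 *\<^sub>R \<xi>)) = (LINT \<xi>|lborel. \<psi> \<xi>)"
    using test_fun_measurable[OF \<psi>] by (rule integral_lborel_scale) simp
  then have "(LINT \<xi>|lborel. \<psi> (2 *\<^sub>R \<xi>)) = 0" by (simp add: \<psi>0)
  then have \<theta>0: "(LINT \<xi>|lborel. \<theta> \<xi>) = 0"
    unfolding \<theta>_def by (simp add: test_fun_integrable \<psi> \<psi>2 \<psi>0)
  obtain C1 where C1: "C1 \<ge> 0" "\<And>z. norm (kern \<psi> z) \<le> C1 * norm z / (1 + norm z) ^ N"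
    by (rule kern_zero_mean_bound[OF \<psi> \<psi>0, where N=N]) blast
  obtain C2 where C2: "C2 \<ge> 0" "\<And>z. norm (kern \<theta> z) \<le> C2 * norm z / (1 + norm z) ^ N"
    by (rule kern_zero_mean_bound[OF \<theta> \<theta>0, where N=N]) blast
  have mono: "c * norm z / (1 + norm z) ^ N \<le> (C1 + C2 + 1) * norm z / (1 + norm z) ^ N"
    if "c \<le> C1 + C2 + 1" for c and z :: 'a
    using that by (intro divide_right_mono mult_right_mono) auto
  show ?thesis
  proof (rule that[of "C1 + C2 + 1"])
    fix j and z :: 'a
    show "norm (kern (lp_cutoff \<psi> j) z) \<le> (2 ^ j) ^ DIM('a) * ((C1 + C2 + 1) * norm (2 ^ j *\<^sub>R z) / (1 + norm (2 ^ j *\<^sub>R z)) ^ N)"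
    proof (cases "j = 0")
      case True
      have "lp_cutoff \<psi> 0 = \<psi>" by (simp add: lp_cutoff_eq[abs_def])
      then show ?thesis
        using True order_trans[OF C1(2)[of z] mono[of C1 z]] C2(1) by simp
    next
      case False
      have "lp_cutoff \<psi> j = (\<lambda>\<xi>. \<theta> ((1 / 2 ^ j) *\<^sub>R \<xi>))"
      proof
        fix \<xi> :: 'a
        have "(2::real) * (1 / 2 ^ j) = 1 / 2 ^ (j - 1)" using False by (cases j) auto
        then have eq: "2 *\<^sub>R ((1 / 2 ^ j) *\<^sub>R \<xi>) = (1 / 2 ^ (j - 1)) *\<^sub>R \<xi>"
          by simp
        then show "lp_cutoff \<psi> j \<xi> = \<theta> ((1 / 2 ^ j) *\<^sub>R \<xi>)"
          using False by (simp only: lp_cutoff_eq \<theta>_def eq if_False)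
      qed
      then have "norm (kern (lp_cutoff \<psi> j) z) = (2 ^ j) ^ DIM('a) * norm (kern \<theta> (2 ^ j *\<^sub>R z))"
        using kern_scale[OF \<theta>, of "2 ^ j" z] by (simp add: norm_mult norm_power)
      also have "\<dots> \<le> (2 ^ j) ^ DIM('a) * ((C1 + C2 + 1) * norm (2 ^ j *\<^sub>R z) / (1 + norm (2 ^ j *\<^sub>R z)) ^ N)"
        by (intro mult_left_mono order_trans[OF C2(2) mono]) (use C1(1) in auto)
      finally show ?thesis .
    qed
  qed (use C1 C2 in auto)
qed

lemma conv_dist_kern_sum:
  fixes m :: "'i \<Rightarrow> 'a::euclidean_space \<Rightarrow> complex"
  assumes T: "tempered_distribution T" and "finite I" "\<And>i. i \<in> I \<Longrightarrow> test_fun (m i)"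
  shows "conv_dist (kern (\<lambda>\<xi>. \<Sum>i\<in>I. m i \<xi>)) T x = (\<Sum>i\<in>I. conv_dist (kern (m i)) T x)"
  using assms(2,3)
proof (induction I)
  case empty
  have "kern (\<lambda>\<xi>::'a. 0) = (\<lambda>z. 0)" by (simp add: kern_def[abs_def])
  then show ?case using tempered_sum[OF T, of "{}"] by (simp add: conv_dist_def)
next
  case (insert i I)
  then show ?case by (simp add: conv_dist_kern_add[OF T] test_fun_sum)
qed

text \<open>On the support of the j-th radial cutoff the given cutoffs with indices j - 1 to j + 2
  sum to 1: there norm \<xi> < 3 * 2^j <= 2^(j + 2), so the sum up to j + 2 is 1, and norm \<xi> >
  2^(j - 1) >= 3/2 * 2^(j - 2), so the sum up to j - 2 is 0.\<close>

lemma radial_block_eq: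
  fixes \<phi> \<psi> :: "'a::euclidean_space \<Rightarrow> complex"
  assumes T: "tempered_distribution T" and \<phi>: "lp_generator \<phi>" and \<psi>: "radial_generator \<psi>"
  shows "radial_block \<psi> j T x =
    (LINT w|lborel. kern (lp_cutoff \<psi> j) (x - w) * (\<Sum>i\<in>{j - 1..j + 2}. lp_block \<phi> i T w))"
proof -
  have t\<phi>: "test_fun (lp_cutoff \<phi> i)" and t\<psi>: "test_fun (lp_cutoff \<psi> i)" for i
    using \<phi> \<psi> by (auto intro: test_fun_lp_cutoff simp: lp_generator_def radial_generator_def)
  have one: "\<psi> \<xi> = 1" if "norm \<xi> \<le> 1" for \<xi> using \<psi> that by (simp add: radial_generator_def)
  have zero: "\<psi> \<xi> = 0" if "norm \<xi> \<ge> 3" for \<xi> using \<psi> that by (simp add: radial_generator_def)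
  have \<phi>1: "\<phi> \<xi> = 1" if "norm \<xi> \<le> 1" for \<xi> using \<phi> that by (simp add: lp_generator_def)
  have \<phi>0: "\<phi> \<xi> = 0" if "norm \<xi> \<ge> 3/2" for \<xi> using \<phi> that by (simp add: lp_generator_def)
  have "lp_cutoff \<psi> j \<xi> * (\<Sum>i\<in>{j - 1..j + 2}. lp_cutoff \<phi> i \<xi>) = lp_cutoff \<psi> j \<xi>" for \<xi>
  proof (cases "lp_cutoff \<psi> j \<xi> = 0")
    case False
    note supp = lp_cutoff_support[of \<psi> 3, OF one zero _ False]
    have "(\<Sum>i\<le>j + 2. lp_cutoff \<phi> i \<xi>) = 1"
    proof -
      have "norm ((1 / 2 ^ (j + 2)) *\<^sub>R \<xi>) \<le> 1"
      proof -
        have "norm \<xi> \<le> 4 * 2 ^ j" using supp(1) zero_le_power[of "2::real" j] by linarith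
        then show ?thesis by (simp add: divide_le_eq)
      qed
      then show ?thesis by (simp only: sum_lp_cutoff \<phi>1)
    qed
    moreover have "(\<Sum>i<j - 1. lp_cutoff \<phi> i \<xi>) = 0"
    \<comment> \<open>For j < 2 truncated subtraction makes the index set empty, and the window
      starts at 0.\<close>
    proof (cases "j \<ge> 2")
      case True
      then obtain k where j: "j = Suc (Suc k)" by (metis add_2_eq_Suc le_Suc_ex)
      have "2 * 2 ^ k < norm \<xi>" using supp(2) by (simp add: j)
      moreover have "(0::real) \<le> 2 ^ k" by simp
      ultimately have "3/2 * 2 ^ k \<le> norm \<xi>" by linarith
      then have "norm ((1 / 2 ^ k) *\<^sub>R \<xi>) \<ge> 3/2" by (simp add: pos_le_divide_eq)
      then have "(\<Sum>i\<le>k. lp_cutoff \<phi> i \<xi>) = 0" by (simp only: sum_lp_cutoff \<phi>0)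
      then show ?thesis by (simp add: j lessThan_Suc_atMost)
    next
      case False
      then have "j - 1 = 0" by simp
      then show ?thesis by simp
    qed
    moreover have "{..j + 2} = {..<j - 1} \<union> {j - 1..j + 2}" "{..<j - 1} \<inter> {j - 1..j + 2} = {}" by auto
    then have "(\<Sum>i\<le>j + 2. lp_cutoff \<phi> i \<xi>) = (\<Sum>i<j - 1. lp_cutoff \<phi> i \<xi>) + (\<Sum>i\<in>{j - 1..j + 2}. lp_cutoff \<phi> i \<xi>)"
      by (simp add: sum.union_disjoint)
    ultimately show ?thesis by simp
  qed simp
  then have "radial_block \<psi> j T x = conv_dist (kern (\<lambda>\<xi>. lp_cutoff \<psi> j \<xi> * (\<Sum>i\<in>{j - 1..j + 2}. lp_cutoff \<phi> i \<xi>))) T x"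
    by (simp only:)
  also have "\<dots> = (LINT w|lborel. kern (lp_cutoff \<psi> j) (x - w) * conv_dist (kern (\<lambda>\<xi>. \<Sum>i\<in>{j - 1..j + 2}. lp_cutoff \<phi> i \<xi>)) T w)"
    by (intro conv_dist_mult T t\<psi> test_fun_sum t\<phi>) simp
  finally show ?thesis
    by (simp only: conv_dist_kern_sum[OF T finite_atLeastAtMost t\<phi>] lp_block_eq[OF \<phi> T])
qed

text \<open>The dilated generator is 1 on the support of the i-th cutoff, since 3/2 * 2^i <= 2^(i +
  1). This is the reproducing formula behind Nikolskii's inequality.\<close>

lemma lp_block_reproducing:
  fixes \<phi> :: "'a::euclidean_space \<Rightarrow> complex"
  assumes T: "tempered_distribution T" and \<phi>: "lp_generator \<phi>"
  shows "lp_block \<phi> i T x = (LINT w|lborel. kern (\<lambda>\<xi>. \<phi> ((1 / 2 ^ (i + 1)) *\<^sub>R \<xi>)) (x - w) * lp_block \<phi> i T w)"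
proof -
  have t: "test_fun \<phi>" using \<phi> by (simp add: lp_generator_def)
  have t1: "test_fun (\<lambda>\<xi>. \<phi> ((1 / 2 ^ (i + 1)) *\<^sub>R \<xi>))" by (rule test_fun_scale[OF t]) simp
  have \<phi>1: "\<phi> \<xi> = 1" if "norm \<xi> \<le> 1" for \<xi> using \<phi> that by (simp add: lp_generator_def)
  have \<phi>0: "\<phi> \<xi> = 0" if "norm \<xi> \<ge> 3/2" for \<xi> using \<phi> that by (simp add: lp_generator_def)
  have "\<phi> ((1 / 2 ^ (i + 1)) *\<^sub>R \<xi>) * lp_cutoff \<phi> i \<xi> = lp_cutoff \<phi> i \<xi>" for \<xi>
  proof (cases "lp_cutoff \<phi> i \<xi> = 0")
    case False
    have "norm ((1 / 2 ^ (i + 1)) *\<^sub>R \<xi>) \<le> 1"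
    proof -
      have "norm \<xi> \<le> 2 * 2 ^ i"
        using lp_cutoff_support(1)[of \<phi> "3/2", OF \<phi>1 \<phi>0 _ False] zero_le_power[of "2::real" i] by linarith
      then show ?thesis by (simp add: divide_le_eq)
    qed
    then show ?thesis by (simp only: \<phi>1) simp
  qed simp
  then have "conv_dist (kern (lp_cutoff \<phi> i)) T x = conv_dist (kern (\<lambda>\<xi>. \<phi> ((1 / 2 ^ (i + 1)) *\<^sub>R \<xi>) * lp_cutoff \<phi> i \<xi>)) T x"
    by (simp only:)
  also have "\<dots> = (LINT w|lborel. kern (\<lambda>\<xi>. \<phi> ((1 / 2 ^ (i + 1)) *\<^sub>R \<xi>)) (x - w) * conv_dist (kern (lp_cutoff \<phi> i)) T w)"
    by (rule conv_dist_mult[OF T t1 test_fun_lp_cutoff[OF t]])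
  finally show ?thesis by (simp add: lp_block_eq[OF \<phi> T])
qed

lemma lp_block_continuous:
  assumes "tempered_distribution T" "lp_generator \<phi>"
  shows "continuous_on UNIV (lp_block \<phi> i T)"
  unfolding lp_block_eq[OF assms(2,1)]
  using assms by (intro conv_dist_continuous schwartz_fun_kern test_fun_lp_cutoff) (auto simp: lp_generator_def)

text \<open>The M-test away from balls around 0 gives continuity off the origin. Partial sums
  telescope to a single dilated symbol, so pairing them with a test function converges to its value
  under T; the support of the test function avoids the origin, where no uniform bound is
  available.\<close>

lemma agrees_with_radial_series:
  fixes \<psi> :: "'a::euclidean_space \<Rightarrow> complex"
  assumes T: "tempered_distribution T" and \<psi>: "test_fun \<psi>" and \<psi>0: "\<psi> 0 = 1"
    and M: "\<And>r. r > 0 \<Longrightarrow> \<exists>M. summable M \<and> (\<forall>j x. r \<le> norm x \<longrightarrow> norm (radial_block \<psi> j T x) \<le> M j)"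
  shows "agrees_with_on (- {0}) T (\<lambda>x. \<Sum>j. radial_block \<psi> j T x)"
  unfolding agrees_with_on_def
proof (intro conjI allI impI)
  let ?f = "\<lambda>j. radial_block \<psi> j T"
  have fc: "continuous_on UNIV (?f j)" for j
    by (intro conv_dist_continuous T schwartz_fun_kern test_fun_lp_cutoff \<psi>)
  have [measurable]: "?f j \<in> borel_measurable borel" for j
    using fc by (rule borel_measurable_continuous_onI)
  show "continuous_on (- {0}) (\<lambda>x. \<Sum>j. ?f j x)"
    unfolding continuous_on_eq_continuous_at[OF open_Compl[OF closed_singleton]]
  proof
    fix x :: 'a assume x: "x \<in> - {0}"
    define r where "r = norm x / 2"
    have r: "r > 0" using x by (simp add: r_def)
    obtain M where "summable M" "\<And>j y. r \<le> norm y \<Longrightarrow> norm (?f j y) \<le> M j" using M[OF r] by blast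
    then have "uniform_limit {y. r < norm y} (\<lambda>n y. \<Sum>j<n. ?f j y) (\<lambda>y. \<Sum>j. ?f j y) sequentially"
      by (intro Weierstrass_m_test[where M=M]) auto
    then have "continuous_on {y. r < norm y} (\<lambda>y. \<Sum>j. ?f j y)"
      by (rule uniform_limit_theorem[rotated])
        (auto intro!: always_eventually continuous_on_sum continuous_on_subset[OF fc])
    moreover have "open {y::'a. r < norm y}" by (intro open_Collect_less continuous_intros)
    moreover have "r < norm x" using x by (simp add: r_def)
    ultimately show "isCont (\<lambda>y. \<Sum>j. ?f j y) x"
      by (simp add: continuous_on_eq_continuous_at)
  qed
  fix u :: "'a \<Rightarrow> complex" assume u: "test_fun_on (- {0}) u"
  then have u': "test_fun u" by (simp add: test_fun_on_def)
  have [measurable]: "u \<in> borel_measurable borel" using u' by (rule test_fun_measurable)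
  \<comment> \<open>The closed support omits 0 and hence a whole ball around it.\<close>
  obtain r where r: "r > 0" "\<And>x. u x \<noteq> 0 \<Longrightarrow> r \<le> norm x"
  proof -
    have "open (- closure {x. u x \<noteq> 0})" "0 \<in> - closure {x. u x \<noteq> 0}"
      using u by (auto simp: test_fun_on_def)
    then obtain r where "r > 0" "ball 0 r \<subseteq> - closure {x. u x \<noteq> 0}"
      by (meson openE)
    then show ?thesis
      using that[of r] closure_subset[of "{x. u x \<noteq> 0}"] by (force simp: not_less)
  qed
  obtain M where M: "summable M" "\<And>j y. r \<le> norm y \<Longrightarrow> norm (?f j y) \<le> M j" using M[OF r(1)] by blast
  have M0: "M j \<ge> 0" for j
  proof -
    obtain e :: 'a where "e \<in> Basis" using nonempty_Basis by blast
    then show ?thesis using M(2)[of "r *\<^sub>R e" j] r(1) order_trans[OF norm_ge_zero] by fastforce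
  qed
  have summ: "summable (\<lambda>j. ?f j y)" if "r \<le> norm y" for y
    using M(1) by (rule summable_comparison_test') (use M(2)[OF that] in auto)
  have bound: "norm (\<Sum>i\<le>n. ?f i y) \<le> (\<Sum>j. M j)" if "r \<le> norm y" for y n
    by (rule order_trans[OF sum_norm_le[OF M(2)[OF that]] sum_le_suminf[OF M(1)]]) (use M0 in auto)
  have "(\<lambda>n. LINT x|lborel. u x * (\<Sum>i\<le>n. ?f i x)) \<longlonglongrightarrow> (LINT x|lborel. u x * (\<Sum>j. ?f j x))"
  proof (rule integral_dominated_convergence[where w="\<lambda>x. norm (u x) * (\<Sum>j. M j)"])
    show lim: "AE x in lborel. (\<lambda>n. u x * (\<Sum>i\<le>n. ?f i x)) \<longlonglongrightarrow> u x * (\<Sum>j. ?f j x)"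
    proof (rule AE_I2)
      fix x
      show "(\<lambda>n. u x * (\<Sum>i\<le>n. ?f i x)) \<longlonglongrightarrow> u x * (\<Sum>j. ?f j x)"
        using r(2)[of x] summable_LIMSEQ'[OF summ[of x]] by (cases "u x = 0") (auto intro!: tendsto_mult)
    qed
    show "integrable lborel (\<lambda>x. norm (u x) * (\<Sum>j. M j))"
      by (intro integrable_mult_left integrable_norm test_fun_integrable u')
    show "AE x in lborel. norm (u x * (\<Sum>i\<le>n. ?f i x)) \<le> norm (u x) * (\<Sum>j. M j)" for n
    proof (rule AE_I2)
      fix x
      show "norm (u x * (\<Sum>i\<le>n. ?f i x)) \<le> norm (u x) * (\<Sum>j. M j)"
        using r(2)[of x] bound[of x n] by (cases "u x = 0") (auto simp: norm_mult intro!: mult_left_mono)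
    qed
    have "(\<lambda>x. u x * (\<Sum>j. ?f j x)) \<in> borel_measurable borel"
    proof (rule borel_measurable_LIMSEQ_metric)
      show "(\<lambda>x. u x * (\<Sum>i\<le>n. ?f i x)) \<in> borel_measurable borel" for n by measurable
      show "(\<lambda>n. u x * (\<Sum>i\<le>n. ?f i x)) \<longlonglongrightarrow> u x * (\<Sum>j. ?f j x)" for x
        using r(2)[of x] summable_LIMSEQ'[OF summ[of x]] by (cases "u x = 0") (auto intro!: tendsto_mult)
    qed
    then show "(\<lambda>x. u x * (\<Sum>j. ?f j x)) \<in> borel_measurable lborel" by simp
  qed measurable
  moreover have "(\<Sum>i\<le>n. ?f i x) = conv_dist (kern (\<lambda>\<xi>. \<psi> ((1 / 2 ^ n) *\<^sub>R \<xi>))) T x" for n and x :: 'a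
    unfolding sum_lp_cutoff[symmetric]
    by (rule conv_dist_kern_sum[symmetric]) (auto intro: T test_fun_lp_cutoff \<psi>)
  ultimately have "(\<lambda>n. LINT x|lborel. u x * conv_dist (kern (\<lambda>\<xi>. \<psi> ((1 / 2 ^ n) *\<^sub>R \<xi>))) T x) \<longlonglongrightarrow> (LINT x|lborel. u x * (\<Sum>j. ?f j x))"
    by simp
  from LIMSEQ_unique[OF conv_dist_approx_identity[OF T \<psi> \<psi>0 u'] this]
  show "T u = (LINT x|lborel. (\<Sum>j. ?f j x) * u x)" by (simp add: mult.commute)
qed

section \<open>Inequalities for powers\<close>

text \<open>Young's inequality with second factor 1, that is, the tangent of \<open>t powr p\<close>
  at t = 1.\<close>

lemma le_powr_div_add:
  fixes t p :: real
  assumes "t \<ge> 0" "p \<ge> 1"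
  shows "t \<le> t powr p / p + (1 - 1 / p)"
proof (cases "t = 0")
  case False
  then have "(t powr p) powr (1 / p) * 1 powr (1 - 1 / p) \<le> 1 / p * t powr p + (1 - 1 / p) * 1"
    using assms by (intro Youngs_inequality_0) auto
  then show ?thesis using assms False by (simp add: powr_powr)
qed (use assms in auto)

text \<open>Hoelder's inequality, from the tangent of \<open>t powr p\<close> at the point \<open>y / c\<close>.\<close>

lemma powr_nn_integral_le:
  fixes k g :: "'a \<Rightarrow> real"
  assumes [measurable]: "k \<in> borel_measurable M" "g \<in> borel_measurable M"
    and k: "\<And>x. k x \<ge> 0" and g: "\<And>x. g x \<ge> 0" and p: "p \<ge> 1" and c: "c > 0"
    and kc: "(\<integral>\<^sup>+x. ennreal (k x) \<partial>M) \<le> ennreal c"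
    and y: "y \<ge> 0" "ennreal y \<le> (\<integral>\<^sup>+x. ennreal (k x * g x) \<partial>M)"
  shows "ennreal (y powr p) \<le> ennreal (c powr (p - 1)) * (\<integral>\<^sup>+x. ennreal (k x * g x powr p) \<partial>M)"
proof (cases "y = 0 \<or> (\<integral>\<^sup>+x. ennreal (k x * g x powr p) \<partial>M) = \<infinity>")
  case True
  then show ?thesis using c p by (auto simp: ennreal_mult_top)
next
  case False
  then have y0: "y > 0" using y by simp
  define b where "b = enn2real (\<integral>\<^sup>+x. ennreal (k x * g x powr p) \<partial>M)"
  have b: "(\<integral>\<^sup>+x. ennreal (k x * g x powr p) \<partial>M) = ennreal b" "b \<ge> 0"
    using False by (auto simp: b_def ennreal_enn2real_if)
  define l where "l = y / c"
  have l: "l > 0" using y0 c by (simp add: l_def)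
  have pw: "k x * g x \<le> (l powr (1 - p) / p) * (k x * g x powr p) + (l * (1 - 1 / p)) * k x" for x
  proof -
    have "g x / l \<le> (g x / l) powr p / p + (1 - 1 / p)"
      using g l p by (intro le_powr_div_add) auto
    then have "l * (g x / l) \<le> l * ((g x / l) powr p / p + (1 - 1 / p))"
      using l by (intro mult_left_mono) auto
    also have "\<dots> = (l powr (1 - p) / p) * g x powr p + l * (1 - 1 / p)"
      using l g by (simp add: powr_divide powr_diff algebra_simps)
    finally have "g x \<le> (l powr (1 - p) / p) * g x powr p + l * (1 - 1 / p)" using l by simp
    from mult_left_mono[OF this k[of x]] show ?thesis by (simp add: algebra_simps)
  qed
  have p1: "1 - 1 / p \<ge> 0" "l powr (1 - p) / p \<ge> 0" using p by (auto simp: divide_simps)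
  have "ennreal y \<le> (\<integral>\<^sup>+x. ennreal ((l powr (1 - p) / p) * (k x * g x powr p) + (l * (1 - 1 / p)) * k x) \<partial>M)"
    by (rule order_trans[OF y(2)], intro nn_integral_mono ennreal_leI pw)
  also have "\<dots> = (\<integral>\<^sup>+x. ennreal (l powr (1 - p) / p) * ennreal (k x * g x powr p) + ennreal (l * (1 - 1 / p)) * ennreal (k x) \<partial>M)"
  proof (rule nn_integral_cong)
    fix x
    have "0 \<le> (l powr (1 - p) / p) * (k x * g x powr p)" "0 \<le> (l * (1 - 1 / p)) * k x"
      using mult_nonneg_nonneg[OF p1(2) mult_nonneg_nonneg[OF k powr_ge_zero]] p1(1) l k[of x] by simp_all
    then show "ennreal ((l powr (1 - p) / p) * (k x * g x powr p) + (l * (1 - 1 / p)) * k x) =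
        ennreal (l powr (1 - p) / p) * ennreal (k x * g x powr p) + ennreal (l * (1 - 1 / p)) * ennreal (k x)"
      using p1 l by (simp only: ennreal_plus ennreal_mult' mult_nonneg_nonneg less_imp_le)
  qed
  also have "\<dots> = ennreal (l powr (1 - p) / p) * ennreal b + ennreal (l * (1 - 1 / p)) * (\<integral>\<^sup>+x. ennreal (k x) \<partial>M)"
    by (simp add: nn_integral_add nn_integral_cmult b)
  also have "\<dots> \<le> ennreal (l powr (1 - p) / p) * ennreal b + ennreal (l * (1 - 1 / p)) * ennreal c"
    by (intro add_left_mono mult_left_mono kc) auto
  also have "\<dots> = ennreal (l powr (1 - p) / p * b + l * (1 - 1 / p) * c)"
    using p1 l b(2) less_imp_le[OF c]
    by (simp only: ennreal_plus ennreal_mult' mult_nonneg_nonneg less_imp_le)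
  finally have "ennreal y \<le> \<dots>" .
  moreover have "0 \<le> l powr (1 - p) / p * b + l * (1 - 1 / p) * c"
    using p1 l b(2) c by (intro add_nonneg_nonneg mult_nonneg_nonneg) auto
  ultimately have "y \<le> l powr (1 - p) / p * b + l * (1 - 1 / p) * c"
    by (simp only: ennreal_le_iff)
  \<comment> \<open>This is why the tangent point is y / c: the term from the mass of k cancels all
    but y / p of the left-hand side.\<close>
  also have "l * (1 - 1 / p) * c = y - y / p" using c by (simp add: l_def field_simps)
  finally have "y / p \<le> l powr (1 - p) * b / p" by simp
  then have "y \<le> l powr (1 - p) * b" using p by (simp add: divide_le_cancel)
  then have "y * l powr (p - 1) \<le> l powr (1 - p) * b * l powr (p - 1)"
    by (rule mult_right_mono) simp
  also have "\<dots> = b" using l by (simp add: mult.commute mult.left_commute flip: powr_add)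
  finally have "y * l powr (p - 1) * c powr (p - 1) \<le> b * c powr (p - 1)"
    by (rule mult_right_mono) simp
  also have "y * l powr (p - 1) * c powr (p - 1) = y powr p"
  proof -
    have "l powr (p - 1) * c powr (p - 1) = y powr (p - 1)"
      using c y0 l by (simp add: l_def flip: powr_mult)
    moreover have "y * y powr (p - 1) = y powr p"
      using y0 powr_add[of y 1 "p - 1"] by simp
    ultimately show ?thesis by (simp add: mult.assoc)
  qed
  finally show ?thesis
    unfolding b(1) using b(2) by (simp add: ennreal_mult'[symmetric] mult.commute)
qed

text \<open>The preceding inequality for counting measure and k = 1, whose mass is the number of
  terms.\<close>

lemma powr_sum_le:
  fixes a :: "'i \<Rightarrow> real"
  assumes I: "finite I" and a: "\<And>i. a i \<ge> 0" and p: "p \<ge> 1" and n: "card I \<le> n" "n > 0"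
  shows "(\<Sum>i\<in>I. a i) powr p \<le> real n powr (p - 1) * (\<Sum>i\<in>I. a i powr p)"
proof -
  have "ennreal ((\<Sum>i\<in>I. a i) powr p) \<le> ennreal (real n powr (p - 1)) * (\<integral>\<^sup>+i. ennreal (1 * a i powr p) \<partial>count_space I)"
  proof (rule powr_nn_integral_le)
    show "(\<integral>\<^sup>+i. ennreal 1 \<partial>count_space I) \<le> ennreal (real n)"
      using I n by (simp add: nn_integral_count_space_finite ennreal_of_nat_eq_real_of_nat)
    show "ennreal (\<Sum>i\<in>I. a i) \<le> (\<integral>\<^sup>+i. ennreal (1 * a i) \<partial>count_space I)"
      using I a by (simp add: nn_integral_count_space_finite)
  qed (use a p n in \<open>auto intro: sum_nonneg\<close>)
  also have "\<dots> = ennreal (real n powr (p - 1) * (\<Sum>i\<in>I. a i powr p))"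
    using I a by (simp add: nn_integral_count_space_finite ennreal_mult' sum_nonneg)
  finally show ?thesis
    using a by (subst (asm) ennreal_le_iff) (auto intro!: mult_nonneg_nonneg sum_nonneg)
qed

text \<open>The embedding of l_1 into l_p: each term is at most the total, so p - 1 powers of the
  total can be taken out.\<close>

lemma sum_powr_le_powr_sum:
  fixes a :: "'i \<Rightarrow> real"
  assumes I: "finite I" and a: "\<And>i. a i \<ge> 0" and p: "p \<ge> 1"
  shows "(\<Sum>i\<in>I. a i powr p) \<le> (\<Sum>i\<in>I. a i) powr p"
proof -
  define S where "S = (\<Sum>i\<in>I. a i)"
  have S: "S \<ge> 0" unfolding S_def using a by (intro sum_nonneg)
  have "a i powr p \<le> a i * S powr (p - 1)" if "i \<in> I" for i
  proof (cases "a i = 0")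
    case False
    have "a i \<le> S" unfolding S_def using that I a by (intro member_le_sum) auto
    then have "a i powr (p - 1) \<le> S powr (p - 1)" using a p by (intro powr_mono2) auto
    then have "a i * a i powr (p - 1) \<le> a i * S powr (p - 1)" using a by (intro mult_left_mono) auto
    moreover have "a i * a i powr (p - 1) = a i powr p"
      using powr_add[of "a i" 1 "p - 1"] False a[of i] by simp
    ultimately show ?thesis by simp
  qed (use p in auto)
  then have "(\<Sum>i\<in>I. a i powr p) \<le> (\<Sum>i\<in>I. a i * S powr (p - 1))" by (rule sum_mono)
  also have "\<dots> = S * S powr (p - 1)" by (simp add: S_def sum_distrib_right)
  also have "\<dots> = S powr p"
    using powr_add[of S 1 "p - 1"] S p by (cases "S = 0") auto
  finally show ?thesis by (simp add: S_def)
qed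

lemma le_powr_root:
  fixes y m D A p :: real
  assumes p: "p \<ge> 1" and D: "D \<ge> 0" and A: "A \<ge> 0" and m: "m > 0" and y: "y \<ge> 0"
    and le: "m * y powr p \<le> D * A powr p"
  shows "y \<le> D powr (1 / p) * m powr (- 1 / p) * A"
proof -
  have "y powr p \<le> D * A powr p / m" using m le by (simp add: pos_le_divide_eq mult.commute)
  then have "(y powr p) powr (1 / p) \<le> (D * A powr p / m) powr (1 / p)"
    using p by (intro powr_mono2) auto
  also have "\<dots> = D powr (1 / p) * m powr (- (1 / p)) * A"
    using p D m A by (simp add: powr_divide powr_mult powr_powr powr_minus_divide)
  finally show ?thesis using p y by (simp add: powr_powr)
qed

text \<open>The terms grow geometrically while 2^j t <= 1 and decay geometrically afterwards, so the
  bound depends on neither t nor n.\<close>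

lemma sum_min_dyadic_le:
  fixes t :: real
  assumes t: "t > 0"
  shows "(\<Sum>j<n. min (2 ^ j * t) (1 / (2 ^ j * t))) \<le> 4"
proof -
  define h where "h n = 2 ^ n * t" for n :: nat
  have h: "h n > 0" "h (Suc n) = 2 * h n" for n using t by (auto simp: h_def)
  \<comment> \<open>The invariant has two phases. Up to h n = 2 a bound by h n survives doubling;
    afterwards a new term is at most 1 / h n, which is exactly the increase of 4 - 2 / h n.\<close>
  have "(\<Sum>j<n. min (h j) (1 / h j)) \<le> (if h n \<le> 2 then h n else 4 - 2 / h n)" for n
  proof (induction n)
    case 0
    then show ?case using h(1)[of 0] by (simp add: divide_simps)
  next
    case (Suc n)
    consider "h n \<le> 1" | "1 < h n" "h n \<le> 2" | "2 < h n" by linarith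
    then show ?case
    proof cases
      case 1
      then show ?thesis using Suc by (simp add: h(2))
    next
      case 2
      have "(h n - 1) * (h n - 2) \<le> 0" using 2 by (intro mult_nonneg_nonpos) auto
      then have "h n * h n + 2 \<le> 3 * h n" by (simp add: algebra_simps)
      then have "h n * h n + 2 \<le> 4 * h n" using h(1)[of n] by linarith
      then have "2 \<le> (4 - h n) * h n" by (simp add: algebra_simps)
      then have "2 / h n \<le> 4 - h n" using h(1)[of n] by (simp only: pos_divide_le_eq)
      moreover have "1 / h n + 1 / h n = 2 / h n" by simp
      ultimately have "h n + 1 / h n \<le> 4 - 1 / h n" by linarith
      moreover have "min (h n) (1 / h n) \<le> 1 / h n" by simp
      ultimately show ?thesis using Suc 2 by (simp add: h(2))
    next
      case 3
      have "min (h n) (1 / h n) \<le> 1 / h n" by simp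
      then show ?thesis using Suc 3 by (simp add: h(2))
    qed
  qed
  from this[of n] h(1)[of n] have "(\<Sum>j<n. min (h j) (1 / h j)) \<le> 4"
    by (auto split: if_splits intro: order_trans)
  then show ?thesis by (simp add: h_def)
qed

section \<open>Pointwise bounds for the radial blocks\<close>

text \<open>The majorant from \<open>kern_lp_cutoff_bound\<close> with N = 2 d + 1. The extra power
  beyond 2 d compensates the factor norm z, which records that the kernels vanish at 0.\<close>

definition profile :: "'a::euclidean_space \<Rightarrow> real" where
  "profile z = norm z / (1 + norm z) ^ (2 * DIM('a) + 1)"

lemma profile_nonneg: "profile z \<ge> 0"
  by (simp add: profile_def)

lemma profile_measurable [measurable]: "profile \<in> borel_measurable borel"
  unfolding profile_def[abs_def] by measurable

lemma profile_le_power: "profile (z :: 'a::euclidean_space) \<le> 1 / (1 + norm z) ^ (2 * DIM('a))"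
proof -
  have "0 < 1 + norm z" by (simp add: add_pos_nonneg)
  then have "norm z / (1 + norm z) \<le> 1" by (simp add: divide_le_eq)
  moreover have "profile z = (norm z / (1 + norm z)) / (1 + norm z) ^ (2 * DIM('a))"
    by (simp add: profile_def)
  ultimately show ?thesis by (simp only: divide_right_mono zero_le_power add_nonneg_nonneg zero_le_one norm_ge_zero)
qed

lemma profile_le_sq: "profile (z :: 'a::euclidean_space) \<le> 1 / (1 + norm z)\<^sup>2"
proof -
  have "(1 + norm z)\<^sup>2 \<le> (1 + norm z) ^ (2 * DIM('a))"
    using DIM_positive[where 'a='a] by (intro power_increasing) auto
  then have "1 / (1 + norm z) ^ (2 * DIM('a)) \<le> 1 / (1 + norm z)\<^sup>2"
    by (intro divide_left_mono mult_pos_pos zero_less_power) (auto simp: add_pos_nonneg)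
  with profile_le_power[of z] show ?thesis by linarith
qed

text \<open>Keeps a single coordinate of z; an average over a curve parametrised by that coordinate
  then reduces to a one-dimensional integral.\<close>

lemma profile_le_inner:
  assumes "b \<in> Basis"
  shows "profile z \<le> inverse (1 + (z \<bullet> b)\<^sup>2)"
proof -
  have "(z \<bullet> b)\<^sup>2 \<le> (norm z)\<^sup>2" using Basis_le_norm[OF assms, of z] by (metis abs_ge_zero power2_abs power_mono)
  then have "1 + (z \<bullet> b)\<^sup>2 \<le> (1 + norm z)\<^sup>2" by (simp add: power2_sum add_increasing2)
  then have "1 / (1 + norm z)\<^sup>2 \<le> inverse (1 + (z \<bullet> b)\<^sup>2)"
    unfolding inverse_eq_divide
    by (intro divide_left_mono mult_pos_pos zero_less_power) (auto simp: add_pos_nonneg)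
  with profile_le_sq[of z] show ?thesis by linarith
qed

lemma profile_le_1: "profile z \<le> 1"
proof -
  have "1 \<le> (1 + norm z)\<^sup>2" by simp
  then have "1 / (1 + norm z)\<^sup>2 \<le> 1" by (simp add: divide_le_eq)
  with profile_le_sq[of z] show ?thesis by linarith
qed

text \<open>The bound by norm z comes from the vanishing at the origin, the other one from decay;
  together they make the sum over dyadic dilates finite.\<close>

lemma profile_le_min: "profile z \<le> min (norm z) (1 / norm z)" if "z \<noteq> 0"
proof -
  have "profile z \<le> norm z / 1"
    unfolding profile_def
    by (intro divide_left_mono one_le_power mult_pos_pos zero_less_power) (auto simp: add_pos_nonneg)
  moreover have "1 / (1 + norm z)\<^sup>2 \<le> 1 / norm z"
  proof (intro divide_left_mono)
    have "norm z \<le> (1 + norm z) * 1" by simp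
    also have "\<dots> \<le> (1 + norm z) * (1 + norm z)" by (intro mult_left_mono) auto
    finally show "norm z \<le> (1 + norm z)\<^sup>2" by (simp add: power2_eq_square)
  qed (use that in \<open>auto intro!: mult_pos_pos zero_less_power simp: add_pos_nonneg\<close>)
  ultimately show ?thesis using profile_le_sq[of z] by simp
qed

lemma profile_integral_finite:
  obtains c where "c > 0" "(\<integral>\<^sup>+z. ennreal (profile (z :: 'a::euclidean_space)) \<partial>lborel) \<le> ennreal c"
proof -
  have "integrable lborel (\<lambda>z::'a. 1 / (1 + norm z) ^ (2 * DIM('a)))"
    by (rule integrable_inverse_power_norm) simp
  then have "(\<integral>\<^sup>+z. ennreal (1 / (1 + norm (z::'a)) ^ (2 * DIM('a))) \<partial>lborel) = ennreal (LINT z|lborel. 1 / (1 + norm (z::'a)) ^ (2 * DIM('a)))"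
    by (intro nn_integral_eq_integral) auto
  moreover have "(\<integral>\<^sup>+z. ennreal (profile (z :: 'a)) \<partial>lborel) \<le> (\<integral>\<^sup>+z. ennreal (1 / (1 + norm (z::'a)) ^ (2 * DIM('a))) \<partial>lborel)"
    by (intro nn_integral_mono ennreal_leI profile_le_power)
  ultimately have "(\<integral>\<^sup>+z. ennreal (profile (z :: 'a)) \<partial>lborel) \<le> ennreal (\<bar>LINT z|lborel. 1 / (1 + norm (z::'a)) ^ (2 * DIM('a))\<bar> + 1)"
    by (metis (no_types, lifting) abs_ge_self add_increasing2 ennreal_leI order_trans zero_le_one)
  then show ?thesis by (rule that[rotated]) (simp add: add_nonneg_pos)
qed

definition block_powers :: "('a::euclidean_space \<Rightarrow> complex) \<Rightarrow> real \<Rightarrow> nat \<Rightarrow> 'a distribution \<Rightarrow> 'a \<Rightarrow> real" where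
  "block_powers \<phi> p j T w = (\<Sum>i\<in>{j - 1..j + 2}. norm (lp_block \<phi> i T w) powr p)"

lemma block_powers_nonneg: "block_powers \<phi> p j T w \<ge> 0"
  unfolding block_powers_def by (intro sum_nonneg) auto

lemma block_powers_measurable:
  assumes "tempered_distribution T" "lp_generator \<phi>"
  shows "block_powers \<phi> p j T \<in> borel_measurable borel"
proof -
  have [measurable]: "lp_block \<phi> i T \<in> borel_measurable borel" for i
    by (intro borel_measurable_continuous_onI lp_block_continuous assms)
  show ?thesis unfolding block_powers_def[abs_def] by measurable
qed

text \<open>The factor (2^j)^d compensates the dilation, so the kernel has the same mass at all
  scales and Hoelder's inequality costs a constant independent of j. The at most four neighbouring
  blocks cost another factor 4^(p - 1).\<close>

lemma radial_block_power_bound: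
  fixes \<phi> \<psi> :: "'a::euclidean_space \<Rightarrow> complex"
  assumes \<phi>: "lp_generator \<phi>" and \<psi>: "radial_generator \<psi>"
    and p: "p \<ge> 1"
  shows "\<exists>C>0. \<forall>T j x. tempered_distribution T \<longrightarrow>
    ennreal (norm (radial_block \<psi> j T x) powr p) \<le>
      ennreal C * (\<integral>\<^sup>+w. ennreal ((2 ^ j) ^ DIM('a) * profile (2 ^ j *\<^sub>R (x - w)) * block_powers \<phi> p j T w) \<partial>lborel)"
proof -
  obtain C0 where C0: "C0 > 0" "\<And>j z. norm (kern (lp_cutoff \<psi> j) z) \<le>
      (2 ^ j) ^ DIM('a) * (C0 * norm (2 ^ j *\<^sub>R z) / (1 + norm (2 ^ j *\<^sub>R z)) ^ (2 * DIM('a) + 1))"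
    using kern_lp_cutoff_bound[of \<psi> "2 * DIM('a) + 1"] \<psi> unfolding radial_generator_def by blast
  obtain c where c: "c > 0" "(\<integral>\<^sup>+z. ennreal (profile (z :: 'a)) \<partial>lborel) \<le> ennreal c"
    by (rule profile_integral_finite)
  define C where "C = c powr (p - 1) * (C0 powr p * 4 powr (p - 1))"
  show ?thesis
  proof (intro exI[of _ C] conjI allI impI)
    show "C > 0" unfolding C_def using c C0 by (intro mult_pos_pos) auto
    fix T :: "'a distribution" and j :: nat and x :: 'a assume T: "tempered_distribution T"
    let ?S = "\<lambda>w. \<Sum>i\<in>{j - 1..j + 2}. lp_block \<phi> i T w"
    let ?k = "\<lambda>w. (2 ^ j) ^ DIM('a) * profile (2 ^ j *\<^sub>R (x - w))"
    let ?y = "norm (radial_block \<psi> j T x)"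
    have [measurable]: "lp_block \<phi> i T \<in> borel_measurable borel" for i
      by (intro borel_measurable_continuous_onI lp_block_continuous T \<phi>)
    have [measurable]: "block_powers \<phi> p j T \<in> borel_measurable borel"
      by (rule block_powers_measurable[OF T \<phi>])
    have kint: "(\<integral>\<^sup>+w. ennreal (?k w) \<partial>lborel) \<le> ennreal c"
    proof -
      have "(\<integral>\<^sup>+w. ennreal (?k w) \<partial>lborel) = (\<integral>\<^sup>+w. ennreal ((2 ^ j) ^ DIM('a) * profile (2 ^ j *\<^sub>R (w::'a))) \<partial>lborel)"
        by (rule nn_integral_lborel_reflect[where f="\<lambda>w::'a. ennreal ((2 ^ j) ^ DIM('a) * profile (2 ^ j *\<^sub>R w))"]) measurable
      also have "\<dots> = (\<integral>\<^sup>+w. ennreal ((2 ^ j) ^ DIM('a)) * ennreal (profile (2 ^ j *\<^sub>R (w::'a))) \<partial>lborel)"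
        by (simp add: ennreal_mult profile_nonneg)
      also have "\<dots> = (\<integral>\<^sup>+w. ennreal (profile (w::'a)) \<partial>lborel)"
        by (rule nn_integral_lborel_scale) auto
      finally show ?thesis using c by simp
    qed
    have "ennreal ?y \<le> (\<integral>\<^sup>+w. ennreal (norm (kern (lp_cutoff \<psi> j) (x - w) * ?S w)) \<partial>lborel)"
      unfolding radial_block_eq[OF T \<phi> \<psi>] by (rule ennreal_norm_integral_le)
    also have "\<dots> \<le> (\<integral>\<^sup>+w. ennreal (?k w * (C0 * norm (?S w))) \<partial>lborel)"
    proof (intro nn_integral_mono ennreal_leI)
      fix w
      have "norm (kern (lp_cutoff \<psi> j) (x - w)) \<le> ?k w * C0"
        using C0(2)[of j "x - w"] by (simp add: profile_def mult_ac)
      from mult_right_mono[OF this norm_ge_zero[of "?S w"]]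
      show "norm (kern (lp_cutoff \<psi> j) (x - w) * ?S w) \<le> ?k w * (C0 * norm (?S w))"
        by (simp only: norm_mult mult.assoc)
    qed
    finally have y: "ennreal ?y \<le> \<dots>" .
    have "ennreal (?y powr p) \<le> ennreal (c powr (p - 1)) * (\<integral>\<^sup>+w. ennreal (?k w * (C0 * norm (?S w)) powr p) \<partial>lborel)"
      by (rule powr_nn_integral_le[OF _ _ _ _ p c(1) kint _ y])
        (use C0 in \<open>auto intro!: mult_nonneg_nonneg profile_nonneg\<close>)
    also have "\<dots> \<le> ennreal (c powr (p - 1)) * (\<integral>\<^sup>+w. ennreal ((C0 powr p * 4 powr (p - 1)) * (?k w * block_powers \<phi> p j T w)) \<partial>lborel)"
    proof (intro mult_left_mono nn_integral_mono ennreal_leI)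
      fix w
      have "norm (?S w) powr p \<le> (\<Sum>i\<in>{j - 1..j + 2}. norm (lp_block \<phi> i T w)) powr p"
        using p by (intro powr_mono2 norm_sum) auto
      also have "\<dots> \<le> real 4 powr (p - 1) * block_powers \<phi> p j T w"
        unfolding block_powers_def by (rule powr_sum_le) (use p in auto)
      finally have "norm (?S w) powr p \<le> 4 powr (p - 1) * block_powers \<phi> p j T w" by simp
      then have "?k w * (C0 powr p * norm (?S w) powr p) \<le> ?k w * (C0 powr p * (4 powr (p - 1) * block_powers \<phi> p j T w))"
        by (intro mult_left_mono) (auto intro!: mult_nonneg_nonneg profile_nonneg)
      then show "?k w * (C0 * norm (?S w)) powr p \<le> (C0 powr p * 4 powr (p - 1)) * (?k w * block_powers \<phi> p j T w)"
        using C0(1) by (simp only: powr_mult mult_ac norm_ge_zero less_imp_le)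
    qed auto
    also have "\<dots> = ennreal C * (\<integral>\<^sup>+w. ennreal (?k w * block_powers \<phi> p j T w) \<partial>lborel)"
    proof -
      have "(\<integral>\<^sup>+w. ennreal ((C0 powr p * 4 powr (p - 1)) * (?k w * block_powers \<phi> p j T w)) \<partial>lborel)
        = ennreal (C0 powr p * 4 powr (p - 1)) * (\<integral>\<^sup>+w. ennreal (?k w * block_powers \<phi> p j T w) \<partial>lborel)"
        by (subst nn_integral_cmult[symmetric]) (auto simp: ennreal_mult' intro!: nn_integral_cong)
      then show ?thesis by (simp add: C_def ennreal_mult' mult.assoc)
    qed
    finally show "ennreal (?y powr p) \<le> ennreal C * (\<integral>\<^sup>+w. ennreal (?k w * block_powers \<phi> p j T w) \<partial>lborel)" .
  qed
qed

text \<open>The window starts at j - 1, so j <= i + 1 and comparing the two scales costs at most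
  2^d.\<close>

lemma power2_dyadic_le:
  assumes "i \<in> {j - 1..j + 2}"
  shows "(2 ^ j :: real) ^ d \<le> 2 ^ d * (2 ^ i) ^ d"
proof -
  have "(2 ^ j :: real) \<le> 2 ^ Suc i" using assms by (intro power_increasing) auto
  then have "(2 ^ j :: real) ^ d \<le> (2 ^ Suc i) ^ d" by (intro power_mono) auto
  then show ?thesis by (simp add: power_mult_distrib)
qed

text \<open>A radial function at \<open>x\<close> is an average over the points
  \<open>sqrt (r\<^sup>2 - t\<^sup>2) *\<^sub>R e1 + t *\<^sub>R e2\<close> of norm \<open>r = norm x\<close>, for \<open>t\<close> between \<open>0\<close> and \<open>r\<close>; only
  a fraction \<open>1 / (2 ^ j * r)\<close> of them is within distance \<open>1 / 2 ^ j\<close> of a given point.\<close>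

lemma radial_block_bound:
  fixes \<phi> \<psi> :: "real ^ 'n \<Rightarrow> complex"
  assumes \<phi>: "lp_generator \<phi>" and \<psi>: "radial_generator \<psi>"
    and p: "p \<ge> 1" and d: "CARD('n) \<ge> 2"
  shows "\<exists>C>0. \<forall>T a j x. tempered_distribution T \<longrightarrow> radial_distribution T \<longrightarrow> (\<forall>i. a i \<ge> 0) \<longrightarrow>
      (\<forall>i. block_mass \<phi> p i T \<le> ennreal (a i powr p / (2 ^ i) ^ CARD('n))) \<longrightarrow>
      x \<noteq> 0 \<longrightarrow> norm (radial_block \<psi> j T x) \<le> C * min 1 ((2 ^ j * norm x) powr (- 1 / p)) * (\<Sum>i\<in>{j - 1..j + 2}. a i)"
proof -
  from radial_block_power_bound[OF \<phi> \<psi> p]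
  obtain C where "C > 0" and bound: "\<forall>T j x. tempered_distribution T \<longrightarrow>
    ennreal (norm (radial_block \<psi> j T x) powr p) \<le>
      ennreal C * (\<integral>\<^sup>+w. ennreal ((2 ^ j) ^ DIM(real ^ 'n) * profile (2 ^ j *\<^sub>R (x - w)) * block_powers \<phi> p j T w) \<partial>lborel)"
    by (elim exE conjE)
  note C = \<open>C > 0\<close> bound[rule_format]
  \<comment> \<open>The dimension is at least two, so there are two orthogonal directions spanning
    the plane that contains the arc.\<close>
  obtain e1 e2 :: "real ^ 'n" where e: "e1 \<in> Basis" "e2 \<in> Basis" "e1 \<noteq> e2"
  proof -
    have "\<not> card (Basis :: (real ^ 'n) set) \<le> 1" using d by simp
    then show ?thesis using that by (metis card_le_Suc0_iff_eq finite_Basis One_nat_def)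
  qed
  define P where "P = enn2real (\<integral>\<^sup>+s. ennreal (inverse (1 + (s::real)\<^sup>2)) \<partial>lborel)"
  have P: "(\<integral>\<^sup>+s. ennreal (inverse (1 + (s::real)\<^sup>2)) \<partial>lborel) = ennreal P" "P \<ge> 0"
  proof -
    have "integrable lborel (\<lambda>s::real. inverse (1 + s\<^sup>2))"
      using integrable_inverse_1_plus_square by (simp add: set_integrable_def)
    then have "(\<integral>\<^sup>+s. ennreal (inverse (1 + (s::real)\<^sup>2)) \<partial>lborel) = ennreal (LINT s|lborel. inverse (1 + s\<^sup>2))"
      by (intro nn_integral_eq_integral) auto
    then show "(\<integral>\<^sup>+s. ennreal (inverse (1 + (s::real)\<^sup>2)) \<partial>lborel) = ennreal P" "P \<ge> 0"
      by (simp_all add: P_def)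
  qed
  \<comment> \<open>P + 1 dominates both 1 and P: the direct bound needs C * 2^d, the averaged one C
    * P * 2^d. The power 2^d comes from passing between neighbouring scales.\<close>
  define D where "D = C * (P + 1) * 2 ^ CARD('n)"
  have D: "D > 0" unfolding D_def using C P by (intro mult_pos_pos) auto
  show ?thesis
  proof (intro exI[of _ "D powr (1 / p)"] conjI allI impI)
    show "D powr (1 / p) > 0" using D by simp
    fix T :: "(real ^ 'n) distribution" and a :: "nat \<Rightarrow> real" and j :: nat and x :: "real ^ 'n"
    assume T: "tempered_distribution T" "radial_distribution T" and "\<forall>i. a i \<ge> 0" and x: "x \<noteq> 0"
      and "\<forall>i. block_mass \<phi> p i T \<le> ennreal (a i powr p / (2 ^ i) ^ CARD('n))"
    then have a: "a i \<ge> 0"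
      and norms: "block_mass \<phi> p i T \<le> ennreal (a i powr p / (2 ^ i) ^ CARD('n))" for i
      by auto
    let ?f = "radial_block \<psi> j T"
    let ?G = "block_powers \<phi> p j T"
    let ?d = "CARD('n)"
    let ?A = "\<Sum>i\<in>{j - 1..j + 2}. a i"
    define r where "r = norm x"
    have r: "r > 0" using x by (simp add: r_def)
    have [measurable]: "lp_block \<phi> i T \<in> borel_measurable borel" for i
      by (intro borel_measurable_continuous_onI lp_block_continuous T \<phi>)
    have [measurable]: "?G \<in> borel_measurable borel"
      by (rule block_powers_measurable[OF T(1) \<phi>])
    have A0: "?A \<ge> 0" using a by (intro sum_nonneg)
    have Gint: "ennreal ((2 ^ j) ^ ?d) * (\<integral>\<^sup>+w. ennreal (?G w) \<partial>lborel) \<le> ennreal (2 ^ ?d * ?A powr p)"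
    proof -
      have "ennreal ((2 ^ j) ^ ?d) * (\<integral>\<^sup>+w. ennreal (?G w) \<partial>lborel)
          = (\<Sum>i\<in>{j - 1..j + 2}. ennreal ((2 ^ j) ^ ?d) * block_mass \<phi> p i T)"
      proof -
        have "ennreal (?G w) = (\<Sum>i\<in>{j - 1..j + 2}. ennreal (norm (lp_block \<phi> i T w) powr p))" for w
          unfolding block_powers_def by (rule sum_ennreal[symmetric]) simp
        then have "(\<integral>\<^sup>+w. ennreal (?G w) \<partial>lborel) = (\<integral>\<^sup>+w. (\<Sum>i\<in>{j - 1..j + 2}. ennreal (norm (lp_block \<phi> i T w) powr p)) \<partial>lborel)"
          by (simp only:)
        also have "\<dots> = (\<Sum>i\<in>{j - 1..j + 2}. \<integral>\<^sup>+w. ennreal (norm (lp_block \<phi> i T w) powr p) \<partial>lborel)"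
          by (rule nn_integral_sum) measurable
        finally show ?thesis by (simp only: sum_distrib_left)
      qed
      also have "\<dots> \<le> (\<Sum>i\<in>{j - 1..j + 2}. ennreal (2 ^ ?d * a i powr p))"
      proof (rule sum_mono)
        fix i assume i: "i \<in> {j - 1..j + 2}"
        have "ennreal ((2 ^ j) ^ ?d) * block_mass \<phi> p i T
            \<le> ennreal (2 ^ ?d * (2 ^ i) ^ ?d) * ennreal (a i powr p / (2 ^ i) ^ ?d)"
          by (intro mult_mono ennreal_leI power2_dyadic_le[OF i] norms) auto
        also have "\<dots> = ennreal (2 ^ ?d * a i powr p)"
          by (subst ennreal_mult'[symmetric]) auto
        finally show "ennreal ((2 ^ j) ^ ?d) * block_mass \<phi> p i T \<le> ennreal (2 ^ ?d * a i powr p)" .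
      qed
      also have "\<dots> = ennreal (2 ^ ?d * (\<Sum>i\<in>{j - 1..j + 2}. a i powr p))"
        by (subst sum_ennreal, simp, simp only: sum_distrib_left)
      also have "\<dots> \<le> ennreal (2 ^ ?d * ?A powr p)"
        by (intro ennreal_leI mult_left_mono sum_powr_le_powr_sum a p) auto
      finally show ?thesis .
    qed
    have b1: "norm (?f x) powr p \<le> D * ?A powr p"
    proof -
      have "ennreal (norm (?f x) powr p) \<le> ennreal C * (\<integral>\<^sup>+w. ennreal ((2 ^ j) ^ ?d * profile (2 ^ j *\<^sub>R (x - w)) * ?G w) \<partial>lborel)"
        using C(2)[OF T(1)] by simp
      also have "\<dots> \<le> ennreal C * (\<integral>\<^sup>+w. ennreal ((2 ^ j) ^ ?d) * ennreal (?G w) \<partial>lborel)"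
      proof (intro mult_left_mono nn_integral_mono)
        fix w
        have "(2 ^ j) ^ ?d * profile (2 ^ j *\<^sub>R (x - w)) * ?G w \<le> (2 ^ j) ^ ?d * 1 * ?G w"
          by (intro mult_right_mono mult_left_mono profile_le_1 block_powers_nonneg) auto
        then show "ennreal ((2 ^ j) ^ ?d * profile (2 ^ j *\<^sub>R (x - w)) * ?G w) \<le> ennreal ((2 ^ j) ^ ?d) * ennreal (?G w)"
          by (subst ennreal_mult'[symmetric]) (auto intro: ennreal_leI)
      qed auto
      also have "\<dots> \<le> ennreal C * ennreal (2 ^ ?d * ?A powr p)"
        by (subst nn_integral_cmult, simp, rule mult_left_mono[OF Gint], simp)
      also have "\<dots> = ennreal (C * (2 ^ ?d * ?A powr p))"
        using C(1) by (subst ennreal_mult') auto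
      finally have "norm (?f x) powr p \<le> C * (2 ^ ?d * ?A powr p)"
        using C(1) by (subst (asm) ennreal_le_iff) auto
      also have "\<dots> = (C * 1 * 2 ^ ?d) * ?A powr p" by simp
      also have "\<dots> \<le> D * ?A powr p"
        unfolding D_def using C(1) P(2) by (intro mult_right_mono mult_left_mono) auto
      finally show ?thesis .
    qed
    \<comment> \<open>Integrating over t from 0 to r gives the factor r on the left, where radiality
      makes the integrand constant. On the right only the coordinate t - w \<bullet> e2 of the
      difference is kept; its integral over t is P / 2^j for every w, and this is the gain.\<close>
    have b2: "(2 ^ j * r) * norm (?f x) powr p \<le> D * ?A powr p"
    proof -
      define y where "y t = sqrt (r\<^sup>2 - t\<^sup>2) *\<^sub>R e1 + t *\<^sub>R e2" for t
      have [measurable]: "y \<in> borel_measurable borel" unfolding y_def[abs_def] by measurable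
      have ye: "y t \<bullet> e2 = t" for t
        using e by (simp add: y_def inner_add_left inner_Basis)
      have ny: "norm (y t) = r" if "t \<in> {0..r}" for t
      proof -
        have "t\<^sup>2 \<le> r\<^sup>2" using that by (intro power_mono) auto
        then have "(norm (y t))\<^sup>2 = r\<^sup>2"
          unfolding power2_norm_eq_inner using e
          by (simp add: y_def inner_add_left inner_add_right inner_Basis power2_eq_square[symmetric])
        then show ?thesis using r by simp
      qed
      have fy: "?f (y t) = ?f x" if t: "t \<in> {0..r}" for t
      proof -
        have "norm x = norm (y t)" using ny[OF t] by (simp add: r_def)
        then obtain A where A: "orthogonal_transformation A" "A x = y t"
          by (rule orthogonal_transformation_exists)
        have "lp_cutoff \<psi> j (B \<xi>) = lp_cutoff \<psi> j \<xi>" if "orthogonal_transformation B" for B \<xi>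
          using \<psi> that linear_scale[OF orthogonal_transformation_linear[OF that], symmetric]
          by (simp add: lp_cutoff_eq radial_generator_def)
        moreover have "test_fun (lp_cutoff \<psi> j)"
          using \<psi> by (intro test_fun_lp_cutoff) (simp add: radial_generator_def)
        ultimately have "?f (A x) = ?f x" by (intro conv_dist_kern_orthogonal T A)
        then show ?thesis by (simp add: A)
      qed
      have "ennreal r * ennreal (norm (?f x) powr p) = (\<integral>\<^sup>+t. ennreal (norm (?f x) powr p) * indicator {0..r} t \<partial>lborel)"
        using r by (subst nn_integral_cmult_indicator) (auto simp: mult.commute)
      also have "\<dots> \<le> (\<integral>\<^sup>+t. (\<integral>\<^sup>+w. ennreal (C * ((2 ^ j) ^ ?d * inverse (1 + (2 ^ j * (t - w \<bullet> e2))\<^sup>2) * ?G w)) \<partial>lborel) \<partial>lborel)"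
      proof (rule nn_integral_mono)
        fix t
        show "ennreal (norm (?f x) powr p) * indicator {0..r} t \<le> (\<integral>\<^sup>+w. ennreal (C * ((2 ^ j) ^ ?d * inverse (1 + (2 ^ j * (t - w \<bullet> e2))\<^sup>2) * ?G w)) \<partial>lborel)"
        proof (cases "t \<in> {0..r}")
          case True
          have "ennreal (norm (?f x) powr p) = ennreal (norm (?f (y t)) powr p)" by (simp add: fy[OF True])
          also have "\<dots> \<le> ennreal C * (\<integral>\<^sup>+w. ennreal ((2 ^ j) ^ ?d * profile (2 ^ j *\<^sub>R (y t - w)) * ?G w) \<partial>lborel)"
            using C(2)[OF T(1)] by simp
          also have "\<dots> = (\<integral>\<^sup>+w. ennreal (C * ((2 ^ j) ^ ?d * profile (2 ^ j *\<^sub>R (y t - w)) * ?G w)) \<partial>lborel)"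
            using C(1) by (subst nn_integral_cmult[symmetric]) (auto simp: ennreal_mult' intro!: nn_integral_cong)
          also have "\<dots> \<le> (\<integral>\<^sup>+w. ennreal (C * ((2 ^ j) ^ ?d * inverse (1 + (2 ^ j * (t - w \<bullet> e2))\<^sup>2) * ?G w)) \<partial>lborel)"
          proof (intro nn_integral_mono ennreal_leI mult_left_mono mult_right_mono)
            fix w
            show "profile (2 ^ j *\<^sub>R (y t - w)) \<le> inverse (1 + (2 ^ j * (t - w \<bullet> e2))\<^sup>2)"
              using profile_le_inner[OF e(2), of "2 ^ j *\<^sub>R (y t - w)"] by (simp add: inner_diff_left ye)
          qed (use C(1) in \<open>auto intro: block_powers_nonneg\<close>)
          finally show ?thesis using True by simp
        qed simp
      qed
      also have "\<dots> = (\<integral>\<^sup>+w. (\<integral>\<^sup>+t. ennreal (C * ((2 ^ j) ^ ?d * inverse (1 + (2 ^ j * (t - w \<bullet> e2))\<^sup>2) * ?G w)) \<partial>lborel) \<partial>lborel)"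
        by (rule lborel_pair.Fubini') measurable
      also have "\<dots> = (\<integral>\<^sup>+w. ennreal (C * (P / 2 ^ j)) * (ennreal ((2 ^ j) ^ ?d) * ennreal (?G w)) \<partial>lborel)"
      proof (rule nn_integral_cong)
        fix w
        have I: "ennreal (2 ^ j) * (\<integral>\<^sup>+t. ennreal (inverse (1 + (2 ^ j * (t - b))\<^sup>2)) \<partial>lborel) = ennreal P" for b :: real
        proof -
          have "(\<integral>\<^sup>+t. ennreal (inverse (1 + (2 ^ j * (t - b))\<^sup>2)) \<partial>lborel) = (\<integral>\<^sup>+t. ennreal (inverse (1 + (2 ^ j * (b - t))\<^sup>2)) \<partial>lborel)"
            by (simp add: power_mult_distrib power2_commute)
          also have "\<dots> = (\<integral>\<^sup>+t. ennreal (inverse (1 + (2 ^ j * t)\<^sup>2)) \<partial>lborel)"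
            by (rule nn_integral_lborel_reflect[where f="\<lambda>t. ennreal (inverse (1 + (2 ^ j * t)\<^sup>2))"]) measurable
          finally show ?thesis
            using nn_integral_lborel_scale[of "\<lambda>t::real. ennreal (inverse (1 + t\<^sup>2))" "2 ^ j"] P(1)
            by (simp add: nn_integral_cmult)
        qed
        have I': "(\<integral>\<^sup>+t. ennreal (inverse (1 + (2 ^ j * (t - b))\<^sup>2)) \<partial>lborel) = ennreal (P / 2 ^ j)" for b :: real
        proof -
          have "ennreal (1 / 2 ^ j) * (ennreal (2 ^ j) * (\<integral>\<^sup>+t. ennreal (inverse (1 + (2 ^ j * (t - b))\<^sup>2)) \<partial>lborel)) = ennreal (1 / 2 ^ j) * ennreal P"
            by (simp only: I)
          then show ?thesis
            using P(2) by (simp add: mult.assoc[symmetric] ennreal_mult'[symmetric])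
        qed
        have "(\<integral>\<^sup>+t. ennreal (C * ((2 ^ j) ^ ?d * inverse (1 + (2 ^ j * (t - w \<bullet> e2))\<^sup>2) * ?G w)) \<partial>lborel)
          = (\<integral>\<^sup>+t. ennreal (C * ((2 ^ j) ^ ?d * ?G w)) * ennreal (inverse (1 + (2 ^ j * (t - w \<bullet> e2))\<^sup>2)) \<partial>lborel)"
          using C(1) by (intro nn_integral_cong) (simp add: ennreal_mult'[symmetric] block_powers_nonneg mult_ac)
        also have "\<dots> = ennreal (C * ((2 ^ j) ^ ?d * ?G w)) * ennreal (P / 2 ^ j)"
          by (subst nn_integral_cmult) (auto simp: I')
        also have "\<dots> = ennreal (C * (P / 2 ^ j)) * (ennreal ((2 ^ j) ^ ?d) * ennreal (?G w))"
          using C(1) P(2) by (simp add: ennreal_mult'[symmetric] block_powers_nonneg mult_ac)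
        finally show "(\<integral>\<^sup>+t. ennreal (C * ((2 ^ j) ^ ?d * inverse (1 + (2 ^ j * (t - w \<bullet> e2))\<^sup>2) * ?G w)) \<partial>lborel)
          = ennreal (C * (P / 2 ^ j)) * (ennreal ((2 ^ j) ^ ?d) * ennreal (?G w))" .
      qed
      also have "\<dots> = ennreal (C * (P / 2 ^ j)) * (ennreal ((2 ^ j) ^ ?d) * (\<integral>\<^sup>+w. ennreal (?G w) \<partial>lborel))"
        by (simp add: nn_integral_cmult)
      also have "\<dots> \<le> ennreal (C * (P / 2 ^ j)) * ennreal (2 ^ ?d * ?A powr p)"
        by (intro mult_left_mono Gint) auto
      also have "\<dots> = ennreal (C * (P / 2 ^ j) * (2 ^ ?d * ?A powr p))"
        using C(1) P(2) by (subst ennreal_mult') auto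
      also have "ennreal r * ennreal (norm (?f x) powr p) = ennreal (r * norm (?f x) powr p)"
        using r by (subst ennreal_mult') auto
      finally have "r * norm (?f x) powr p \<le> C * (P / 2 ^ j) * (2 ^ ?d * ?A powr p)"
        using C(1) P(2) by (subst (asm) ennreal_le_iff) auto
      then have "2 ^ j * (r * norm (?f x) powr p) \<le> 2 ^ j * (C * (P / 2 ^ j) * (2 ^ ?d * ?A powr p))"
        by (rule mult_left_mono) simp
      also have "\<dots> = (C * P * 2 ^ ?d) * ?A powr p" by simp
      also have "\<dots> \<le> D * ?A powr p"
        unfolding D_def using C(1) P(2) by (intro mult_right_mono mult_left_mono) auto
      finally show ?thesis by (simp only: mult.assoc)
    qed
    have "norm (?f x) \<le> D powr (1 / p) * 1 powr (- 1 / p) * ?A"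
      by (rule le_powr_root[OF p _ A0]) (use D b1 in auto)
    then have "norm (?f x) \<le> D powr (1 / p) * ?A" by (simp only: powr_one_eq_one mult_1_right)
    moreover have "norm (?f x) \<le> D powr (1 / p) * (2 ^ j * norm x) powr (- 1 / p) * ?A"
      unfolding r_def[symmetric] by (rule le_powr_root[OF p _ A0 _ _ b2]) (use D r in auto)
    moreover have "y \<le> c * min 1 z * b" if "y \<le> c * b" "y \<le> c * z * b" for y c z b :: real
      using that by (simp add: min_def)
    ultimately show "norm (?f x) \<le> D powr (1 / p) * min 1 ((2 ^ j * norm x) powr (- 1 / p)) * ?A"
      by blast
  qed
qed

text \<open>F dominates the normalised blocks of all scales at once, so it can be taken out of the
  sum over j. The dilated profiles that remain sum to at most 4 at every point, whence no dependence
  on n.\<close>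

lemma sum_radial_block_powers_le:
  fixes \<phi> \<psi> :: "'a::euclidean_space \<Rightarrow> complex"
  assumes \<phi>: "lp_generator \<phi>" and \<psi>: "radial_generator \<psi>"
    and p: "p \<ge> 1"
  shows "\<exists>C>0. \<forall>T F n x. tempered_distribution T \<longrightarrow> F \<in> borel_measurable borel \<longrightarrow>
      (\<forall>i w. ennreal ((2 ^ i) ^ DIM('a) * norm (lp_block \<phi> i T w) powr p) \<le> F w) \<longrightarrow>
      ennreal (\<Sum>j<n. norm (radial_block \<psi> j T x) powr p) \<le> ennreal C * (\<integral>\<^sup>+w. F w \<partial>lborel)"
proof -
  from radial_block_power_bound[OF \<phi> \<psi> p]
  obtain C where "C > 0" and bound: "\<forall>T j x. tempered_distribution T \<longrightarrow>
    ennreal (norm (radial_block \<psi> j T x) powr p) \<le>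
      ennreal C * (\<integral>\<^sup>+w. ennreal ((2 ^ j) ^ DIM('a) * profile (2 ^ j *\<^sub>R (x - w)) * block_powers \<phi> p j T w) \<partial>lborel)"
    by (elim exE conjE)
  note C = \<open>C > 0\<close> bound[rule_format]
  let ?d = "DIM('a)"
  show ?thesis
  \<comment> \<open>One 4 bounds the sum of the dilated profiles, the other the number of blocks in
    a window; 2^d is the change of scale inside a window.\<close>
  proof (intro exI[of _ "C * (4 * (4 * 2 ^ ?d))"] conjI allI impI)
    show "C * (4 * (4 * 2 ^ ?d)) > 0" using C(1) by simp
    fix T :: "'a distribution" and F :: "'a \<Rightarrow> ennreal" and n and x :: 'a
    assume T: "tempered_distribution T" and [measurable]: "F \<in> borel_measurable borel"
      and F': "\<forall>i w. ennreal ((2 ^ i) ^ ?d * norm (lp_block \<phi> i T w) powr p) \<le> F w"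
    have F: "ennreal ((2 ^ i) ^ ?d * norm (lp_block \<phi> i T w) powr p) \<le> F w" for i w
      using F' by blast
    let ?f = "\<lambda>j. radial_block \<psi> j T x"
    let ?h = "\<lambda>j w. profile (2 ^ j *\<^sub>R (x - w))"
    have G: "ennreal ((2 ^ j) ^ ?d * block_powers \<phi> p j T w) \<le> ennreal (4 * 2 ^ ?d) * F w" for j w
    proof -
      have "(2 ^ j) ^ ?d * block_powers \<phi> p j T w \<le> (\<Sum>i\<in>{j - 1..j + 2}. 2 ^ ?d * ((2 ^ i) ^ ?d * norm (lp_block \<phi> i T w) powr p))"
        unfolding block_powers_def sum_distrib_left mult.assoc[symmetric]
        by (intro sum_mono mult_right_mono power2_dyadic_le) auto
      then have "ennreal ((2 ^ j) ^ ?d * block_powers \<phi> p j T w) \<le> (\<Sum>i\<in>{j - 1..j + 2}. ennreal (2 ^ ?d * ((2 ^ i) ^ ?d * norm (lp_block \<phi> i T w) powr p)))"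
        by (subst sum_ennreal) (auto intro: ennreal_leI)
      also have "\<dots> \<le> (\<Sum>i\<in>{j - 1..j + 2}. ennreal (2 ^ ?d) * F w)"
      proof (rule sum_mono)
        fix i
        show "ennreal (2 ^ ?d * ((2 ^ i) ^ ?d * norm (lp_block \<phi> i T w) powr p)) \<le> ennreal (2 ^ ?d) * F w"
          by (subst ennreal_mult') (auto intro!: mult_left_mono F)
      qed
      also have "\<dots> \<le> ennreal 4 * (ennreal (2 ^ ?d) * F w)"
      proof -
        have "card {j - 1..j + 2} \<le> 4" by simp
        from of_nat_mono[OF this, where 'a=ennreal] have "of_nat (card {j - 1..j + 2}) \<le> ennreal 4"
          by (simp only: of_nat_numeral ennreal_numeral)
        then show ?thesis by (simp only: sum_constant) (rule mult_right_mono, auto)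
      qed
      finally show ?thesis by (simp add: ennreal_mult' mult.assoc)
    qed
    have single: "ennreal (norm (?f j) powr p) \<le> ennreal (C * (4 * 2 ^ ?d)) * (\<integral>\<^sup>+w. ennreal (?h j w) * F w \<partial>lborel)" for j
    proof -
      have "ennreal (norm (?f j) powr p) \<le> ennreal C * (\<integral>\<^sup>+w. ennreal ((2 ^ j) ^ ?d * ?h j w * block_powers \<phi> p j T w) \<partial>lborel)"
        by (rule C(2)[OF T])
      also have "\<dots> \<le> ennreal C * (\<integral>\<^sup>+w. ennreal (4 * 2 ^ ?d) * (ennreal (?h j w) * F w) \<partial>lborel)"
      proof (intro mult_left_mono nn_integral_mono)
        fix w
        have "ennreal ((2 ^ j) ^ ?d * ?h j w * block_powers \<phi> p j T w) = ennreal (?h j w) * ennreal ((2 ^ j) ^ ?d * block_powers \<phi> p j T w)"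
          by (simp add: ennreal_mult'[symmetric] profile_nonneg mult_ac)
        also have "\<dots> \<le> ennreal (?h j w) * (ennreal (4 * 2 ^ ?d) * F w)"
          by (intro mult_left_mono G) auto
        finally show "ennreal ((2 ^ j) ^ ?d * ?h j w * block_powers \<phi> p j T w) \<le> ennreal (4 * 2 ^ ?d) * (ennreal (?h j w) * F w)"
          by (simp only: mult_ac)
      qed auto
      also have "\<dots> = ennreal (C * (4 * 2 ^ ?d)) * (\<integral>\<^sup>+w. ennreal (?h j w) * F w \<partial>lborel)"
        using C(1) by (subst nn_integral_cmult) (auto simp: ennreal_mult' mult.assoc)
      finally show ?thesis .
    qed
    \<comment> \<open>At w = x every profile vanishes. Here the vanishing integral of \<psi> pays
      off: kernels that are nonzero at the origin would contribute a term of fixed size for each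
      j.\<close>
    have hsum: "(\<Sum>j<n. ?h j w) \<le> 4" for w
    proof (cases "w = x")
      case True
      then show ?thesis by (simp add: profile_def)
    next
      case False
      have "(\<Sum>j<n. ?h j w) \<le> (\<Sum>j<n. min (2 ^ j * norm (x - w)) (1 / (2 ^ j * norm (x - w))))"
      proof (rule sum_mono)
        fix j
        show "?h j w \<le> min (2 ^ j * norm (x - w)) (1 / (2 ^ j * norm (x - w)))"
          using profile_le_min[of "2 ^ j *\<^sub>R (x - w)"] False by simp
      qed
      also have "\<dots> \<le> 4" using False by (intro sum_min_dyadic_le) auto
      finally show ?thesis .
    qed
    have "ennreal (\<Sum>j<n. norm (?f j) powr p) = (\<Sum>j<n. ennreal (norm (?f j) powr p))"
      by (subst sum_ennreal) auto
    also have "\<dots> \<le> (\<Sum>j<n. ennreal (C * (4 * 2 ^ ?d)) * (\<integral>\<^sup>+w. ennreal (?h j w) * F w \<partial>lborel))"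
      by (intro sum_mono single)
    also have "\<dots> = ennreal (C * (4 * 2 ^ ?d)) * (\<integral>\<^sup>+w. (\<Sum>j<n. ennreal (?h j w) * F w) \<partial>lborel)"
      by (subst nn_integral_sum) (auto simp: sum_distrib_left)
    also have "\<dots> \<le> ennreal (C * (4 * 2 ^ ?d)) * (\<integral>\<^sup>+w. ennreal 4 * F w \<partial>lborel)"
    proof (intro mult_left_mono nn_integral_mono)
      fix w
      have "(\<Sum>j<n. ennreal (?h j w) * F w) = ennreal (\<Sum>j<n. ?h j w) * F w"
        by (simp add: sum_distrib_right[symmetric] profile_nonneg)
      also have "\<dots> \<le> ennreal 4 * F w" by (intro mult_right_mono ennreal_leI hsum) auto
      finally show "(\<Sum>j<n. ennreal (?h j w) * F w) \<le> ennreal 4 * F w" .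
    qed auto
    also have "\<dots> = ennreal (C * (4 * (4 * 2 ^ ?d))) * (\<integral>\<^sup>+w. F w \<partial>lborel)"
      using C(1) by (subst nn_integral_cmult) (auto simp: ennreal_mult' mult_ac)
    finally show "ennreal (\<Sum>j<n. norm (?f j) powr p) \<le> ennreal (C * (4 * (4 * 2 ^ ?d))) * (\<integral>\<^sup>+w. F w \<partial>lborel)" .
  qed
qed

section \<open>Nikolskii's inequality\<close>

lemma power_weight_le:
  fixes x y w :: "'a::real_normed_vector"
  assumes "R \<ge> 0"
  shows "(1 + R * norm (x - w)) ^ N \<le> (1 + R * norm (x - y)) ^ N * (1 + R * norm (y - w)) ^ N"
proof -
  have "norm (x - w) \<le> norm (x - y) + norm (y - w)"
    using norm_triangle_ineq[of "x - y" "y - w"] by simp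
  from mult_left_mono[OF this assms]
  have "R * norm (x - w) \<le> R * norm (x - y) + R * norm (y - w)"
    by (simp add: distrib_left)
  also have "\<dots> \<le> R * norm (x - y) + R * norm (y - w) + (R * norm (x - y)) * (R * norm (y - w))"
    using assms by simp
  finally have "1 + R * norm (x - w) \<le> (1 + R * norm (x - y)) * (1 + R * norm (y - w))"
    by (simp add: algebra_simps)
  then have "(1 + R * norm (x - w)) ^ N \<le> ((1 + R * norm (x - y)) * (1 + R * norm (y - w))) ^ N"
    using assms by (intro power_mono) auto
  then show ?thesis by (simp add: power_mult_distrib)
qed

text \<open>With \<open>S\<close> the supremum of \<open>norm (f y) / (1 + R * norm (x - y)) ^ N\<close>, the reproducing
  formula and \<open>norm (f w) = norm (f w) powr p * norm (f w) powr (1 - p)\<close> give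
  \<open>S \<le> D * S powr (1 - p) * B\<close>. Only the finiteness of \<open>S\<close> enters, so the growth
  constant \<open>K\<close> disappears from the conclusion.\<close>

lemma powr_le_of_reproducing:
  fixes f :: "'a::euclidean_space \<Rightarrow> complex"
  assumes p: "0 < p" "p < 1" and D: "D \<ge> 0" and R: "R \<ge> 0" and B: "B \<ge> 0"
    and [measurable]: "f \<in> borel_measurable borel"
    and repr: "\<And>y. ennreal (norm (f y)) \<le> (\<integral>\<^sup>+w. ennreal (D / (1 + R * norm (y - w)) ^ N * norm (f w)) \<partial>lborel)"
    and fB: "(\<integral>\<^sup>+w. ennreal (norm (f w) powr p) \<partial>lborel) \<le> ennreal B"
    and growth: "\<And>y. norm (f y) \<le> K * (1 + R * norm (x - y)) ^ N"
  shows "norm (f x) powr p \<le> D * B"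
proof -
  define W where "W y = (1 + R * norm (x - y)) ^ N" for y
  have W: "W y \<ge> 1" for y unfolding W_def using R by (intro one_le_power) auto
  have W0: "W y > 0" for y using W[of y] by linarith
  define g where "g y = norm (f y) / W y" for y
  have bdd: "bdd_above (range g)"
    using growth W0 by (intro bdd_aboveI[of _ K]) (auto simp: g_def W_def[symmetric] pos_divide_le_eq)
  define S where "S = (SUP y. g y)"
  have gS: "g y \<le> S" for y unfolding S_def by (rule cSUP_upper[OF UNIV_I bdd])
  have fS: "norm (f y) \<le> S * W y" for y using gS[of y] W0[of y] by (simp add: g_def pos_divide_le_eq)
  have S0: "S \<ge> 0" using gS[of x] W0[of x] by (auto simp: g_def intro: order_trans[rotated])
  have xS: "norm (f x) \<le> S" using fS[of x] by (simp add: W_def)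
  show ?thesis
  proof (cases "S = 0")
    case True
    then show ?thesis using xS D B by simp
  next
    case False
    then have S: "S > 0" using S0 by simp
    have "g y \<le> D * S powr (1 - p) * B" for y
    proof -
      have "ennreal (norm (f y)) \<le> (\<integral>\<^sup>+w. ennreal (D / (1 + R * norm (y - w)) ^ N * norm (f w)) \<partial>lborel)"
        by (rule repr)
      also have "\<dots> \<le> (\<integral>\<^sup>+w. ennreal (W y * (D * S powr (1 - p))) * ennreal (norm (f w) powr p) \<partial>lborel)"
      proof (rule nn_integral_mono)
        fix w
        have V0: "(1 + R * norm (y - w)) ^ N > 0" using R by (intro zero_less_power add_pos_nonneg) auto
        have "norm (f w) = norm (f w) powr p * norm (f w) powr (1 - p)"
          by (cases "f w = 0") (auto simp flip: powr_add)
        also have "\<dots> \<le> norm (f w) powr p * (S * W w) powr (1 - p)"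
          using fS p by (intro mult_left_mono powr_mono2) auto
        also have "\<dots> \<le> norm (f w) powr p * (S powr (1 - p) * W w)"
        proof (intro mult_left_mono)
          \<comment> \<open>Since W w is at least 1, the power 1 - p may be enlarged to 1; the
            weight then splits multiplicatively and cancels the decay of the kernel.\<close>
          have "W w powr (1 - p) \<le> W w powr 1" using W p by (intro powr_mono) auto
          then have "S powr (1 - p) * W w powr (1 - p) \<le> S powr (1 - p) * W w"
            using W0[of w] by (intro mult_left_mono) auto
          then show "(S * W w) powr (1 - p) \<le> S powr (1 - p) * W w" using S0 W0[of w] by (simp add: powr_mult)
        qed auto
        also have "\<dots> \<le> norm (f w) powr p * (S powr (1 - p) * (W y * (1 + R * norm (y - w)) ^ N))"
          unfolding W_def by (intro mult_left_mono power_weight_le R) auto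
        finally have "D / (1 + R * norm (y - w)) ^ N * norm (f w)
            \<le> D / (1 + R * norm (y - w)) ^ N * (norm (f w) powr p * (S powr (1 - p) * (W y * (1 + R * norm (y - w)) ^ N)))"
          using D V0 by (intro mult_left_mono) auto
        also have "\<dots> = W y * (D * S powr (1 - p)) * norm (f w) powr p"
        proof -
          have "D / V * (b * (t * (c * V))) = c * (D * t) * b" if "V > 0" for V b t c :: real
            using that by simp
          from this[OF V0] show ?thesis .
        qed
        finally show "ennreal (D / (1 + R * norm (y - w)) ^ N * norm (f w)) \<le> ennreal (W y * (D * S powr (1 - p))) * ennreal (norm (f w) powr p)"
          using D W0[of y] by (subst ennreal_mult'[symmetric]) (auto intro: ennreal_leI)
      qed
      also have "\<dots> = ennreal (W y * (D * S powr (1 - p))) * (\<integral>\<^sup>+w. ennreal (norm (f w) powr p) \<partial>lborel)"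
        by (rule nn_integral_cmult) simp
      also have "\<dots> \<le> ennreal (W y * (D * S powr (1 - p))) * ennreal B"
        by (intro mult_left_mono fB) auto
      also have "\<dots> = ennreal (W y * (D * S powr (1 - p)) * B)"
        using D W0[of y] by (subst ennreal_mult') auto
      finally have "norm (f y) \<le> W y * (D * S powr (1 - p)) * B"
        using D W0[of y] B by (subst (asm) ennreal_le_iff) auto
      then show ?thesis using W0[of y] by (simp add: g_def pos_divide_le_eq mult_ac)
    qed
    then have "S \<le> D * S powr (1 - p) * B" unfolding S_def by (intro cSUP_least) auto
    then have "S * S powr (p - 1) \<le> D * S powr (1 - p) * B * S powr (p - 1)"
      by (rule mult_right_mono) simp
    also have "\<dots> = D * B * (S powr (1 - p) * S powr (p - 1))" by (simp only: mult_ac)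
    also have "S powr (1 - p) * S powr (p - 1) = 1" using S by (simp flip: powr_add)
    also have "S * S powr (p - 1) = S powr p" using S powr_add[of S 1 "p - 1"] by simp
    finally have "S powr p \<le> D * B" by simp
    moreover have "norm (f x) powr p \<le> S powr p" using xS p by (intro powr_mono2) auto
    ultimately show ?thesis by simp
  qed
qed

text \<open>Nikolskii's inequality from L_p to L_1, through the supremum: norm f is at most (sup
  norm f)^(1 - p) times \<open>norm f powr p\<close>. With a in the normalisation of
  \<open>block_mass\<close>, the powers of 2^i match and only a constant is lost.\<close>

lemma lp_block_L1_bound:
  fixes \<phi> :: "'a::euclidean_space \<Rightarrow> complex"
  assumes \<phi>: "lp_generator \<phi>" and p: "0 < p" "p < 1"
  shows "\<exists>C>0. \<forall>T a i. tempered_distribution T \<longrightarrow> a \<ge> 0 \<longrightarrow>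
    block_mass \<phi> p i T \<le> ennreal (a powr p / (2 ^ i) ^ DIM('a)) \<longrightarrow>
    (\<integral>\<^sup>+w. ennreal (norm (lp_block \<phi> i T w)) \<partial>lborel) \<le> ennreal (C * a / (2 ^ i) ^ DIM('a))"
proof -
  let ?d = "DIM('a)"
  have t: "test_fun \<phi>" using \<phi> by (simp add: lp_generator_def)
  have "\<exists>C. \<forall>z. (1 + norm z) ^ N * norm (kern \<phi> z) \<le> C" for N
    by (rule kern_bound[OF t])
  then obtain c where c: "(1 + norm z) ^ N * norm (kern \<phi> z) \<le> c N" for N z
    by metis
  have c0: "c N \<ge> 0" for N
    by (rule order_trans[OF _ c[of 0 N]]) simp
  define C where "C = (2 ^ ?d * c 0 + 1) powr (1 / p - 1)"
  show ?thesis
  proof (intro exI[of _ C] conjI allI impI)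
    have "2 ^ ?d * c 0 + 1 > 0" using c0[of 0] by (intro add_nonneg_pos mult_nonneg_nonneg) auto
    then show "C > 0" unfolding C_def by (metis less_irrefl powr_gt_zero)
    fix T :: "'a distribution" and a :: real and i :: nat
    assume T: "tempered_distribution T" and a: "a \<ge> 0"
      and norms: "block_mass \<phi> p i T \<le> ennreal (a powr p / (2 ^ i) ^ ?d)"
    let ?f = "lp_block \<phi> i T"
    define R :: real where "R = 2 ^ (i + 1)"
    have R: "R \<ge> 1" "R > 0" using one_le_power[of "2::real" "i + 1"] by (simp_all only: R_def) simp_all
    define B where "B = a powr p / (2 ^ i) ^ ?d"
    have B: "B \<ge> 0" by (simp add: B_def)
    have [measurable]: "?f \<in> borel_measurable borel"
      by (intro borel_measurable_continuous_onI lp_block_continuous T \<phi>)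
    have repr: "ennreal (norm (?f y)) \<le> (\<integral>\<^sup>+w. ennreal (R ^ ?d * c N / (1 + R * norm (y - w)) ^ N * norm (?f w)) \<partial>lborel)" for y N
    proof -
      let ?m = "\<lambda>\<xi>. \<phi> ((1 / 2 ^ (i + 1)) *\<^sub>R \<xi>)"
      have "ennreal (norm (?f y)) \<le> (\<integral>\<^sup>+w. ennreal (norm (kern ?m (y - w) * ?f w)) \<partial>lborel)"
        unfolding lp_block_reproducing[OF T \<phi>, of i y] by (rule ennreal_norm_integral_le)
      also have "\<dots> \<le> (\<integral>\<^sup>+w. ennreal (R ^ ?d * c N / (1 + R * norm (y - w)) ^ N * norm (?f w)) \<partial>lborel)"
      proof (intro nn_integral_mono ennreal_leI)
        fix w
        have pos: "(1 + R * norm (y - w)) ^ N > 0" using R by (intro zero_less_power add_pos_nonneg) auto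
        have "norm (kern ?m (y - w)) = R ^ ?d * norm (kern \<phi> (R *\<^sub>R (y - w)))"
          unfolding R_def by (subst kern_scale[OF t]) (auto simp: norm_mult norm_power)
        also have "\<dots> \<le> R ^ ?d * (c N / (1 + R * norm (y - w)) ^ N)"
          using c[of "R *\<^sub>R (y - w)" N] R pos by (intro mult_left_mono) (auto simp: pos_le_divide_eq mult.commute)
        finally have "norm (kern ?m (y - w)) \<le> R ^ ?d * c N / (1 + R * norm (y - w)) ^ N" by simp
        from mult_right_mono[OF this norm_ge_zero[of "?f w"]]
        show "norm (kern ?m (y - w) * ?f w) \<le> R ^ ?d * c N / (1 + R * norm (y - w)) ^ N * norm (?f w)"
          by (simp only: norm_mult)
      qed
      finally show ?thesis .
    qed
    have nB: "(\<integral>\<^sup>+w. ennreal (norm (?f w) powr p) \<partial>lborel) \<le> ennreal B" using norms by (simp add: B_def)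
    have Dn: "R ^ ?d * c N \<ge> 0" for N using R c0 by simp
    have k: "schwartz_fun (kern (lp_cutoff \<phi> i))" by (intro schwartz_fun_kern test_fun_lp_cutoff t)
    obtain K N where K: "K \<ge> 0" "\<And>y. norm (?f y) \<le> K * (1 + norm y) ^ N"
      unfolding lp_block_eq[OF \<phi> T] by (rule conv_dist_bound[OF T k]) blast
    \<comment> \<open>First pass: N is the growth order of the block and depends on T, so the
      constant is not uniform. Only boundedness of the block is kept.\<close>
    have "norm (?f x) powr p \<le> R ^ ?d * c N * B" for x
    proof (rule powr_le_of_reproducing[OF p Dn _ B _ repr nB])
      fix y
      have "1 + norm y \<le> (1 + norm x) * (1 + norm (x - y))" by (rule one_plus_norm_le)
      also have "\<dots> \<le> (1 + norm x) * (1 + R * norm (x - y))"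
        using R mult_right_mono[OF R(1) norm_ge_zero[of "x - y"]] by (intro mult_left_mono) auto
      finally have "(1 + norm y) ^ N \<le> ((1 + norm x) * (1 + R * norm (x - y))) ^ N"
        by (intro power_mono) auto
      from mult_left_mono[OF this K(1)]
      show "norm (?f y) \<le> (K * (1 + norm x) ^ N) * (1 + R * norm (x - y)) ^ N"
        using K(2)[of y] by (simp add: power_mult_distrib mult.assoc)
    qed (use R in auto)
    then have bounded: "norm (?f x) \<le> (R ^ ?d * c N * B) powr (1 / p)" for x
      using powr_mono2[of "1 / p" "norm (?f x) powr p" "R ^ ?d * c N * B"] p by (simp add: powr_powr)
    \<comment> \<open>Second pass with N = 0: boundedness is now an admissible growth bound, and the
      constant \<open>c 0\<close> no longer depends on T.\<close>
    have sup: "norm (?f x) powr p \<le> R ^ ?d * c 0 * B" for x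
      by (rule powr_le_of_reproducing[OF p Dn _ B _ repr nB]) (use R bounded in auto)
    \<comment> \<open>The summand 1 / 2^d makes Q positive. Its factor (2^i)^d cancels the
      denominator of B, so Q * B is a constant times \<open>a powr p\<close>.\<close>
    define Q where "Q = R ^ ?d * (c 0 + 1 / 2 ^ ?d)"
    have Q0: "Q > 0" unfolding Q_def using R c0[of 0] by (intro mult_pos_pos) (auto intro: add_nonneg_pos)
    have Qeq: "Q = (2 ^ ?d * c 0 + 1) * (2 ^ i) ^ ?d"
      by (simp add: Q_def R_def power_mult_distrib field_simps)
    have sup': "norm (?f x) powr p \<le> Q * B" for x
    proof (rule order_trans[OF sup])
      show "R ^ ?d * c 0 * B \<le> Q * B"
        unfolding Q_def using R B by (intro mult_right_mono mult_left_mono) auto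
    qed
    have le1: "norm (?f w) \<le> (Q * B) powr (1 / p - 1) * norm (?f w) powr p" for w
    proof (cases "?f w = 0")
      case False
      have "norm (?f w) = (norm (?f w) powr p) powr (1 / p - 1) * norm (?f w) powr p"
        using False p by (simp add: powr_powr algebra_simps flip: powr_add)
      also have "\<dots> \<le> (Q * B) powr (1 / p - 1) * norm (?f w) powr p"
        using p sup'[of w] by (intro mult_right_mono powr_mono2) (auto simp: divide_simps)
      finally show ?thesis .
    qed simp
    have "(\<integral>\<^sup>+w. ennreal (norm (?f w)) \<partial>lborel) \<le> (\<integral>\<^sup>+w. ennreal ((Q * B) powr (1 / p - 1)) * ennreal (norm (?f w) powr p) \<partial>lborel)"
      by (intro nn_integral_mono) (use le1 in \<open>auto simp: ennreal_mult'[symmetric] intro: ennreal_leI\<close>)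
    also have "\<dots> \<le> ennreal ((Q * B) powr (1 / p - 1)) * ennreal B"
      by (subst nn_integral_cmult) (auto intro!: mult_left_mono nB)
    also have "\<dots> = ennreal ((Q * B) powr (1 / p - 1) * B)" by (subst ennreal_mult') auto
    also have "(Q * B) powr (1 / p - 1) * B = C * a / (2 ^ i) ^ ?d"
    proof (cases "a = 0")
      case False
      let ?x = "(2 ^ i :: real) ^ ?d"
      have a0: "a > 0" using a False by simp
      have QB: "Q * B = (2 ^ ?d * c 0 + 1) * a powr p" by (simp add: Qeq B_def)
      have "(Q * B) powr (1 / p - 1) = C * (a powr p) powr (1 / p - 1)"
        unfolding QB C_def using c0[of 0] by (subst powr_mult) auto
      moreover have "(a powr p) powr (1 / p - 1) * a powr p = a"
        using a0 p by (simp add: powr_powr algebra_simps flip: powr_add)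
      ultimately show ?thesis by (simp add: B_def)
    qed (simp add: B_def)
    finally show "(\<integral>\<^sup>+w. ennreal (norm (?f w)) \<partial>lborel) \<le> ennreal (C * a / (2 ^ i) ^ ?d)" .
  qed
qed

section \<open>The logarithmic bound\<close>

lemma enn_powr_ennreal: "x \<ge> 0 \<Longrightarrow> enn_powr (ennreal x) a = ennreal (x powr a)"
  by (simp add: enn_powr_def)

lemma enn_powr_mono: "x \<le> y \<Longrightarrow> a > 0 \<Longrightarrow> enn_powr x a \<le> enn_powr y a"
  by (auto simp: enn_powr_def top_unique intro!: ennreal_leI powr_mono2 enn2real_mono simp: less_top)

lemma enn_powr_enn_powr:
  assumes "a > 0"
  shows "enn_powr (enn_powr x (1 / a)) a = x"
  using assms by (cases x) (auto simp: enn_powr_def powr_powr)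

lemma lq_norm_ge: "q > 0 \<Longrightarrow> a j \<le> lq_norm q a"
proof (cases "q = \<infinity>")
  case True
  then show ?thesis by (simp add: lq_norm_def SUP_upper)
next
  case False
  assume "q > 0"
  define r where "r = enn2real q"
  have r: "r > 0" using \<open>q > 0\<close> False by (simp add: r_def enn2real_positive_iff less_top)
  have "enn_powr (a j) r \<le> (\<Sum>j. enn_powr (a j) r)"
    using sum_le_suminf[of "\<lambda>j. enn_powr (a j) r" "{j}"] by simp
  then have "enn_powr (enn_powr (a j) (1 / (1 / r))) (1 / r) \<le> enn_powr (\<Sum>j. enn_powr (a j) r) (1 / r)"
    using r by (intro enn_powr_mono) auto
  then show ?thesis
    using False enn_powr_enn_powr[of "1 / r" "a j"] r by (simp add: lq_norm_def r_def)
qed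

text \<open>Hoelder's inequality for n terms: \<open>powr_sum_le\<close> with exponent q, whose root
  turns n^(q - 1) into n^(1 - 1/q). For infinite q each of the n terms is bounded by the
  norm.\<close>

lemma sum_le_lq_norm:
  fixes a :: "nat \<Rightarrow> real"
  assumes q: "q > 1" and a: "\<And>j. a j \<ge> 0" and A: "lq_norm q (\<lambda>j. ennreal (a j)) = ennreal A" "A \<ge> 0"
    and n: "n > 0"
  shows "(\<Sum>i<n. a i) \<le> real n powr inv_conj_exponent q * A"
proof (cases "q = \<infinity>")
  case True
  have "a i \<le> A" for i
    using lq_norm_ge[of q "\<lambda>j. ennreal (a j)" i] q A by (simp add: True)
  then have "(\<Sum>i<n. a i) \<le> (\<Sum>i<n. A)" by (intro sum_mono)
  then show ?thesis using True n by (simp add: inv_conj_exponent_def)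
next
  case False
  define r where "r = enn2real q"
  have qr: "q = ennreal r" using False by (simp add: r_def less_top)
  have r: "r > 1" using q unfolding qr by (simp add: ennreal_less_iff flip: ennreal_1)
  have "(\<Sum>i<n. a i powr r) \<le> A powr r"
  proof -
    have "ennreal A = enn_powr (\<Sum>j. enn_powr (ennreal (a j)) r) (1 / r)"
      using A(1) False by (simp add: lq_norm_def r_def)
    then have "ennreal (A powr r) = (\<Sum>j. ennreal (a j powr r))"
      using enn_powr_enn_powr[of r] r A(2) a by (simp add: enn_powr_ennreal flip: enn_powr_ennreal[OF A(2)])
    moreover have "(\<Sum>i<n. ennreal (a i powr r)) \<le> (\<Sum>j. ennreal (a j powr r))"
      by (rule sum_le_suminf) auto
    ultimately have "ennreal (\<Sum>i<n. a i powr r) \<le> ennreal (A powr r)" by simp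
    then show ?thesis by (simp only: ennreal_le_iff powr_ge_zero)
  qed
  moreover have "(\<Sum>i<n. a i) powr r \<le> real n powr (r - 1) * (\<Sum>i<n. a i powr r)"
    by (rule powr_sum_le) (use a r n in auto)
  ultimately have "(\<Sum>i<n. a i) powr r \<le> real n powr (r - 1) * A powr r"
    by (meson mult_left_mono order_trans powr_ge_zero)
  then have "((\<Sum>i<n. a i) powr r) powr (1 / r) \<le> (real n powr (r - 1) * A powr r) powr (1 / r)"
    using r by (intro powr_mono2) auto
  then show ?thesis
    using r A(2) False sum_nonneg[of "{..<n}" a] a
    by (simp add: powr_powr powr_mult inv_conj_exponent_def r_def[symmetric] diff_divide_distrib)
qed

text \<open>Splits the sum at \<open>2 ^ n * r \<approx> 1\<close>, where \<open>n\<close> is comparable to \<open>- ln r\<close>.\<close>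

lemma log_bound:
  fixes u :: "nat \<Rightarrow> complex" and p \<theta> :: real
  assumes p: "p > 0" and \<theta>: "0 \<le> \<theta>" "\<theta> \<le> 1" and r: "0 < r" "r \<le> 1 / 2" and A: "A \<ge> 0"
    and tail: "\<And>j. norm (u j) \<le> A * (2 ^ j * r) powr (- 1 / p)"
    and head: "\<And>n. n > 0 \<Longrightarrow> (\<Sum>j<n. norm (u j)) \<le> A * real n powr \<theta>"
  shows "(- ln r) powr (- \<theta>) * norm (\<Sum>j. u j) \<le> (4 + 2 / (1 - 2 powr (- 1 / p))) * A"
proof -
  define L where "L = - ln r"
  have L: "L \<ge> ln 2" using r ln_mono[of r "1/2"] by (simp add: L_def ln_div)
  have ln2: "ln 2 > (1 / 2 :: real)"
    using ln2_ge_two_thirds by simp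
  define \<rho> where "\<rho> = 2 powr (- 1 / p)"
  have \<rho>: "0 < \<rho>" "\<rho> < 1" using p by (auto simp: \<rho>_def powr_less_one)
  define n where "n = nat \<lceil>log 2 (1 / r)\<rceil>"
  have "2 \<le> 1 / r" using r by (simp add: pos_le_divide_eq)
  then have lg: "log 2 (1 / r) \<ge> 1" using r by (simp add: le_log_iff)
  have n1: "n > 0" using lg by (simp add: n_def)
  \<comment> \<open>Rounding up costs 1, which is at most log 2 (1 / r) since r <= 1/2; conversion
    to the natural logarithm costs another factor below 2, as ln 2 > 1/2.\<close>
  have n2: "real n \<le> 4 * L"
  proof -
    have "real n \<le> log 2 (1 / r) + 1" using lg by (simp add: n_def)
    also have "\<dots> \<le> 2 * log 2 (1 / r)" using lg by simp
    also have "\<dots> = 2 * (L / ln 2)" using r by (simp add: log_def L_def ln_div)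
    also have "\<dots> \<le> 4 * L"
    proof -
      have "L * 1 \<le> L * (2 * ln 2)" using ln2 L by (intro mult_left_mono) auto
      then show ?thesis using ln2 by (simp add: divide_simps mult_ac)
    qed
    finally show ?thesis .
  qed
  have n3: "2 ^ n * r \<ge> 1"
  proof -
    have "log 2 (1 / r) \<le> real n" by (simp add: n_def real_nat_ceiling_ge)
    then have "1 / r \<le> 2 powr real n" using r by (simp add: log_le_iff)
    then show ?thesis using r by (simp add: powr_realpow pos_divide_le_eq)
  qed
  have tail': "norm (u (j + n)) \<le> A * \<rho> ^ j" for j
  proof -
    have "norm (u (j + n)) \<le> A * (2 ^ (j + n) * r) powr (- 1 / p)" by (rule tail)
    also have "\<dots> \<le> A * (2 ^ j) powr (- 1 / p)"
    proof (intro mult_left_mono A)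
      have "2 ^ j * 1 \<le> 2 ^ j * (2 ^ n * r)" using n3 by (intro mult_left_mono) auto
      then show "(2 ^ (j + n) * r) powr (- 1 / p) \<le> (2 ^ j) powr (- 1 / p)"
        using p by (intro powr_mono2') (auto simp: power_add mult.assoc)
    qed
    also have "(2 ^ j) powr (- 1 / p) = \<rho> ^ j"
      by (simp add: \<rho>_def powr_powr powr_realpow[symmetric] powr_power mult.commute)
    finally show ?thesis .
  qed
  have geo: "summable (\<lambda>j. A * \<rho> ^ j)" "(\<Sum>j. A * \<rho> ^ j) = A / (1 - \<rho>)"
    using \<rho> by (auto simp: suminf_mult suminf_geometric summable_geometric intro!: summable_mult)
  have s1: "summable (\<lambda>j. norm (u (j + n)))"
    by (rule summable_comparison_test'[OF geo(1), of 0]) (use tail' in auto)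
  then have s2: "summable (\<lambda>j. norm (u j))" by (subst (asm) summable_iff_shift)
  have "norm (\<Sum>j. u j) \<le> (\<Sum>j. norm (u j))" by (rule summable_norm[OF s2])
  also have "\<dots> = (\<Sum>j. norm (u (j + n))) + (\<Sum>j<n. norm (u j))" by (rule suminf_split_initial_segment[OF s2])
  also have "\<dots> \<le> A / (1 - \<rho>) + A * real n powr \<theta>"
    using suminf_le[OF tail' s1 geo(1)] head[OF n1] geo(2) by linarith
  \<comment> \<open>The tail carries no logarithm. It is absorbed because L >= ln 2 > 1/2 and
    \<theta> <= 1 give 1 <= 2 * L^\<theta>; likewise 4^\<theta> <= 4 in the head.\<close>
  also have "\<dots> \<le> (2 / (1 - \<rho>) * A) * L powr \<theta> + (4 * A) * L powr \<theta>"
  proof (rule add_mono)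
    have "(1 / 2) powr \<theta> \<le> L powr \<theta>" using L ln2 \<theta> by (intro powr_mono2) auto
    moreover have "(1 / 2 :: real) powr 1 \<le> (1 / 2) powr \<theta>" using \<theta> by (intro powr_mono') auto
    ultimately have "1 \<le> 2 * L powr \<theta>" by simp
    then have "A / (1 - \<rho>) * 1 \<le> A / (1 - \<rho>) * (2 * L powr \<theta>)"
      using A \<rho> by (intro mult_left_mono) auto
    then show "A / (1 - \<rho>) \<le> (2 / (1 - \<rho>) * A) * L powr \<theta>" by (simp add: mult_ac)
    have "real n powr \<theta> \<le> (4 * L) powr \<theta>" using n2 \<theta> by (intro powr_mono2) auto
    also have "\<dots> = 4 powr \<theta> * L powr \<theta>" by (rule powr_mult)
    also have "\<dots> \<le> 4 powr 1 * L powr \<theta>" using \<theta> by (intro mult_right_mono powr_mono) auto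
    finally have "A * real n powr \<theta> \<le> A * (4 * L powr \<theta>)" using A by (intro mult_left_mono) auto
    then show "A * real n powr \<theta> \<le> (4 * A) * L powr \<theta>" by (simp add: mult_ac)
  qed
  also have "\<dots> = ((4 + 2 / (1 - \<rho>)) * A) * L powr \<theta>" by (simp add: algebra_simps)
  finally have "L powr (- \<theta>) * norm (\<Sum>j. u j) \<le> L powr (- \<theta>) * (((4 + 2 / (1 - \<rho>)) * A) * L powr \<theta>)"
    by (rule mult_left_mono) simp
  also have "\<dots> = ((4 + 2 / (1 - \<rho>)) * A) * (L powr (- \<theta>) * L powr \<theta>)" by (simp only: mult_ac)
  also have "L powr (- \<theta>) * L powr \<theta> = 1" using L ln2 by (simp flip: powr_add)
  finally show ?thesis by (simp add: L_def \<rho>_def)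
qed

text \<open>The common end of both cases. The decay hypothesis serves twice, for uniform convergence
  away from the origin and for the tail of the series; the head hypothesis carries the exponent
  \<theta>.\<close>

lemma radial_series_log_bound:
  fixes \<psi> :: "'a::euclidean_space \<Rightarrow> complex"
  assumes T: "tempered_distribution T" and \<psi>: "radial_generator \<psi>"
    and p: "p > 0" and \<theta>: "0 \<le> \<theta>" "\<theta> \<le> 1" and M: "M \<ge> 0"
    and decay: "\<And>j x. x \<noteq> 0 \<Longrightarrow> norm (radial_block \<psi> j T x) \<le> M * (2 ^ j * norm x) powr (- 1 / p)"
    and head: "\<And>n x. n > 0 \<Longrightarrow> x \<noteq> 0 \<Longrightarrow> (\<Sum>j<n. norm (radial_block \<psi> j T x)) \<le> M * real n powr \<theta>"
  shows "\<exists>g. agrees_with_on (- {0}) T g \<and> (\<forall>x. 0 < norm x \<and> norm x \<le> 1/2 \<longrightarrow>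
    (- ln (norm x)) powr (- \<theta>) * norm (g x) \<le> (4 + 2 / (1 - 2 powr (- 1 / p))) * M)"
proof (intro exI conjI allI impI)
  show "agrees_with_on (- {0}) T (\<lambda>x. \<Sum>j. radial_block \<psi> j T x)"
  proof (rule agrees_with_radial_series[OF T])
    show "test_fun \<psi>" "\<psi> 0 = 1" using \<psi> by (auto simp: radial_generator_def)
    fix r :: real assume r: "r > 0"
    define \<rho> where "\<rho> = 2 powr (- 1 / p)"
    have \<rho>: "0 < \<rho>" "\<rho> < 1" using p by (auto simp: \<rho>_def powr_less_one)
    have "summable (\<lambda>j. M * r powr (- 1 / p) * \<rho> ^ j)"
      using \<rho> by (intro summable_mult summable_geometric) auto
    moreover have "norm (radial_block \<psi> j T x) \<le> M * r powr (- 1 / p) * \<rho> ^ j" if x: "r \<le> norm x" for j x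
    proof -
      have "norm (radial_block \<psi> j T x) \<le> M * (2 ^ j * norm x) powr (- 1 / p)"
        using x r by (intro decay) auto
      also have "\<dots> \<le> M * (2 ^ j * r) powr (- 1 / p)"
        using x r p M by (intro mult_left_mono powr_mono2') auto
      also have "(2 ^ j * r) powr (- 1 / p) = r powr (- 1 / p) * \<rho> ^ j"
        using r by (simp add: powr_mult \<rho>_def powr_powr powr_realpow[symmetric] powr_power mult.commute)
      finally show ?thesis by (simp only: mult.assoc)
    qed
    ultimately show "\<exists>M. summable M \<and> (\<forall>j x. r \<le> norm x \<longrightarrow> norm (radial_block \<psi> j T x) \<le> M j)"
      by (intro exI[of _ "\<lambda>j. M * r powr (- 1 / p) * \<rho> ^ j"]) auto
  qed
  fix x :: 'a assume x: "0 < norm x \<and> norm x \<le> 1/2"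
  show "(- ln (norm x)) powr (- \<theta>) * norm (\<Sum>j. radial_block \<psi> j T x) \<le> (4 + 2 / (1 - 2 powr (- 1 / p))) * M"
    by (rule log_bound[OF p \<theta> _ _ M]) (use x decay head in auto)
qed

text \<open>After exchanging the sums, an index i lies only in the windows of j between i - 2 and i
  + 1, which are at most four.\<close>

lemma sum_dyadic_windows_le:
  fixes a :: "nat \<Rightarrow> real"
  assumes a: "\<And>i. a i \<ge> 0"
  shows "(\<Sum>j<n. \<Sum>i\<in>{j - 1..j + 2}. a i) \<le> 4 * (\<Sum>i<n + 2. a i)"
proof -
  have "(\<Sum>i\<in>{j - 1..j + 2}. a i) = (\<Sum>i<n + 2. if i \<in> {j - 1..j + 2} then a i else 0)" if "j < n" for j
  proof -
    have "{..<n + 2} \<inter> {j - 1..j + 2} = {j - 1..j + 2}" using that by auto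
    then show ?thesis
      using sum.inter_restrict[of "{..<n + 2}" a "{j - 1..j + 2}"] by (simp only: finite_lessThan)
  qed
  then have "(\<Sum>j<n. \<Sum>i\<in>{j - 1..j + 2}. a i) = (\<Sum>j<n. \<Sum>i<n + 2. if i \<in> {j - 1..j + 2} then a i else 0)"
    by (rule sum.cong[OF refl]) (simp only: lessThan_iff)
  also have "\<dots> = (\<Sum>i<n + 2. \<Sum>j<n. if i \<in> {j - 1..j + 2} then a i else 0)"
    by (rule sum.swap)
  also have "\<dots> \<le> (\<Sum>i<n + 2. 4 * a i)"
  proof (rule sum_mono)
    fix i
    have "(\<Sum>j<n. if i \<in> {j - 1..j + 2} then a i else 0) \<le> (\<Sum>j<n. if j \<in> {i - 2..i + 1} then a i else 0)"
      using a by (intro sum_mono) auto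
    also have "\<dots> = (\<Sum>j\<in>{..<n} \<inter> {i - 2..i + 1}. a i)"
      by (rule sum.inter_restrict[symmetric]) simp
    also have "\<dots> \<le> (\<Sum>j\<in>{i - 2..i + 1}. a i)"
      using a by (intro sum_mono2) auto
    also have "\<dots> = real (card {i - 2..i + 1}) * a i" by (rule sum_constant)
    also have "\<dots> \<le> 4 * a i" using a by (intro mult_right_mono) auto
    finally show "(\<Sum>j<n. if i \<in> {j - 1..j + 2} then a i else 0) \<le> 4 * a i" .
  qed
  finally show ?thesis by (simp only: sum_distrib_left)
qed

text \<open>Stated for an arbitrary sequence a that dominates the normalised L_p norms and satisfies
  the Hoelder bound on its partial sums; the sequence may thus come from another exponent by way of
  Nikolskii's inequality.\<close>

lemma besov_log_bound:
  fixes \<phi> :: "real ^ 'n \<Rightarrow> complex"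
  assumes \<phi>: "lp_generator \<phi>" and p: "p \<ge> 1" and d: "CARD('n) \<ge> 2" and \<theta>: "0 \<le> \<theta>" "\<theta> \<le> 1"
  shows "\<exists>C. \<forall>T a A. tempered_distribution T \<longrightarrow> radial_distribution T \<longrightarrow> A \<ge> 0 \<longrightarrow> (\<forall>i. 0 \<le> a i \<and> a i \<le> A) \<longrightarrow>
    (\<forall>n>0. (\<Sum>i<n. a i) \<le> real n powr \<theta> * A) \<longrightarrow>
    (\<forall>i. block_mass \<phi> p i T \<le> ennreal (a i powr p / (2 ^ i) ^ CARD('n))) \<longrightarrow>
    (\<exists>g. agrees_with_on (- {0}) T g \<and> (\<forall>x. 0 < norm x \<and> norm x \<le> 1/2 \<longrightarrow> (- ln (norm x)) powr (- \<theta>) * norm (g x) \<le> C * A))"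
proof -
  obtain \<psi> :: "real ^ 'n \<Rightarrow> complex" where \<psi>: "radial_generator \<psi>"
    using radial_generator_exists[OF \<phi>] by blast
  from radial_block_bound[OF \<phi> \<psi> p d]
  obtain C where C: "C > 0" and bound: "\<forall>T a j x. tempered_distribution T \<longrightarrow> radial_distribution T \<longrightarrow> (\<forall>i. a i \<ge> 0) \<longrightarrow>
      (\<forall>i. block_mass \<phi> p i T \<le> ennreal (a i powr p / (2 ^ i) ^ CARD('n))) \<longrightarrow>
      x \<noteq> 0 \<longrightarrow> norm (radial_block \<psi> j T x) \<le> C * min 1 ((2 ^ j * norm x) powr (- 1 / p)) * (\<Sum>i\<in>{j - 1..j + 2}. a i)"
    by (elim exE conjE)
  show ?thesis
  \<comment> \<open>12 = 4 * 3: an index lies in at most four windows, and n + 2 <= 3 n costs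
    3^\<theta> <= 3. The tail needs only the 4, from the size of one window.\<close>
  proof (intro exI[of _ "(4 + 2 / (1 - 2 powr (- 1 / p))) * (12 * C)"] allI impI)
    fix T :: "(real ^ 'n) distribution" and a :: "nat \<Rightarrow> real" and A :: real
    assume T: "tempered_distribution T" "radial_distribution T" and A: "A \<ge> 0" and a: "\<forall>i. 0 \<le> a i \<and> a i \<le> A"
      and sums: "\<forall>n>0. (\<Sum>i<n. a i) \<le> real n powr \<theta> * A"
      and norms: "\<forall>i. block_mass \<phi> p i T \<le> ennreal (a i powr p / (2 ^ i) ^ CARD('n))"
    define f where "f j x = norm (radial_block \<psi> j T x)" for j x
    define S where "S j = (\<Sum>i\<in>{j - 1..j + 2}. a i)" for j
    have S0: "S j \<ge> 0" for j unfolding S_def using a by (intro sum_nonneg) auto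
    have S4: "S j \<le> 4 * A" for j
    proof -
      have "S j \<le> (\<Sum>i\<in>{j - 1..j + 2}. A)" unfolding S_def using a by (intro sum_mono) auto
      also have "\<dots> = real (card {j - 1..j + 2}) * A" by (rule sum_constant)
      also have "\<dots> \<le> 4 * A" using A by (intro mult_right_mono) auto
      finally show ?thesis .
    qed
    have fb: "f j x \<le> C * min 1 ((2 ^ j * norm x) powr (- 1 / p)) * S j" if "x \<noteq> 0" for j x
      unfolding f_def S_def using bound T a norms that by blast
    have f1: "f j x \<le> C * S j" if "x \<noteq> 0" for j x
    proof -
      have "C * min 1 ((2 ^ j * norm x) powr (- 1 / p)) * S j \<le> C * 1 * S j"
        using C S0 by (intro mult_right_mono mult_left_mono) auto
      then show ?thesis using fb[OF that, of j] by simp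
    qed
    have "\<exists>g. agrees_with_on (- {0}) T g \<and> (\<forall>x. 0 < norm x \<and> norm x \<le> 1/2 \<longrightarrow>
      (- ln (norm x)) powr (- \<theta>) * norm (g x) \<le> (4 + 2 / (1 - 2 powr (- 1 / p))) * (12 * C * A))"
    proof (rule radial_series_log_bound[OF T(1) \<psi> _ \<theta>])
      show "p > 0" using p by simp
      show "0 \<le> 12 * C * A" using C A by simp
      fix x :: "real ^ 'n" assume x: "x \<noteq> 0"
      show "norm (radial_block \<psi> j T x) \<le> 12 * C * A * (2 ^ j * norm x) powr (- 1 / p)" for j
      proof -
        have "C * min 1 ((2 ^ j * norm x) powr (- 1 / p)) * S j \<le> C * (2 ^ j * norm x) powr (- 1 / p) * (4 * A)"
          using C S0 S4 by (intro mult_mono mult_left_mono) auto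
        also have "\<dots> \<le> C * (2 ^ j * norm x) powr (- 1 / p) * (12 * A)"
          using C A by (intro mult_left_mono) auto
        finally show ?thesis using fb[OF x, of j] by (simp add: f_def mult_ac)
      qed
      show "(\<Sum>j<n. norm (radial_block \<psi> j T x)) \<le> 12 * C * A * real n powr \<theta>" if n: "n > 0" for n
      proof -
        have "(\<Sum>j<n. f j x) \<le> (\<Sum>j<n. C * S j)" by (intro sum_mono f1 x)
        also have "\<dots> = C * (\<Sum>j<n. S j)" by (simp only: sum_distrib_left)
        also have "\<dots> \<le> C * (4 * (\<Sum>i<n + 2. a i))"
          unfolding S_def using C a by (intro mult_left_mono sum_dyadic_windows_le) auto
        also have "\<dots> \<le> C * (4 * (real (n + 2) powr \<theta> * A))"
          by (intro mult_left_mono sums[rule_format]) (use C in auto)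
        also have "\<dots> \<le> C * (4 * (3 * real n powr \<theta> * A))"
        proof (intro mult_left_mono mult_right_mono)
          have "real (n + 2) powr \<theta> \<le> (3 * real n) powr \<theta>" using n \<theta> by (intro powr_mono2) auto
          also have "\<dots> = 3 powr \<theta> * real n powr \<theta>" by (simp add: powr_mult)
          also have "\<dots> \<le> 3 powr 1 * real n powr \<theta>" using \<theta> by (intro mult_right_mono powr_mono) auto
          finally show "real (n + 2) powr \<theta> \<le> 3 * real n powr \<theta>" by simp
        qed (use C A in auto)
        finally show ?thesis by (simp add: f_def mult_ac)
      qed
    qed
    then show "\<exists>g. agrees_with_on (- {0}) T g \<and> (\<forall>x. 0 < norm x \<and> norm x \<le> 1/2 \<longrightarrow>
      (- ln (norm x)) powr (- \<theta>) * norm (g x) \<le> (4 + 2 / (1 - 2 powr (- 1 / p))) * (12 * C) * A)"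
      by (simp only: mult.assoc)
  qed
qed

text \<open>F majorises every normalised block, so its integral bounds all block norms by the same
  A, which gives the tail. For the head the p-th powers are already summable, and n enters only
  through Hoelder's inequality for n terms.\<close>

lemma triebel_log_bound:
  fixes \<phi> :: "real ^ 'n \<Rightarrow> complex"
  assumes \<phi>: "lp_generator \<phi>" and p: "p > 1" and d: "CARD('n) \<ge> 2"
  shows "\<exists>C. \<forall>T F A. tempered_distribution T \<longrightarrow> radial_distribution T \<longrightarrow> A \<ge> 0 \<longrightarrow> F \<in> borel_measurable borel \<longrightarrow>
    (\<forall>i w. ennreal ((2 ^ i) ^ CARD('n) * norm (lp_block \<phi> i T w) powr p) \<le> F w) \<longrightarrow>
    (\<integral>\<^sup>+w. F w \<partial>lborel) \<le> ennreal (A powr p) \<longrightarrow>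
    (\<exists>g. agrees_with_on (- {0}) T g \<and> (\<forall>x. 0 < norm x \<and> norm x \<le> 1/2 \<longrightarrow> (- ln (norm x)) powr (- (1 - 1 / p)) * norm (g x) \<le> C * A))"
proof -
  have p1: "p \<ge> 1" using p by simp
  obtain \<psi> :: "real ^ 'n \<Rightarrow> complex" where \<psi>: "radial_generator \<psi>"
    using radial_generator_exists[OF \<phi>] by blast
  from radial_block_bound[OF \<phi> \<psi> p1 d]
  obtain C where C: "C > 0" and bound: "\<forall>T a j x. tempered_distribution T \<longrightarrow> radial_distribution T \<longrightarrow> (\<forall>i. a i \<ge> 0) \<longrightarrow>
      (\<forall>i. block_mass \<phi> p i T \<le> ennreal (a i powr p / (2 ^ i) ^ CARD('n))) \<longrightarrow>
      x \<noteq> 0 \<longrightarrow> norm (radial_block \<psi> j T x) \<le> C * min 1 ((2 ^ j * norm x) powr (- 1 / p)) * (\<Sum>i\<in>{j - 1..j + 2}. a i)"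
    by (elim exE conjE)
  from sum_radial_block_powers_le[OF \<phi> \<psi> p1]
  obtain D where D: "D > 0" and bound2: "\<forall>T F n x. tempered_distribution T \<longrightarrow> F \<in> borel_measurable borel \<longrightarrow>
      (\<forall>i w. ennreal ((2 ^ i) ^ DIM(real ^ 'n) * norm (lp_block \<phi> i T w) powr p) \<le> F w) \<longrightarrow>
      ennreal (\<Sum>j<n. norm (radial_block \<psi> j T x) powr p) \<le> ennreal D * (\<integral>\<^sup>+w. F w \<partial>lborel)"
    by (elim exE conjE)
  \<comment> \<open>4 * C serves the tail, where the window sum of the constant sequence A is at
    most 4 * A; the other summand, the p-th root of D, serves the head.\<close>
  define M where "M = 4 * C + D powr (1 / p)"
  show ?thesis
  proof (intro exI[of _ "(4 + 2 / (1 - 2 powr (- 1 / p))) * M"] allI impI)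
    fix T :: "(real ^ 'n) distribution" and F :: "real ^ 'n \<Rightarrow> ennreal" and A :: real
    assume T: "tempered_distribution T" "radial_distribution T" and A: "A \<ge> 0" and Fm: "F \<in> borel_measurable borel"
      and F: "\<forall>i w. ennreal ((2 ^ i) ^ CARD('n) * norm (lp_block \<phi> i T w) powr p) \<le> F w"
      and FA: "(\<integral>\<^sup>+w. F w \<partial>lborel) \<le> ennreal (A powr p)"
    have [measurable]: "lp_block \<phi> i T \<in> borel_measurable borel" for i
      by (intro borel_measurable_continuous_onI lp_block_continuous T \<phi>)
    have norms: "block_mass \<phi> p i T \<le> ennreal (A powr p / (2 ^ i) ^ CARD('n))" for i
    proof -
      let ?I = "\<integral>\<^sup>+w. ennreal (norm (lp_block \<phi> i T w) powr p) \<partial>lborel" and ?c = "(2 ^ i :: real) ^ CARD('n)"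
      have "ennreal ?c * ?I = (\<integral>\<^sup>+w. ennreal (?c * norm (lp_block \<phi> i T w) powr p) \<partial>lborel)"
        by (subst nn_integral_cmult[symmetric]) (auto simp: ennreal_mult' intro!: nn_integral_cong)
      also have "\<dots> \<le> (\<integral>\<^sup>+w. F w \<partial>lborel)" using F by (intro nn_integral_mono) auto
      also have "\<dots> \<le> ennreal (A powr p)" by (rule FA)
      finally have "ennreal (1 / ?c) * (ennreal ?c * ?I) \<le> ennreal (1 / ?c) * ennreal (A powr p)"
        by (rule mult_left_mono) simp
      moreover have "ennreal (1 / ?c) * (ennreal ?c * ?I) = ?I"
        by (simp add: mult.assoc[symmetric] ennreal_mult'[symmetric])
      moreover have "ennreal (1 / ?c) * ennreal (A powr p) = ennreal (A powr p / ?c)"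
        by (subst ennreal_mult'[symmetric]) auto
      ultimately show ?thesis by simp
    qed
    have "\<exists>g. agrees_with_on (- {0}) T g \<and> (\<forall>x. 0 < norm x \<and> norm x \<le> 1/2 \<longrightarrow>
      (- ln (norm x)) powr (- (1 - 1 / p)) * norm (g x) \<le> (4 + 2 / (1 - 2 powr (- 1 / p))) * (M * A))"
    proof (rule radial_series_log_bound[OF T(1) \<psi>])
      show "p > 0" "0 \<le> 1 - 1 / p" "1 - 1 / p \<le> 1" using p by auto
      show "0 \<le> M * A" unfolding M_def using C A by simp
      fix x :: "real ^ 'n" assume x: "x \<noteq> 0"
      define f where "f j = norm (radial_block \<psi> j T x)" for j
      show "norm (radial_block \<psi> j T x) \<le> M * A * (2 ^ j * norm x) powr (- 1 / p)" for j
      proof -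
        have "f j \<le> C * min 1 ((2 ^ j * norm x) powr (- 1 / p)) * (\<Sum>i\<in>{j - 1..j + 2}. A)"
          unfolding f_def by (rule bound[rule_format, where a="\<lambda>_. A"]) (use T A norms x in auto)
        also have "(\<Sum>i\<in>{j - 1..j + 2}. A) = real (card {j - 1..j + 2}) * A" by (rule sum_constant)
        also have "C * min 1 ((2 ^ j * norm x) powr (- 1 / p)) * \<dots> \<le> C * (2 ^ j * norm x) powr (- 1 / p) * (4 * A)"
          using C A by (intro mult_mono mult_left_mono) auto
        also have "\<dots> = (4 * C) * (A * (2 ^ j * norm x) powr (- 1 / p))" by simp
        also have "\<dots> \<le> M * (A * (2 ^ j * norm x) powr (- 1 / p))"
          unfolding M_def using A by (intro mult_right_mono) auto
        finally show ?thesis by (simp add: f_def mult.assoc)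
      qed
      show "(\<Sum>j<n. norm (radial_block \<psi> j T x)) \<le> M * A * real n powr (1 - 1 / p)" if n: "n > 0" for n
      proof -
        have "ennreal (\<Sum>j<n. f j powr p) \<le> ennreal D * (\<integral>\<^sup>+w. F w \<partial>lborel)"
          unfolding f_def using bound2 T(1) Fm F by simp
        also have "\<dots> \<le> ennreal D * ennreal (A powr p)" by (intro mult_left_mono FA) auto
        also have "\<dots> = ennreal (D * A powr p)" using D by (subst ennreal_mult') auto
        finally have "(\<Sum>j<n. f j powr p) \<le> D * A powr p"
          using D by (subst (asm) ennreal_le_iff) auto
        then have "real n powr (p - 1) * (\<Sum>j<n. f j powr p) \<le> real n powr (p - 1) * (D * A powr p)"
          by (rule mult_left_mono) simp
        moreover have "(\<Sum>j<n. f j) powr p \<le> real n powr (p - 1) * (\<Sum>j<n. f j powr p)"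
          by (rule powr_sum_le) (use p n in \<open>auto simp: f_def\<close>)
        ultimately have "1 * (\<Sum>j<n. f j) powr p \<le> (real n powr (p - 1) * D) * A powr p"
          by (simp add: mult.assoc)
        then have "(\<Sum>j<n. f j) \<le> (real n powr (p - 1) * D) powr (1 / p) * 1 powr (- 1 / p) * A"
          using D A p by (intro le_powr_root) (auto simp: f_def intro: sum_nonneg)
        also have "\<dots> = D powr (1 / p) * (A * real n powr (1 - 1 / p))"
          using D p by (simp add: powr_mult powr_powr diff_divide_distrib)
        also have "\<dots> \<le> M * (A * real n powr (1 - 1 / p))"
          unfolding M_def using A C by (intro mult_right_mono) auto
        finally show ?thesis by (simp add: f_def mult.assoc)
      qed
    qed
    then show "\<exists>g. agrees_with_on (- {0}) T g \<and> (\<forall>x. 0 < norm x \<and> norm x \<le> 1/2 \<longrightarrow>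
      (- ln (norm x)) powr (- (1 - 1 / p)) * norm (g x) \<le> (4 + 2 / (1 - 2 powr (- 1 / p))) * M * A)"
      by (simp only: mult.assoc)
  qed
qed

text \<open>Here the critical value of s enters: the p-th power of the weight is the Jacobian of
  dilation by 2^i, matching the normalisation of \<open>block_mass\<close>.\<close>

lemma dyadic_powr:
  assumes "p > 0" "s = real d / p"
  shows "(2 powr (real i * s)) powr p = (2 ^ i) ^ d"
  using assms by (simp add: powr_powr powr_realpow[symmetric] power_mult[symmetric] flip: of_nat_mult)

theorem theorem14:
  fixes \<phi>\<^sub>0 :: "real ^ 'n \<Rightarrow> complex" and p s :: real and q :: ennreal
  assumes "CARD('n) \<ge> 2"
    and "lp_generator \<phi>\<^sub>0"
    and "0 < p" and "0 < q"
    and "s = real CARD('n) / p"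
  shows "(1 < q \<longrightarrow>
           (\<exists>c::real. \<forall>f \<in> radial_part (besov_space \<phi>\<^sub>0 s p q).
              \<exists>g. agrees_with_on (- {0}) f g \<and>
                (\<forall>x. 0 < norm x \<and> norm x \<le> 1/2 \<longrightarrow>
                   (- ln (norm x)) powr (- inv_conj_exponent q) * norm (g x)
                     \<le> c * enn2real (besov_norm \<phi>\<^sub>0 s p q f)))) \<and>
         (1 < p \<longrightarrow>
           (\<exists>c::real. \<forall>f \<in> radial_part (triebel_space \<phi>\<^sub>0 s p q).
              \<exists>g. agrees_with_on (- {0}) f g \<and>
                (\<forall>x. 0 < norm x \<and> norm x \<le> 1/2 \<longrightarrow>
                   (- ln (norm x)) powr (- inv_conj_exponent (ennreal p)) * norm (g x)
                     \<le> c * enn2real (triebel_norm \<phi>\<^sub>0 s p q f))))"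
proof (intro conjI impI)
  note d = assms(1) and \<phi> = assms(2) and p = assms(3) and q0 = assms(4) and s = assms(5)
  assume q: "1 < q"
  define \<theta> where "\<theta> = inv_conj_exponent q"
  have \<theta>: "0 \<le> \<theta>" "\<theta> \<le> 1"
  proof -
    have "q = \<infinity> \<or> (\<exists>r. q = ennreal r \<and> 1 < r)"
      using q by (cases q) (auto simp: ennreal_less_iff simp flip: ennreal_1)
    then show "0 \<le> \<theta>" "\<theta> \<le> 1" by (auto simp: \<theta>_def inv_conj_exponent_def)
  qed
  \<comment> \<open>Not the conjugate exponent, but the exponent at least 1 in which the pointwise
    bounds are applied.\<close>
  define p' where "p' = max p 1"
  have p': "p' \<ge> 1" by (simp add: p'_def)
  \<comment> \<open>Changing the exponent costs only a constant K in the normalisation of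
    \<open>block_mass\<close>: at critical smoothness the weighted norm is invariant under the
    embedding from p to p'.\<close>
  have "\<exists>K>0. \<forall>T a i. tempered_distribution T \<longrightarrow> a \<ge> 0 \<longrightarrow>
    block_mass \<phi>\<^sub>0 p i T \<le> ennreal (a powr p / (2 ^ i) ^ CARD('n)) \<longrightarrow>
    block_mass \<phi>\<^sub>0 p' i T \<le> ennreal ((K * a) powr p' / (2 ^ i) ^ CARD('n))"
  proof (cases "p < 1")
    case True
    from lp_block_L1_bound[OF \<phi> p True] show ?thesis
    proof (elim exE conjE, intro exI conjI)
      fix K :: real assume K: "K > 0"
      then show "K > 0" .
      assume "\<forall>T a i. tempered_distribution T \<longrightarrow> a \<ge> 0 \<longrightarrow>
        block_mass \<phi>\<^sub>0 p i T \<le> ennreal (a powr p / (2 ^ i) ^ DIM(real ^ 'n)) \<longrightarrow>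
        (\<integral>\<^sup>+w. ennreal (norm (lp_block \<phi>\<^sub>0 i T w)) \<partial>lborel) \<le> ennreal (K * a / (2 ^ i) ^ DIM(real ^ 'n))"
      then show "\<forall>T a i. tempered_distribution T \<longrightarrow> a \<ge> 0 \<longrightarrow>
        block_mass \<phi>\<^sub>0 p i T \<le> ennreal (a powr p / (2 ^ i) ^ CARD('n)) \<longrightarrow>
        block_mass \<phi>\<^sub>0 p' i T \<le> ennreal ((K * a) powr p' / (2 ^ i) ^ CARD('n))"
        using True K by (simp add: p'_def)
    qed
  next
    case False
    then show ?thesis by (intro exI[of _ 1]) (simp add: p'_def)
  qed
  then obtain K where K: "K > 0" and L: "\<forall>T a i. tempered_distribution T \<longrightarrow> a \<ge> 0 \<longrightarrow>
    block_mass \<phi>\<^sub>0 p i T \<le> ennreal (a powr p / (2 ^ i) ^ CARD('n)) \<longrightarrow>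
    block_mass \<phi>\<^sub>0 p' i T \<le> ennreal ((K * a) powr p' / (2 ^ i) ^ CARD('n))"
    by (elim exE conjE)
  from besov_log_bound[OF \<phi> p' d \<theta>]
  obtain C where C: "\<forall>T a A. tempered_distribution T \<longrightarrow> radial_distribution T \<longrightarrow> A \<ge> 0 \<longrightarrow> (\<forall>i. 0 \<le> a i \<and> a i \<le> A) \<longrightarrow>
    (\<forall>n>0. (\<Sum>i<n. a i) \<le> real n powr \<theta> * A) \<longrightarrow>
    (\<forall>i. block_mass \<phi>\<^sub>0 p' i T \<le> ennreal (a i powr p' / (2 ^ i) ^ CARD('n))) \<longrightarrow>
    (\<exists>g. agrees_with_on (- {0}) T g \<and> (\<forall>x. 0 < norm x \<and> norm x \<le> 1/2 \<longrightarrow> (- ln (norm x)) powr (- \<theta>) * norm (g x) \<le> C * A))"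
    by (elim exE)
  show "\<exists>c::real. \<forall>f \<in> radial_part (besov_space \<phi>\<^sub>0 s p q).
      \<exists>g. agrees_with_on (- {0}) f g \<and>
        (\<forall>x. 0 < norm x \<and> norm x \<le> 1/2 \<longrightarrow>
           (- ln (norm x)) powr (- inv_conj_exponent q) * norm (g x)
             \<le> c * enn2real (besov_norm \<phi>\<^sub>0 s p q f))"
  proof (intro exI[of _ "C * K"] ballI)
    fix T assume "T \<in> radial_part (besov_space \<phi>\<^sub>0 s p q)"
    then have T: "tempered_distribution T" "radial_distribution T" and fin: "besov_norm \<phi>\<^sub>0 s p q T < \<infinity>"
      by (auto simp: radial_part_def besov_space_def)
    define N where "N i = Lp_norm p (\<lambda>x. ennreal (norm (lp_block \<phi>\<^sub>0 i T x)))" for i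
    define t where "t i = ennreal (2 powr (real i * s)) * N i" for i
    define A where "A = enn2real (besov_norm \<phi>\<^sub>0 s p q T)"
    have bt: "besov_norm \<phi>\<^sub>0 s p q T = lq_norm q t" by (simp add: besov_norm_def t_def[abs_def] N_def)
    have A: "lq_norm q t = ennreal A" "A \<ge> 0"
      using fin unfolding bt[symmetric] A_def by (auto simp: less_top)
    define a where "a i = enn2real (t i)" for i
    have tle: "t i \<le> ennreal A" for i using lq_norm_ge[OF q0, of t i] A(1) by simp
    have ta: "t i = ennreal (a i)" for i
      using tle[of i] unfolding a_def by (metis ennreal_enn2real_if ennreal_neq_top top.extremum_unique)
    have a: "a i \<ge> 0" "a i \<le> A" for i
      using tle[of i] A(2) unfolding ta by (simp_all add: a_def)
    \<comment> \<open>Undoes the outer root of \<open>Lp_norm\<close> and the weight; the number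
      \<open>a i\<close> is the i-th term of the sequence inside the Besov norm.\<close>
    have norms: "block_mass \<phi>\<^sub>0 p i T = ennreal (a i powr p / (2 ^ i) ^ CARD('n))" for i
    proof -
      let ?c = "2 powr (real i * s)"
      have "ennreal (1 / ?c) * (ennreal ?c * N i) = ennreal (1 / ?c) * ennreal (a i)"
        using ta[of i] by (simp add: t_def)
      then have "N i = ennreal (a i / ?c)"
        using a(1)[of i] by (simp add: mult.assoc[symmetric] ennreal_mult'[symmetric])
      then have "enn_powr (N i) p = ennreal ((a i / ?c) powr p)" using a(1)[of i] by (simp add: enn_powr_ennreal)
      also have "(a i / ?c) powr p = a i powr p / (2 ^ i) ^ CARD('n)"
        using a(1)[of i] dyadic_powr[OF p s, of i] by (simp add: powr_divide)
      also have "enn_powr (N i) p = block_mass \<phi>\<^sub>0 p i T"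
        unfolding N_def Lp_norm_def enn_powr_enn_powr[OF p] by (simp add: enn_powr_ennreal)
      finally show ?thesis .
    qed
    have sums: "(\<Sum>i<n. a i) \<le> real n powr \<theta> * A" if "n > 0" for n
      unfolding \<theta>_def by (rule sum_le_lq_norm[OF q a(1) _ A(2) that]) (simp add: A(1) flip: ta)
    have "\<exists>g. agrees_with_on (- {0}) T g \<and> (\<forall>x. 0 < norm x \<and> norm x \<le> 1/2 \<longrightarrow> (- ln (norm x)) powr (- \<theta>) * norm (g x) \<le> C * (K * A))"
    proof (rule C[rule_format, where a="\<lambda>i. K * a i"])
      show "0 \<le> K * A" using K A(2) by simp
      show "0 \<le> K * a i \<and> K * a i \<le> K * A" for i using K a by simp
      show "(\<Sum>i<n. K * a i) \<le> real n powr \<theta> * (K * A)" if "0 < n" for n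
        using mult_left_mono[OF sums[OF that], of K] K by (simp add: sum_distrib_left mult_ac)
      show "block_mass \<phi>\<^sub>0 p' i T \<le> ennreal ((K * a i) powr p' / (2 ^ i) ^ CARD('n))" for i
        by (rule L[rule_format, OF T(1) a(1)]) (simp add: norms)
    qed (use T in auto)
    then show "\<exists>g. agrees_with_on (- {0}) T g \<and>
        (\<forall>x. 0 < norm x \<and> norm x \<le> 1/2 \<longrightarrow>
           (- ln (norm x)) powr (- inv_conj_exponent q) * norm (g x)
             \<le> C * K * enn2real (besov_norm \<phi>\<^sub>0 s p q T))"
      by (simp only: \<theta>_def A_def mult.assoc)
  qed
next
  note d = assms(1) and \<phi> = assms(2) and p = assms(3) and q0 = assms(4) and s = assms(5)
  assume p1: "1 < p"
  from triebel_log_bound[OF \<phi> p1 d]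
  obtain C where C: "\<forall>T F A. tempered_distribution T \<longrightarrow> radial_distribution T \<longrightarrow> A \<ge> 0 \<longrightarrow> F \<in> borel_measurable borel \<longrightarrow>
    (\<forall>i w. ennreal ((2 ^ i) ^ CARD('n) * norm (lp_block \<phi>\<^sub>0 i T w) powr p) \<le> F w) \<longrightarrow>
    (\<integral>\<^sup>+w. F w \<partial>lborel) \<le> ennreal (A powr p) \<longrightarrow>
    (\<exists>g. agrees_with_on (- {0}) T g \<and> (\<forall>x. 0 < norm x \<and> norm x \<le> 1/2 \<longrightarrow> (- ln (norm x)) powr (- (1 - 1 / p)) * norm (g x) \<le> C * A))"
    by (elim exE)
  have inv: "inv_conj_exponent (ennreal p) = 1 - 1 / p" using p by (simp add: inv_conj_exponent_def)
  show "\<exists>c::real. \<forall>f \<in> radial_part (triebel_space \<phi>\<^sub>0 s p q).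
      \<exists>g. agrees_with_on (- {0}) f g \<and>
        (\<forall>x. 0 < norm x \<and> norm x \<le> 1/2 \<longrightarrow>
           (- ln (norm x)) powr (- inv_conj_exponent (ennreal p)) * norm (g x)
             \<le> c * enn2real (triebel_norm \<phi>\<^sub>0 s p q f))"
    unfolding inv
  proof (intro exI[of _ C] ballI)
    fix T assume "T \<in> radial_part (triebel_space \<phi>\<^sub>0 s p q)"
    then have T: "tempered_distribution T" "radial_distribution T" and fin: "triebel_norm \<phi>\<^sub>0 s p q T < \<infinity>"
      by (auto simp: radial_part_def triebel_space_def)
    have [measurable]: "lp_block \<phi>\<^sub>0 i T \<in> borel_measurable borel" for i
      by (intro borel_measurable_continuous_onI lp_block_continuous T \<phi>)
    define t where "t w i = ennreal (2 powr (real i * s)) * ennreal (norm (lp_block \<phi>\<^sub>0 i T w))" for w i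
    \<comment> \<open>The supremum over the scales is below the l_q norm for every q > 0, so one
      argument serves all q; as a countable supremum it is measurable.\<close>
    define F where "F w = (SUP i. ennreal ((2 ^ i) ^ CARD('n) * norm (lp_block \<phi>\<^sub>0 i T w) powr p))" for w
    define A where "A = enn2real (triebel_norm \<phi>\<^sub>0 s p q T)"
    have A: "triebel_norm \<phi>\<^sub>0 s p q T = ennreal A" "A \<ge> 0" using fin by (auto simp: A_def less_top)
    have F1: "ennreal ((2 ^ i) ^ CARD('n) * norm (lp_block \<phi>\<^sub>0 i T w) powr p) \<le> F w" for i w
      unfolding F_def by (rule SUP_upper) simp
    have Ft: "F w \<le> enn_powr (lq_norm q (t w)) p" for w
      unfolding F_def
    proof (rule SUP_least)
      fix i
      have "ennreal ((2 ^ i) ^ CARD('n) * norm (lp_block \<phi>\<^sub>0 i T w) powr p) = enn_powr (t w i) p"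
        using dyadic_powr[OF p s, of i] by (simp add: t_def enn_powr_ennreal powr_mult flip: ennreal_mult')
      also have "\<dots> \<le> enn_powr (lq_norm q (t w)) p" by (intro enn_powr_mono lq_norm_ge q0 p)
      finally show "ennreal ((2 ^ i) ^ CARD('n) * norm (lp_block \<phi>\<^sub>0 i T w) powr p) \<le> enn_powr (lq_norm q (t w)) p" .
    qed
    have FA: "(\<integral>\<^sup>+w. F w \<partial>lborel) \<le> ennreal (A powr p)"
    proof -
      have "(\<integral>\<^sup>+w. F w \<partial>lborel) \<le> (\<integral>\<^sup>+w. enn_powr (lq_norm q (t w)) p \<partial>lborel)"
        by (intro nn_integral_mono Ft)
      also have "\<dots> = enn_powr (triebel_norm \<phi>\<^sub>0 s p q T) p"
        unfolding triebel_norm_def Lp_norm_def enn_powr_enn_powr[OF p] t_def[abs_def] by simp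
      also have "\<dots> = ennreal (A powr p)" using A by (simp add: enn_powr_ennreal)
      finally show ?thesis .
    qed
    have "F \<in> borel_measurable borel" unfolding F_def[abs_def] by measurable
    from C[rule_format, OF T A(2) this F1 FA]
    show "\<exists>g. agrees_with_on (- {0}) T g \<and>
        (\<forall>x. 0 < norm x \<and> norm x \<le> 1/2 \<longrightarrow>
           (- ln (norm x)) powr (- (1 - 1 / p)) * norm (g x)
             \<le> C * enn2real (triebel_norm \<phi>\<^sub>0 s p q T))"
      by (simp only: A_def)
  qed
qed

end
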